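(* Let $\chi$ be an even primitive Dirichlet character of conductor $q>1$ (that is, $\chi(-1)=1$) and suppose that $\chi(2)=1$. Then $$|L(1,\chi)|\le \tfrac12\log q-0.02012 .$$
   Context: $L(z,\chi)$ denotes the Dirichlet $L$-function associated with $\chi$, and $\log$ is the natural logarithm. *)

theory Defs
  imports "HOL-Complex_Analysis.Complex_Analysis" "HOL-Number_Theory.Number_Theory"
    "HOL-Real_Asymp.Real_Asymp"
begin

text \<open>Characters are functions on the integers (rather than on the naturals), so that
  \<open>chi (-1)\<close> makes sense. The last clause makes \<open>chi 1 \<noteq> 0\<close>, hence \<open>chi 1 = 1\<close>.\<close>

definition dirichlet_character :: "nat \<Rightarrow> (int \<Rightarrow> complex) \<Rightarrow> bool" where
  "dirichlet_character q chi \<longleftrightarrow>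
     q > 0 \<and>
     (\<forall>a b. chi (a * b) = chi a * chi b) \<and>
     (\<forall>a. chi (a + int q) = chi a) \<and>
     (\<forall>a. chi a \<noteq> 0 \<longleftrightarrow> coprime a (int q))"

text \<open>Equivalently, \<open>chi\<close> is induced by a character modulo \<open>d\<close>. The set of induced moduli
  contains \<open>q\<close> itself, so the \<open>LEAST\<close> in \<open>conductor\<close> is well defined.\<close>

definition induced_modulus :: "nat \<Rightarrow> (int \<Rightarrow> complex) \<Rightarrow> nat \<Rightarrow> bool" where
  "induced_modulus q chi d \<longleftrightarrow>
     d > 0 \<and> d dvd q \<and> (\<forall>a. coprime a (int q) \<and> [a = 1] (mod int d) \<longrightarrow> chi a = 1)"

definition conductor :: "nat \<Rightarrow> (int \<Rightarrow> complex) \<Rightarrow> nat" where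
  "conductor q chi = (LEAST d. induced_modulus q chi d)"

definition primitive_dirichlet_character :: "nat \<Rightarrow> (int \<Rightarrow> complex) \<Rightarrow> bool" where
  "primitive_dirichlet_character q chi \<longleftrightarrow> dirichlet_character q chi \<and> conductor q chi = q"

text \<open>The sum is the limit of the partial sums in increasing order of \<open>n\<close>; it is used here where it
  need not converge absolutely. For a non-principal character it converges on the half-plane
  \<open>Re z > 0\<close> to a holomorphic function (shown below), so on this half-plane, and in particular
  at \<open>z = 1\<close>, it agrees with the analytic continuation of the Dirichlet series from
  \<open>Re z > 1\<close>. Elsewhere (\<open>Re z \<le> 0\<close>, or principal characters with \<open>Re z \<le> 1\<close>) its value is
  not meaningful.\<close>

definition Dirichlet_L :: "(int \<Rightarrow> complex) \<Rightarrow> complex \<Rightarrow> complex" where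
  "Dirichlet_L chi z = (\<Sum>n. chi (int (Suc n)) / of_nat (Suc n) powr z)"


lemma dirichlet_character_period_sum:
  assumes "dirichlet_character q chi" "coprime b (int q)" "chi b \<noteq> 1"
  shows "(\<Sum>x\<in>{0..<int q}. chi x) = 0"
proof -
  have q: "q > 0" and mult: "\<And>a b. chi (a * b) = chi a * chi b"
    and per: "\<And>a. chi (a + int q) = chi a"
    using assms(1) by (auto simp: dirichlet_character_def)
  have per': "chi (a + int q * int k) = chi a" for a k
  proof (induction k)
    case (Suc k)
    show ?case using per[of "a + int q * int k"] Suc by (simp add: algebra_simps)
  qed simp
  have chi_mod: "chi (a mod int q) = chi a" for a
  proof (cases "a div int q \<ge> 0")
    case True
    have "a = a mod int q + int q * int (nat (a div int q))" using True by simp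
    then show ?thesis by (metis per')
  next
    case False
    have "a mod int q = a + int q * int (nat (- (a div int q)))"
      using False by (simp add: minus_mult_div_eq_mod [symmetric])
    then show ?thesis by (metis per')
  qed
  let ?R = "{0..<int q}" and ?f = "\<lambda>x. (b * x) mod int q"
  have inj: "inj_on ?f ?R"
  proof (rule inj_onI)
    fix x y assume *: "x \<in> ?R" "y \<in> ?R" "?f x = ?f y"
    then have "[b * x = b * y] (mod int q)" by (simp add: cong_def)
    then have "[x = y] (mod int q)" using assms(2) by (simp add: cong_mult_lcancel)
    then show "x = y" using * by (simp add: cong_def)
  qed
  have "?f ` ?R = ?R"
    using q by (intro endo_inj_surj inj) auto
  then have "(\<Sum>x\<in>?R. chi x) = (\<Sum>x\<in>?R. chi (?f x))"
    using sum.reindex[OF inj, of chi] by (simp add: o_def)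
  also have "\<dots> = chi b * (\<Sum>x\<in>?R. chi x)"
    by (simp add: chi_mod mult sum_distrib_left)
  finally have "(1 - chi b) * (\<Sum>x\<in>?R. chi x) = 0" by (simp add: algebra_simps)
  then show ?thesis using assms(3) by simp
qed

lemma dirichlet_character_partial_sums_bounded:
  assumes "dirichlet_character q chi" "coprime b (int q)" "chi b \<noteq> 1"
  obtains B where "\<And>N. norm (\<Sum>n<N. chi (int (Suc n))) \<le> B"
proof -
  have q: "q > 0" and per: "\<And>a. chi (a + int q) = chi a"
    using assms(1) by (auto simp: dirichlet_character_def)
  define S where "S N = (\<Sum>n<N. chi (int (Suc n)))" for N
  have "S q = (\<Sum>x\<in>{1..int q}. chi x)"
    unfolding S_def
    by (rule sum.reindex_bij_witness[of _ "\<lambda>x. nat (x - 1)" "\<lambda>n. int (Suc n)"]) auto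
  also have "{1..int q} = insert (int q) {1..<int q}" using q by auto
  also have "sum chi \<dots> = chi (int q) + sum chi {1..<int q}" by simp
  also have "\<dots> = sum chi (insert 0 {1..<int q})" using per[of 0] by simp
  also have "insert 0 {1..<int q} = {0..<int q}" using q by auto
  finally have Sq: "S q = 0" using dirichlet_character_period_sum[OF assms] by simp
  have shift: "S (N + q) = S N" for N
  proof (induction N)
    case 0
    then show ?case by (simp add: Sq) (simp add: S_def)
  next
    case (Suc N)
    have "S (Suc N + q) = S (N + q) + chi (int (Suc (N + q)))" by (simp add: S_def)
    also have "chi (int (Suc (N + q))) = chi (int (Suc N))"
      using per[of "int (Suc N)"] by (simp add: algebra_simps)
    finally show ?case using Suc by (simp add: S_def)
  qed
  have "norm (S N) \<le> (\<Sum>k<q. norm (S k))" for N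
  proof (induction N rule: less_induct)
    case (less N)
    show ?case
    proof (cases "N < q")
      case True
      then show ?thesis by (intro member_le_sum) auto
    next
      case False
      then show ?thesis using less[of "N - q"] shift[of "N - q"] q by simp
    qed
  qed
  then show ?thesis using that unfolding S_def by blast
qed

lemma norm_powr_diff_le:
  assumes "Re z \<ge> \<delta>" "\<delta> > 0"
  shows "norm (of_nat (Suc n) powr (-z) - of_nat (Suc (Suc n)) powr (-z) :: complex)
           \<le> norm z * real (Suc n) powr (-\<delta> - 1)"
proof -
  define a b :: complex where "a = of_nat (Suc n)" and "b = of_nat (Suc (Suc n))"
  have seg: "\<exists>t. w = of_real t \<and> t \<ge> real (Suc n)" if "w \<in> closed_segment a b" for w
  proof -
    have "a = of_real (real (Suc n))" "b = of_real (real (Suc (Suc n)))"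
      by (simp_all add: a_def b_def)
    then have "w \<in> of_real ` {real (Suc n)..real (Suc (Suc n))}"
      using that by (simp only: closed_segment_of_real closed_segment_eq_real_ivl) auto
    then show ?thesis by auto
  qed
  have "norm (a powr (-z) - b powr (-z)) \<le> norm z * real (Suc n) powr (-\<delta> - 1) * norm (a - b)"
  proof (rule field_differentiable_bound[where S = "closed_segment a b"
        and f' = "\<lambda>w. (-z) * w powr (-z - 1)"])
    fix w assume "w \<in> closed_segment a b"
    then obtain t where t: "w = of_real t" "t \<ge> real (Suc n)" using seg by blast
    then have "t \<ge> 1" by simp
    have "w \<notin> \<real>\<^sub>\<le>\<^sub>0" using t by (auto simp: complex_nonpos_Reals_iff)
    then show "((\<lambda>w. w powr (-z)) has_field_derivative (-z) * w powr (-z - 1))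
                 (at w within closed_segment a b)"
      by (rule has_field_derivative_at_within[OF has_field_derivative_powr])
    have "norm (w powr (-z - 1)) = t powr (- Re z - 1)"
      using t \<open>t \<ge> 1\<close> by (simp add: norm_powr_real_powr)
    also have "\<dots> \<le> t powr (-\<delta> - 1)"
      using assms \<open>t \<ge> 1\<close> by (intro powr_mono) auto
    also have "\<dots> \<le> real (Suc n) powr (-\<delta> - 1)"
      using assms t by (intro powr_mono2') auto
    finally show "norm ((-z) * w powr (-z - 1)) \<le> norm z * real (Suc n) powr (-\<delta> - 1)"
      by (simp add: norm_mult mult_left_mono)
  qed auto
  also have "norm (a - b) = 1" by (simp add: a_def b_def)
  finally show ?thesis by (simp add: a_def b_def)
qed

lemma Dirichlet_L_uniform_limit:
  assumes "dirichlet_character q chi" "coprime b (int q)" "chi b \<noteq> 1" "\<delta> > 0"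
  shows "uniform_limit {z. Re z \<ge> \<delta> \<and> norm z \<le> R}
           (\<lambda>N z. \<Sum>n<N. chi (int (Suc n)) / of_nat (Suc n) powr z) (Dirichlet_L chi) sequentially"
proof -
  define A where "A = {z. Re z \<ge> \<delta> \<and> norm z \<le> R}"
  define S where "S N = (\<Sum>n<N. chi (int (Suc n)))" for N
  define f where "f n z = (of_nat (Suc n) :: complex) powr (-z)" for n z
  define h where "h n z = S (Suc n) * (f n z - f (Suc n) z)" for n z
  define g where "g z = (\<Sum>n. h n z)" for z
  obtain B where B: "\<And>N. norm (S N) \<le> B"
    using dirichlet_character_partial_sums_bounded[OF assms(1-3)] unfolding S_def by blast
  have B0: "B \<ge> 0" using B[of 0] by (simp add: S_def)
  have abel: "(\<Sum>n<N. chi (int (Suc n)) / of_nat (Suc n) powr z) = S N * f N z + (\<Sum>n<N. h n z)"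
    for N z
  proof (induction N)
    case 0
    then show ?case by (simp add: S_def)
  next
    case (Suc N)
    have "chi (int (Suc N)) / of_nat (Suc N) powr z = (S (Suc N) - S N) * f N z"
      by (simp add: S_def f_def powr_minus field_simps)
    then show ?case using Suc by (simp add: h_def algebra_simps)
  qed
  have lim2: "uniform_limit A (\<lambda>N z. \<Sum>n<N. h n z) g sequentially"
    unfolding g_def
  proof (rule Weierstrass_m_test)
    fix n z assume "z \<in> A"
    then have z: "Re z \<ge> \<delta>" "norm z \<le> R" by (auto simp: A_def)
    have "norm (h n z) \<le> B * (norm z * real (Suc n) powr (-\<delta> - 1))"
      unfolding h_def norm_mult f_def
      by (intro mult_mono B norm_powr_diff_le z assms B0) auto
    also have "\<dots> \<le> B * (R * real (Suc n) powr (-\<delta> - 1))"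
      using z B0 by (intro mult_left_mono mult_right_mono) auto
    finally show "norm (h n z) \<le> B * (R * real (Suc n) powr (-\<delta> - 1))" .
  next
    have "summable (\<lambda>n. real n powr (-\<delta> - 1))"
      using assms(4) by (simp add: summable_real_powr_iff)
    then have "summable (\<lambda>n. real (Suc n) powr (-\<delta> - 1))"
      by (subst summable_Suc_iff)
    then show "summable (\<lambda>n. B * (R * real (Suc n) powr (-\<delta> - 1)))"
      by (intro summable_mult)
  qed
  have lim1: "uniform_limit A (\<lambda>N z. S N * f N z) (\<lambda>_. 0) sequentially"
  proof (rule uniform_limitI)
    fix e :: real assume "e > 0"
    have "(\<lambda>N. B * real (Suc N) powr (-\<delta>)) \<longlonglongrightarrow> 0"
      using assms(4) by real_asymp
    then have "\<forall>\<^sub>F N in sequentially. B * real (Suc N) powr (-\<delta>) < e"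
      using \<open>e > 0\<close> by (rule order_tendstoD)
    then show "\<forall>\<^sub>F N in sequentially. \<forall>z\<in>A. dist (S N * f N z) 0 < e"
    proof eventually_elim
      case (elim N)
      show ?case
      proof
        fix z assume "z \<in> A"
        have "norm (f N z) = real (Suc N) powr (- Re z)"
          unfolding f_def by (subst norm_powr_real_powr) auto
        also have "\<dots> \<le> real (Suc N) powr (-\<delta>)"
          using \<open>z \<in> A\<close> by (intro powr_mono) (auto simp: A_def)
        finally have "norm (S N * f N z) \<le> B * real (Suc N) powr (-\<delta>)"
          unfolding norm_mult by (intro mult_mono B B0) auto
        then show "dist (S N * f N z) 0 < e" using elim by simp
      qed
    qed
  qed
  have lim: "uniform_limit A (\<lambda>N z. \<Sum>n<N. chi (int (Suc n)) / of_nat (Suc n) powr z) g sequentially"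
    unfolding abel using uniform_limit_add[OF lim1 lim2] by simp
  have "g z = Dirichlet_L chi z" if "z \<in> A" for z
  proof -
    have "(\<lambda>n. chi (int (Suc n)) / of_nat (Suc n) powr z) sums g z"
      unfolding sums_def using tendsto_uniform_limitI[OF lim that] .
    then show ?thesis by (simp add: Dirichlet_L_def sums_iff)
  qed
  then have "uniform_limit A (\<lambda>N z. \<Sum>n<N. chi (int (Suc n)) / of_nat (Suc n) powr z)
               (Dirichlet_L chi) sequentially"
    using lim by (subst uniform_limit_cong'[of A _ _ _ g]) auto
  then show ?thesis by (simp add: A_def)
qed

lemma Dirichlet_L_sums:
  assumes "dirichlet_character q chi" "coprime b (int q)" "chi b \<noteq> 1" "Re z > 0"
  shows "(\<lambda>n. chi (int (Suc n)) / of_nat (Suc n) powr z) sums Dirichlet_L chi z"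
  unfolding sums_def
  using Dirichlet_L_uniform_limit[OF assms(1-3), of "Re z" "norm z"] assms(4)
  by (auto intro: tendsto_uniform_limitI)

lemma Dirichlet_L_holomorphic:
  assumes "dirichlet_character q chi" "coprime b (int q)" "chi b \<noteq> 1"
  shows "Dirichlet_L chi holomorphic_on {z. Re z > 0}"
proof (rule holomorphic_uniform_sequence)
  show "open {z. Re z > 0}" by (rule open_halfspace_Re_gt)
  show "(\<lambda>z. \<Sum>n<N. chi (int (Suc n)) / of_nat (Suc n) powr z) holomorphic_on {z. Re z > 0}" for N
    by (intro holomorphic_intros) (auto simp del: of_nat_Suc)
  fix z assume "z \<in> {z. Re z > 0}"
  then have z: "Re z > 0" by simp
  let ?d = "Re z / 2"
  have *: "?d \<le> Re w \<and> norm w \<le> norm z + ?d" if "w \<in> cball z ?d" for w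
  proof -
    have "norm (z - w) \<le> ?d" using that by (simp add: dist_norm)
    then show ?thesis
      using abs_Re_le_cmod[of "z - w"] norm_triangle_ineq2[of w z] norm_minus_commute[of w z]
      by (auto simp: abs_le_iff)
  qed
  have "uniform_limit (cball z ?d) (\<lambda>N z. \<Sum>n<N. chi (int (Suc n)) / of_nat (Suc n) powr z)
          (Dirichlet_L chi) sequentially"
    by (rule uniform_limit_on_subset[OF Dirichlet_L_uniform_limit[OF assms, of ?d "norm z + ?d"]])
      (use z * in auto)
  moreover have "cball z ?d \<subseteq> {z. Re z > 0}" using * z by fastforce
  ultimately show "\<exists>d>0. cball z d \<subseteq> {z. Re z > 0} \<and>
      uniform_limit (cball z d) (\<lambda>N z. \<Sum>n<N. chi (int (Suc n)) / of_nat (Suc n) powr z)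
        (Dirichlet_L chi) sequentially"
    using z by (intro exI[of _ ?d]) auto
qed

lemma primitive_dirichlet_character_nonprincipal:
  assumes "primitive_dirichlet_character q chi" "q > 1"
  obtains b where "coprime b (int q)" "chi b \<noteq> 1"
proof -
  have "\<not> induced_modulus q chi 1"
    using assms not_less_Least[of 1 "induced_modulus q chi"]
    by (auto simp: primitive_dirichlet_character_def conductor_def)
  then show ?thesis using that by (auto simp: induced_modulus_def)
qed

end

theory Submission
  imports Defs
begin

text \<open>Since \<open>chi\<close> is even and primitive, with Gauss sum \<open>t\<close>, there are pairs of weights \<open>u, v\<close> with
  \<open>L(1, chi) = (\<Sum>n. chi n * u (n w) / n) + (1 / t) * (\<Sum>m. cnj (chi m) * v (q w / (2 \<pi> m)))\<close>
  for all \<open>w > 0\<close>. The basic pair is \<open>u x = exp (- x)\<close>, \<open>v x = ln (1 + x^2)\<close>; applying \<open>w d/dw\<close>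
  repeatedly multiplies \<open>u\<close> by polynomials and adds polynomials in \<open>x^2 / (1 + x^2)\<close> to \<open>v\<close>.
  The trivial character has an analogous formula with an explicit main term, so it evaluates the same two
  sums without the character. Bounding \<open>chi\<close> trivially in the first sum costs \<open>ln (q) / 2\<close>.
  In the second sum, where \<open>v\<close> takes negative values, \<open>chi (2) = 1\<close> makes the weights constant on
  the sets \<open>{2^k m | k}\<close>, so only the dyadic sums of \<open>v\<close> matter, and these are nearly
  nonnegative. For \<open>w = 6 \<pi> / sqrt q\<close> and a suitable polynomial this gives the
  constant for \<open>q \<ge> 11\<close>; for odd \<open>q \<le> 9\<close> the values \<open>-1\<close> and \<open>2\<close> generate all units, so \<open>chi\<close>
  would be principal.\<close>

section \<open>Characters and Gauss sums\<close>

text \<open>The difficulty is the sign of the constant. Suppose the main term for the trivial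
  character is \<open>C - ln w + b * w\<close>. With \<open>w = a / sqrt q\<close>, two trivial
  evaluations of the sums give \<open>ln q / 2 + C - ln a + a * b\<close>, up to terms with a factor
  \<open>1 / sqrt q\<close>. The basic pair has \<open>C = 0\<close> and \<open>b = 1 / 2\<close>;
  its best constant, at \<open>a = 2\<close>, is \<open>1 - ln 2 > 0\<close>. Repeated use of
  \<open>w d/dw\<close> allows \<open>b\<close> to be traded against \<open>C\<close>: the weight
  chosen here has \<open>C = 1.94222\<close> and \<open>b = 0.04825\<close>, and the constant at
  \<open>a = 6 * pi\<close> is about -0.085. The price is that bounding the twisted dual sum by the
  untwisted one is no longer free. The dyadic sums can still be slightly negative, and this costs
  0.063, namely three times a bound 0.021 for the integral of their negative part. What remains is
  about -0.0218; the difference to -0.02012 leaves room for rounding. The condition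
  \<open>q \<ge> 11\<close> makes the terms with the factor \<open>1 / sqrt q\<close> add up to
  something nonpositive.\<close>

lemma dirichlet_character_cong:
  assumes "dirichlet_character q chi" "[a = b] (mod int q)"
  shows "chi a = chi b"
proof -
  have per: "chi (a + int q) = chi a" for a using assms(1) by (auto simp: dirichlet_character_def)
  have per': "chi (a + int q * int k) = chi a" for a k
  proof (induction k)
    case (Suc k)
    show ?case using per[of "a + int q * int k"] Suc by (simp add: algebra_simps)
  qed simp
  obtain k where k: "a = b + int q * k"
    using cong_sym[OF assms(2)] unfolding cong_iff_lin by blast
  show ?thesis
  proof (cases "k \<ge> 0")
    case True
    then show ?thesis using per'[of b "nat k"] k by simp
  next
    case False
    then show ?thesis using per'[of a "nat (- k)"] k by simp
  qed
qed

lemma dirichlet_character_1: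
  assumes "dirichlet_character q chi"
  shows "chi 1 = 1"
proof -
  have "chi (1 * 1) = chi 1 * chi 1" using assms unfolding dirichlet_character_def by blast
  then have "chi 1 * chi 1 = chi 1" by simp
  moreover have "chi 1 \<noteq> 0" using assms by (auto simp: dirichlet_character_def)
  ultimately show ?thesis by simp
qed

lemma dirichlet_character_power:
  assumes "dirichlet_character q chi"
  shows "chi (a ^ k) = chi a ^ k"
  using assms dirichlet_character_1[OF assms] by (induction k) (auto simp: dirichlet_character_def)

lemma dirichlet_character_norm:
  assumes "dirichlet_character q chi" "coprime a (int q)"
  shows "norm (chi a) = 1"
proof -
  have q: "q > 0" using assms(1) by (auto simp: dirichlet_character_def)
  have "coprime (nat (a mod int q)) q"
  proof -
    have "coprime (int (nat (a mod int q))) (int q)" using assms(2) q by (simp add: coprime_mod_left_iff)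
    then show ?thesis by (simp only: coprime_int_iff)
  qed
  then have "[nat (a mod int q) ^ totient q = 1] (mod q)" by (rule euler_theorem)
  then have "[int (nat (a mod int q)) ^ totient q = 1] (mod int q)"
    by (simp only: cong_int_iff [symmetric] of_nat_1 of_nat_power)
  then have "[a ^ totient q = 1] (mod int q)"
    using q by (simp add: cong_def power_mod)
  then have "chi a ^ totient q = 1"
    using dirichlet_character_cong[OF assms(1), of "a ^ totient q" 1]
      dirichlet_character_power[OF assms(1), of a "totient q"] dirichlet_character_1[OF assms(1)] by simp
  then have "norm (chi a) ^ totient q = 1" by (simp add: norm_power [symmetric])
  moreover have "totient q > 0" using q by simp
  ultimately show ?thesis using power_eq_1_iff[of "norm (chi a)" "totient q"] by simp
qed

lemma dirichlet_character_norm_le: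
  assumes "dirichlet_character q chi"
  shows "norm (chi a) \<le> 1"
  using assms dirichlet_character_norm[OF assms, of a] by (cases "coprime a (int q)") (auto simp: dirichlet_character_def)

lemma sum_periodic_reindex_mult:
  fixes f :: "int \<Rightarrow> 'a::comm_monoid_add"
  assumes "q > 0" "coprime b (int q)" "\<And>x y. [x = y] (mod int q) \<Longrightarrow> f x = f y"
  shows "(\<Sum>x\<in>{0..<int q}. f (b * x)) = (\<Sum>x\<in>{0..<int q}. f x)"
proof -
  let ?R = "{0..<int q}" and ?f = "\<lambda>x. (b * x) mod int q"
  have inj: "inj_on ?f ?R"
  proof (rule inj_onI)
    fix x y assume *: "x \<in> ?R" "y \<in> ?R" "?f x = ?f y"
    then have "[b * x = b * y] (mod int q)" by (simp add: cong_def)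
    then have "[x = y] (mod int q)" using assms(2) by (simp add: cong_mult_lcancel)
    then show "x = y" using * by (simp add: cong_def)
  qed
  have "?f ` ?R = ?R"
    using assms(1) by (intro endo_inj_surj inj) auto
  then have "(\<Sum>x\<in>?R. f x) = (\<Sum>x\<in>?R. f (?f x))"
    using sum.reindex[OF inj, of f] by (simp add: o_def)
  also have "\<dots> = (\<Sum>x\<in>?R. f (b * x))"
    by (intro sum.cong assms(3)) (auto simp: cong_def)
  finally show ?thesis by simp
qed

lemma cis_multiple_eq:
  assumes "[x = y] (mod int q)" "q > 0"
  shows "cis (2 * pi * of_int x / q) = cis (2 * pi * of_int y / q)"
proof -
  obtain k where k: "x = y + int q * k"
    using cong_sym[OF assms(1)] unfolding cong_iff_lin by blast
  have "2 * pi * real_of_int x / q = 2 * pi * of_int y / q + 2 * pi * of_int k"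
    using assms(2) by (simp add: k field_simps)
  then show ?thesis by (simp add: cis_mult [symmetric] cis_multiple_2pi)
qed

lemma sum_cis_multiples:
  assumes "q > 0"
  shows "(\<Sum>n\<in>{0..<int q}. cis (2 * pi * of_int (n * a) / q)) = (if int q dvd a then of_nat q else 0)"
proof (cases "int q dvd a")
  case True
  have "cis (2 * pi * of_int (n * a) / q) = 1" for n
    using cis_multiple_eq[of "n * a" 0 q] True assms by (auto simp: cong_0_iff)
  then show ?thesis using True by simp
next
  case False
  define z where "z = cis (2 * pi * of_int a / q)"
  have pw: "cis (2 * pi * of_int (n * a) / q) = z ^ nat n" if "n \<ge> 0" for n
  proof -
    have "z ^ nat n = cis (real (nat n) * (2 * pi * of_int a / q))"
      unfolding z_def by (rule Complex.DeMoivre)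
    then show ?thesis using that by (simp add: mult_ac)
  qed
  have "z \<noteq> 1"
  proof
    assume "z = 1"
    then have "cos (2 * pi * of_int a / q) = 1"
      by (simp add: z_def complex_eq_iff)
    then obtain k where "2 * pi * of_int a / q = of_int k * (2 * pi)"
      by (auto simp: cos_one_2pi_int)
    then have "real_of_int a = of_int (k * int q)" using assms by (simp add: field_simps)
    then have "a = k * int q" by linarith
    then show False using False by simp
  qed
  have "z ^ q = 1"
  proof -
    have "z ^ q = cis (2 * pi * of_int (int q * a) / q)" using pw[of "int q"] by simp
    also have "\<dots> = cis (2 * pi * of_int 0 / q)"
      using assms by (intro cis_multiple_eq) (auto simp: cong_0_iff)
    finally show ?thesis by simp
  qed
  have "(\<Sum>n\<in>{0..<int q}. cis (2 * pi * of_int (n * a) / q)) = (\<Sum>n\<in>{0..<int q}. z ^ nat n)"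
    by (intro sum.cong pw) auto
  also have "\<dots> = (\<Sum>n<q. z ^ n)"
    by (rule sum.reindex_bij_witness[of _ int nat]) auto
  also have "\<dots> = 0" using \<open>z \<noteq> 1\<close> \<open>z ^ q = 1\<close> by (simp add: geometric_sum)
  finally show ?thesis using False by simp
qed

text \<open>Primitivity in the form in which Gauss sums use it: \<open>q\<close> is the least
  induced modulus, so a proper divisor is not induced, and this failure supplies the
  witness.\<close>

lemma primitive_character_detects:
  assumes "primitive_dirichlet_character q chi" "d dvd q" "d > 0" "d \<noteq> q"
  obtains b where "coprime b (int q)" "[b = 1] (mod int d)" "chi b \<noteq> 1"
proof -
  have q: "q > 0" using assms(1) by (auto simp: primitive_dirichlet_character_def dirichlet_character_def)
  have "d < q" using assms(2,4) q by (auto dest: dvd_imp_le)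
  then have "\<not> induced_modulus q chi d"
    using assms(1) not_less_Least[of d "induced_modulus q chi"]
    by (auto simp: primitive_dirichlet_character_def conductor_def)
  then show ?thesis using that assms(2,3) by (auto simp: induced_modulus_def)
qed

text \<open>For \<open>n\<close> not coprime to \<open>q\<close> both sides vanish: substituting \<open>a \<mapsto> b a\<close> with
  \<open>b = 1\<close> modulo \<open>q / gcd n q\<close> fixes the exponential but multiplies the sum by \<open>cnj (chi b) \<noteq> 1\<close>.\<close>

lemma gauss_sum_separable:
  fixes n :: int
  assumes "primitive_dirichlet_character q chi"
  shows "(\<Sum>a\<in>{0..<int q}. cnj (chi a) * cis (2 * pi * of_int (n * a) / q)) =
         chi n * (\<Sum>a\<in>{0..<int q}. cnj (chi a) * cis (2 * pi * of_int a / q))"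
proof -
  have dc: "dirichlet_character q chi" using assms by (simp add: primitive_dirichlet_character_def)
  have q: "q > 0" and mult: "\<And>a b. chi (a * b) = chi a * chi b"
    using dc by (auto simp: dirichlet_character_def)
  define g where "g n = (\<Sum>a\<in>{0..<int q}. cnj (chi a) * cis (2 * pi * of_int (n * a) / q))" for n :: int
  have per: "cnj (chi x) * cis (2 * pi * of_int (n * x) / q) =
             cnj (chi y) * cis (2 * pi * of_int (n * y) / q)" if "[x = y] (mod int q)" for x y n
    using dirichlet_character_cong[OF dc that] cis_multiple_eq[OF cong_scalar_left[OF that, of n] q] by simp
  have shift: "g n = cnj (chi b) * g (n * b)" if "coprime b (int q)" for n b
  proof -
    have "g n = (\<Sum>x\<in>{0..<int q}. cnj (chi (b * x)) * cis (2 * pi * of_int (n * (b * x)) / q))"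
      unfolding g_def using sum_periodic_reindex_mult[OF q that,
          of "\<lambda>x. cnj (chi x) * cis (2 * pi * of_int (n * x) / q)", OF per] by simp
    then show ?thesis by (simp add: g_def mult sum_distrib_left mult_ac)
  qed
  have "g n = chi n * g 1"
  proof (cases "coprime n (int q)")
    case True
    have "norm (chi n) = 1" using dirichlet_character_norm[OF dc True] .
    then have "chi n * cnj (chi n) = 1" by (simp add: complex_norm_square [symmetric])
    then show ?thesis using shift[OF True, of 1] by (simp add: mult.assoc [symmetric])
  next
    case False
    define e where "e = nat (gcd n (int q))"
    have e: "int e = gcd n (int q)" by (simp add: e_def)
    have "e > 0" using q by (simp add: e_def)
    have "e dvd q" using e by (metis gcd_dvd2 int_dvd_int_iff)
    then obtain d where d: "q = e * d" by (elim dvdE)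
    have "e \<noteq> 1" using False e by (simp add: coprime_iff_gcd_eq_1)
    then have "d \<noteq> q" "d > 0" "d dvd q" using d q \<open>e > 0\<close> by auto
    then obtain b where b: "coprime b (int q)" "[b = 1] (mod int d)" "chi b \<noteq> 1"
      using primitive_character_detects[OF assms] by blast
    obtain k where k: "n = int e * k" using e by (metis dvdE gcd_dvd1)
    have "[n * b = n] (mod int q)"
    proof -
      have "int d dvd b - 1" using b(2) by (simp add: cong_iff_dvd_diff)
      then have "int e * int d dvd int e * (b - 1)" by simp
      then have "int q dvd int e * k * (b - 1)" unfolding d of_nat_mult
        by (metis dvd_mult2 mult.assoc mult.commute)
      then show ?thesis using k by (simp add: cong_iff_dvd_diff algebra_simps)
    qed
    then have "g (n * b) = g n"
      unfolding g_def by (intro sum.cong arg_cong2[where f="(*)"] cis_multiple_eq q cong_scalar_right refl) auto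
    then have "(1 - cnj (chi b)) * g n = 0" using shift[OF b(1), of n] by (simp add: algebra_simps)
    moreover have "cnj (chi b) \<noteq> 1" using b(3) by (metis complex_cnj_cnj complex_cnj_one)
    ultimately have "g n = 0" by simp
    moreover have "chi n = 0" using False dc by (auto simp: dirichlet_character_def)
    ultimately show ?thesis by simp
  qed
  then show ?thesis by (simp add: g_def)
qed

text \<open>Parseval on the residues: the sum over \<open>n\<close> of
  \<open>norm (chi n * t) ^ 2\<close> is \<open>N * norm t ^ 2\<close> by separability and
  \<open>q * N\<close> by orthogonality of the exponentials. \<open>N\<close> cancels, so its value,
  the number of units, never enters.\<close>

lemma norm_gauss_sum:
  assumes "primitive_dirichlet_character q chi"
  shows "norm (\<Sum>a\<in>{0..<int q}. cnj (chi a) * cis (2 * pi * of_int a / q)) = sqrt q"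
proof -
  have dc: "dirichlet_character q chi" using assms by (simp add: primitive_dirichlet_character_def)
  have q: "q > 0" using dc by (auto simp: dirichlet_character_def)
  let ?R = "{0..<int q}"
  define t where "t = (\<Sum>a\<in>?R. cnj (chi a) * cis (2 * pi * of_int a / q))"
  define e where "e x = cis (2 * pi * of_int x / q)" for x :: int
  define N where "N = (\<Sum>a\<in>?R. chi a * cnj (chi a))"
  have ee: "e (n * a) * cnj (e (n * b)) = e (n * (a - b))" for n a b
    by (simp add: e_def cis_cnj cis_mult right_diff_distrib diff_divide_distrib)
  have "(\<Sum>n\<in>?R. (chi n * t) * cnj (chi n * t)) =
        (\<Sum>n\<in>?R. (\<Sum>a\<in>?R. cnj (chi a) * e (n * a)) * cnj (\<Sum>b\<in>?R. cnj (chi b) * e (n * b)))"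
    using gauss_sum_separable[OF assms] by (simp add: t_def e_def)
  also have "\<dots> = (\<Sum>n\<in>?R. \<Sum>a\<in>?R. \<Sum>b\<in>?R. cnj (chi a) * chi b * e (n * (a - b)))"
    unfolding sum_product cnj_sum by (intro sum.cong refl) (simp add: ee [symmetric])
  also have "\<dots> = (\<Sum>a\<in>?R. \<Sum>b\<in>?R. cnj (chi a) * chi b * (\<Sum>n\<in>?R. e (n * (a - b))))"
  proof -
    have "(\<Sum>n\<in>?R. \<Sum>a\<in>?R. \<Sum>b\<in>?R. cnj (chi a) * chi b * e (n * (a - b))) =
          (\<Sum>a\<in>?R. \<Sum>n\<in>?R. \<Sum>b\<in>?R. cnj (chi a) * chi b * e (n * (a - b)))"
      by (rule sum.swap)
    also have "\<dots> = (\<Sum>a\<in>?R. \<Sum>b\<in>?R. \<Sum>n\<in>?R. cnj (chi a) * chi b * e (n * (a - b)))"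
      by (intro sum.cong refl sum.swap)
    finally show ?thesis by (simp only: sum_distrib_left)
  qed
  also have "\<dots> = (\<Sum>a\<in>?R. \<Sum>b\<in>?R. if b = a then of_nat q * (cnj (chi a) * chi b) else 0)"
  proof (intro sum.cong refl)
    fix a b assume ab: "a \<in> ?R" "b \<in> ?R"
    have "int q dvd a - b \<longleftrightarrow> b = a"
      using ab by (auto simp: mod_eq_dvd_iff [symmetric])
    then show "cnj (chi a) * chi b * (\<Sum>n\<in>?R. e (n * (a - b))) =
          (if b = a then of_nat q * (cnj (chi a) * chi b) else 0)"
      using sum_cis_multiples[OF q, of "a - b"] by (simp add: e_def)
  qed
  also have "\<dots> = of_nat q * N"
    by (simp add: N_def sum_distrib_left mult_ac)
  finally have "t * cnj t * N = of_nat q * N"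
    by (simp add: N_def sum_distrib_left mult_ac)
  \<comment> \<open>The residue class of 1 contributes 1 to \<open>N\<close>. Writing it as
    \<open>1 mod int q\<close> keeps it inside \<open>{0..<int q}\<close> for \<open>q = 1\<close>
    as well.\<close>
  moreover have "N \<noteq> 0"
  proof -
    have "N = of_real (\<Sum>a\<in>?R. (norm (chi a))\<^sup>2)" unfolding N_def of_real_sum by (simp add: complex_norm_square del: of_real_power)
    moreover have "(\<Sum>a\<in>?R. (norm (chi a))\<^sup>2) \<ge> (\<Sum>a\<in>{1 mod int q}. (norm (chi a))\<^sup>2)"
      using q by (intro sum_mono2) auto
    moreover have "chi (1 mod int q) = 1"
      using dirichlet_character_cong[OF dc, of "1 mod int q" 1] dirichlet_character_1[OF dc] by (simp add: cong_def)
    ultimately have "N = of_real (\<Sum>a\<in>?R. (norm (chi a))\<^sup>2)" "(\<Sum>a\<in>?R. (norm (chi a))\<^sup>2) \<ge> 1" by simp_all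
    then show ?thesis by (metis of_real_eq_0_iff not_one_le_zero)
  qed
  ultimately have "t * cnj t = of_nat q" by simp
  then have "of_real ((norm t)\<^sup>2) = (of_real (real q) :: complex)" by (simp only: complex_norm_square of_real_of_nat_eq)
  then have "(norm t)\<^sup>2 = real q" by (simp only: of_real_eq_iff)
  then show ?thesis by (simp add: t_def real_sqrt_unique)
qed

section \<open>Logarithms of trigonometric products\<close>

text \<open>Euler's product for \<open>sin (pi * z)\<close> at \<open>z = x + i b\<close> is divided
  by the one at \<open>x\<close>, and squared moduli are taken. The factor with index
  \<open>k\<close> splits into the shifts of \<open>x\<close> by \<open>k\<close> and by
  \<open>- k\<close>, and \<open>norm (sin (pi * z)) ^ 2\<close> equals
  \<open>(cosh (2 * pi * b) - cos (2 * pi * x)) / 2\<close>.\<close>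

lemma ln_product_ratio_tendsto:
  fixes x b :: real
  assumes x: "0 < x" "x < 1" and b: "b > 0"
  shows "(\<lambda>N. ln (1 + b\<^sup>2 / x\<^sup>2) + (\<Sum>k=1..N. ln (1 + b\<^sup>2 / (x + real k)\<^sup>2) + ln (1 + b\<^sup>2 / (x - real k)\<^sup>2)))
           \<longlonglongrightarrow> ln ((cosh (2 * pi * b) - cos (2 * pi * x)) / (1 - cos (2 * pi * x)))"
proof -
  define z where "z = Complex x b"
  define f where "f N z = of_real pi * z * (\<Prod>k=1..N. 1 - z\<^sup>2 / of_nat k ^ 2)" for N and z :: complex
  define R where "R N = (1 + b\<^sup>2 / x\<^sup>2) * (\<Prod>k=1..N. (1 + b\<^sup>2 / (x + real k)\<^sup>2) * (1 + b\<^sup>2 / (x - real k)\<^sup>2))" for N :: nat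
  have xk: "x - real k \<noteq> 0" if "k \<ge> 1" for k
    using x that by (simp add: algebra_simps)
  have Rpos: "R N > 0" for N unfolding R_def
    by (intro mult_pos_pos prod_pos ballI add_pos_nonneg) auto
  have lnR: "ln (R N) = ln (1 + b\<^sup>2 / x\<^sup>2) +
       (\<Sum>k=1..N. ln (1 + b\<^sup>2 / (x + real k)\<^sup>2) + ln (1 + b\<^sup>2 / (x - real k)\<^sup>2))" for N
  proof (induction N)
    case 0
    then show ?case by (simp add: R_def)
  next
    case (Suc N)
    have "R (Suc N) = R N * ((1 + b\<^sup>2 / (x + Suc N)\<^sup>2) * (1 + b\<^sup>2 / (x - Suc N)\<^sup>2))"
      by (simp add: R_def)
    moreover have "1 + b\<^sup>2 / (x + Suc N)\<^sup>2 > 0" "1 + b\<^sup>2 / (x - Suc N)\<^sup>2 > 0"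
      by (intro add_pos_nonneg; simp)+
    ultimately show ?case using Suc Rpos[of N] by (simp add: ln_mult_pos)
  qed
  have fac: "(norm (1 - z\<^sup>2 / of_nat k ^ 2))\<^sup>2 =
       (norm (1 - (of_real x :: complex)\<^sup>2 / of_nat k ^ 2))\<^sup>2 * ((1 + b\<^sup>2 / (x + real k)\<^sup>2) * (1 + b\<^sup>2 / (x - real k)\<^sup>2))"
    if "k \<ge> 1" for k
  proof -
    have k: "(of_nat k :: complex) \<noteq> 0" "real k > 0" using that by auto
    have 1: "1 - u\<^sup>2 / of_nat k ^ 2 = (of_nat k - u) * (of_nat k + u) / of_nat k ^ 2" for u :: complex
      using k(1) by (simp add: field_simps power2_eq_square)
    have 2: "(norm (1 - u\<^sup>2 / of_nat k ^ 2))\<^sup>2 =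
          (norm (of_nat k - u))\<^sup>2 * (norm (of_nat k + u))\<^sup>2 / (real k ^ 4)" for u :: complex
      unfolding 1 by (simp add: norm_mult norm_divide norm_power power_mult_distrib power_divide)
    have 3: "(norm (of_nat k - z))\<^sup>2 = (x - k)\<^sup>2 + b\<^sup>2" "(norm (of_nat k + z))\<^sup>2 = (x + k)\<^sup>2 + b\<^sup>2"
      by (simp_all add: z_def cmod_power2 power2_commute add.commute)
    have 4: "(norm (of_nat k - complex_of_real x))\<^sup>2 = (x - k)\<^sup>2" "(norm (of_nat k + complex_of_real x))\<^sup>2 = (x + k)\<^sup>2"
      by (simp_all add: cmod_power2 power2_commute add.commute)
    have "(x - k)\<^sup>2 \<noteq> 0" "(x + k)\<^sup>2 \<noteq> 0" using xk[OF that] x by auto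
    then show ?thesis unfolding 2 3 4 using k(2) by (simp add: divide_simps)
  qed
  have ratio: "(norm (f N z))\<^sup>2 = (norm (f N (of_real x)))\<^sup>2 * R N" for N
  proof (induction N)
    case 0
    have "(norm z)\<^sup>2 = x\<^sup>2 + b\<^sup>2" by (simp add: z_def cmod_power2)
    then show ?case using x by (simp add: f_def R_def norm_mult power_mult_distrib field_simps)
  next
    case (Suc N)
    have "f (Suc N) u = f N u * (1 - u\<^sup>2 / of_nat (Suc N) ^ 2)" for u by (simp add: f_def)
    moreover have "R (Suc N) = R N * ((1 + b\<^sup>2 / (x + Suc N)\<^sup>2) * (1 + b\<^sup>2 / (x - Suc N)\<^sup>2))"
      by (simp add: R_def)
    ultimately show ?case using Suc fac[of "Suc N"] by (simp only: norm_mult power_mult_distrib) simp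
  qed
  have lim: "(\<lambda>N. (norm (f N u))\<^sup>2) \<longlonglongrightarrow> (norm (sin (of_real pi * u)))\<^sup>2" for u
    unfolding f_def by (intro tendsto_intros sin_product_formula_complex)
  have n1: "(norm (sin (of_real pi * z)))\<^sup>2 = (cosh (2 * pi * b) - cos (2 * pi * x)) / 2"
    by (simp add: norm_sin_squared z_def cosh_def exp_minus field_simps)
  have n2: "(norm (sin (of_real pi * complex_of_real x)))\<^sup>2 = (1 - cos (2 * pi * x)) / 2"
    by (simp add: norm_sin_squared field_simps)
  have c1: "cos (2 * pi * x) < 1"
  proof -
    have "cos (2 * pi * x) \<noteq> 1"
    proof
      assume "cos (2 * pi * x) = 1"
      then obtain k where "2 * pi * x = of_int k * (2 * pi)" by (auto simp: cos_one_2pi_int)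
      then have "x = of_int k" by simp
      then show False using x by simp
    qed
    then show ?thesis using cos_le_one[of "2 * pi * x"] by (simp only: less_le) simp
  qed
  have fx: "eventually (\<lambda>N. (norm (f N (of_real x)))\<^sup>2 \<noteq> 0) sequentially"
    using lim[of "of_real x"] c1 unfolding n2 by (intro tendsto_imp_eventually_ne) auto
  have "(\<lambda>N. (norm (f N z))\<^sup>2 / (norm (f N (of_real x)))\<^sup>2) \<longlonglongrightarrow>
      (cosh (2 * pi * b) - cos (2 * pi * x)) / (1 - cos (2 * pi * x))"
  proof -
    have half: "(u / 2) / (v / 2) = u / v" for u v :: real by simp
    show ?thesis
      using tendsto_divide[OF lim[of z] lim[of "of_real x"]] c1 unfolding n1 n2 half by simp
  qed
  then have "R \<longlonglongrightarrow> (cosh (2 * pi * b) - cos (2 * pi * x)) / (1 - cos (2 * pi * x))"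
    by (rule Lim_transform_eventually[THEN tendsto_eq_rhs])
       (use fx ratio in \<open>auto elim!: eventually_mono\<close>)
  moreover have "(cosh (2 * pi * b) - cos (2 * pi * x)) / (1 - cos (2 * pi * x)) > 0"
    using c1 cosh_real_ge_1[of "2 * pi * b"] by (intro divide_pos_pos) auto
  ultimately have "(\<lambda>N. ln (R N)) \<longlonglongrightarrow> ln ((cosh (2 * pi * b) - cos (2 * pi * x)) / (1 - cos (2 * pi * x)))"
    by (intro tendsto_ln) auto
  then show ?thesis unfolding lnR .
qed

text \<open>Real part of the series of \<open>- ln (1 - z)\<close> at
  \<open>z = exp (- w) * cis t\<close>, with
  \<open>norm (1 - z) ^ 2 = 2 * exp (- w) * (cosh w - cos t)\<close>. The two factors stay in
  separate logarithms because the first is independent of \<open>t\<close> and disappears against a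
  nonprincipal character.\<close>

lemma sums_cos_geometric_log:
  fixes w t :: real
  assumes "w > 0"
  shows "(\<lambda>n. cos (real (Suc n) * t) * exp (- w * real (Suc n)) / real (Suc n)) sums
           (- (ln (2 * exp (- w)) + ln (cosh w - cos t)) / 2)"
proof -
  define z where "z = rcis (exp (- w)) t"
  have nz: "norm z < 1" using assms by (simp add: z_def)
  have "(\<lambda>n. - ((- (- z)) ^ n) / of_nat n) sums ln (1 + (- z))"
    by (rule Ln_series') (use nz in simp)
  then have "(\<lambda>n. Re (- (z ^ n) / of_nat n)) sums Re (ln (1 - z))"
    by (intro sums_Re) simp
  moreover have "Re (- (z ^ n) / of_nat n) = - (cos (real n * t) * exp (- w * real n) / real n)" for n
  proof -
    have "exp (- w) ^ n = exp (- w * real n)"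
      by (simp add: exp_of_nat_mult [symmetric] mult_ac)
    then have "z ^ n = rcis (exp (- w * real n)) (real n * t)"
      by (simp add: z_def DeMoivre2)
    then show ?thesis by (simp add: mult_ac Re_divide_of_nat)
  qed
  ultimately have "(\<lambda>n. - (cos (real n * t) * exp (- w * real n) / real n)) sums Re (ln (1 - z))"
    by (simp only:)
  then have "(\<lambda>n. cos (real n * t) * exp (- w * real n) / real n) sums (- Re (ln (1 - z)))"
    using sums_minus by fastforce
  then have "(\<lambda>n. cos (real (Suc n) * t) * exp (- w * real (Suc n)) / real (Suc n)) sums (- Re (ln (1 - z)))"
    by (subst sums_Suc_iff) simp
  moreover have "Re (ln (1 - z)) = (ln (2 * exp (- w)) + ln (cosh w - cos t)) / 2"
  proof -
    have "1 - z \<noteq> 0" using nz by auto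
    then have "Re (ln (1 - z)) = ln (norm (1 - z))" by simp
    also have "\<dots> = ln ((norm (1 - z))\<^sup>2) / 2" using \<open>1 - z \<noteq> 0\<close> by (simp add: ln_realpow)
    also have "(norm (1 - z))\<^sup>2 = (2 * exp (- w)) * (cosh w - cos t)"
    proof -
      have "(norm (1 - z))\<^sup>2 = (1 - exp (-w) * cos t)\<^sup>2 + (exp (-w) * sin t)\<^sup>2"
        by (simp add: z_def cmod_power2 rcis_def)
      also have "\<dots> = 1 - 2 * exp (-w) * cos t + exp (-w) ^ 2 * ((cos t)\<^sup>2 + (sin t)\<^sup>2)"
      proof -
        have "(1 - r * c)\<^sup>2 + (r * s)\<^sup>2 = 1 - 2 * r * c + r\<^sup>2 * (c\<^sup>2 + s\<^sup>2)" for r c s :: real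
          by (simp add: power2_eq_square algebra_simps)
        then show ?thesis .
      qed
      also have "\<dots> = 1 - 2 * exp (-w) * cos t + exp (-w) ^ 2" by simp
      also have "\<dots> = (2 * exp (- w)) * (cosh w - cos t)"
      proof -
        have "exp (-w) * exp w = (1::real)" by (simp add: exp_minus)
        then show ?thesis by (simp add: cosh_def field_simps power2_eq_square)
      qed
      finally show ?thesis .
    qed
    also have "ln \<dots> = ln (2 * exp (- w)) + ln (cosh w - cos t)"
    proof (rule ln_mult_pos)
      have "cosh 0 < cosh w" using assms by (intro cosh_real_strict_mono) auto
      then show "cosh w - cos t > 0" using cos_le_one[of t] cosh_0[where 'a=real] by linarith
    qed simp
    finally show ?thesis .
  qed
  ultimately show ?thesis by (simp only: minus_divide_left)
qed

text \<open>Abel's limit theorem in the variable \<open>r = exp (- w)\<close>. Summation by parts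
  expresses the power series through the errors \<open>S n\<close> of the partial sums, with a
  factor \<open>1 - r\<close> in front: this factor kills any finite number of errors, and the
  others are uniformly small. The exponents start at \<open>Suc 0\<close>, which is why
  \<open>exp (- w) * s\<close> appears in place of \<open>s\<close>.\<close>

lemma abel_limit_at_right:
  fixes a :: "nat \<Rightarrow> complex"
  assumes "a sums s" "\<And>n. norm (a n) \<le> 1"
  shows "((\<lambda>w. \<Sum>n. of_real (exp (- w * real (Suc n))) * a n) \<longlongrightarrow> s) (at_right 0)"
proof -
  define S where "S n = (\<Sum>k<Suc n. a k) - s" for n
  have S0: "S \<longlonglongrightarrow> 0"
    using tendsto_diff[OF LIMSEQ_Suc[OF assms(1)[unfolded sums_def]] tendsto_const[of s]]
    unfolding S_def by (simp only: diff_self)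
  obtain B where B: "\<And>n. norm (S n) \<le> B"
    using convergent_imp_Bseq[OF convergentI[OF S0]] unfolding Bseq_def by blast
  have id: "(\<Sum>n. of_real (exp (- w * real (Suc n))) * a n) - of_real (exp (- w)) * s =
        of_real (1 - exp (- w)) * (\<Sum>n. of_real (exp (- w) ^ Suc n) * S n)" if w: "w > 0" for w
  proof -
    define r where "r = exp (- w)"
    have r: "0 < r" "r < 1" using w by (auto simp: r_def)
    have e: "exp (- w * real (Suc n)) = r ^ Suc n" for n
      unfolding r_def exp_of_nat_mult [symmetric] by (simp add: mult_ac)
    have nr: "norm (of_real (r ^ Suc n) :: complex) = r ^ Suc n" for n
      using r by (simp only: norm_of_real) simp
    have gs: "summable (\<lambda>n. r ^ Suc n)"
      using summable_mult[OF summable_geometric[of r], of r] r by simp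
    have sumS: "summable (\<lambda>n. of_real (r ^ Suc n) * S n)"
    proof (rule summable_comparison_test')
      show "summable (\<lambda>n. r ^ Suc n * B)"
        by (rule summable_mult2[OF gs])
      show "norm (of_real (r ^ Suc n) * S n) \<le> r ^ Suc n * B" for n
        unfolding norm_mult nr using r B[of n] by (intro mult_left_mono) auto
    qed
    have suma: "summable (\<lambda>n. of_real (r ^ Suc n) * a n)"
    proof (rule summable_comparison_test')
      show "summable (\<lambda>n. r ^ Suc n)" by (rule gs)
      show "norm (of_real (r ^ Suc n) * a n) \<le> r ^ Suc n" for n
        unfolding norm_mult nr using r assms(2)[of n] by (intro mult_left_le) auto
    qed
    have part: "(\<Sum>n<Suc N. of_real (r ^ Suc n) * a n) - of_real r * s =
        of_real (1 - r) * (\<Sum>n<N. of_real (r ^ Suc n) * S n) + of_real (r ^ Suc N) * S N" for N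
    proof (induction N)
      case 0
      then show ?case by (simp add: S_def algebra_simps)
    next
      case (Suc N)
      define P Q where "P = (\<Sum>n<Suc N. of_real (r ^ Suc n) * a n)" and "Q = (\<Sum>n<N. of_real (r ^ Suc n) * S n)"
      have IH: "P - of_real r * s = of_real (1 - r) * Q + of_real (r ^ Suc N) * S N"
        using Suc unfolding P_def Q_def .
      have 1: "(\<Sum>n<Suc (Suc N). of_real (r ^ Suc n) * a n) = P + of_real (r ^ Suc (Suc N)) * a (Suc N)"
        unfolding P_def by (rule sum.lessThan_Suc)
      have 2: "(\<Sum>n<Suc N. of_real (r ^ Suc n) * S n) = Q + of_real (r ^ Suc N) * S N"
        unfolding Q_def by (rule sum.lessThan_Suc)
      have 3: "a (Suc N) = S (Suc N) - S N" by (simp add: S_def)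
      show ?case unfolding 1 2 3 using IH by (simp add: algebra_simps)
    qed
    have l1: "(\<lambda>N. (\<Sum>n<Suc N. of_real (r ^ Suc n) * a n) - of_real r * s) \<longlonglongrightarrow>
        (\<Sum>n. of_real (r ^ Suc n) * a n) - of_real r * s"
      by (intro tendsto_intros LIMSEQ_Suc summable_LIMSEQ suma)
    have l2: "(\<lambda>N. of_real (1 - r) * (\<Sum>n<N. of_real (r ^ Suc n) * S n) + of_real (r ^ Suc N) * S N) \<longlonglongrightarrow>
        of_real (1 - r) * (\<Sum>n. of_real (r ^ Suc n) * S n) + 0"
      by (intro tendsto_intros summable_LIMSEQ sumS summable_LIMSEQ_zero)
    show ?thesis
      unfolding e r_def [symmetric] using LIMSEQ_unique[OF l1[unfolded part] l2] by (simp only: add_0_right)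
  qed
  have lim0: "((\<lambda>w. of_real (1 - exp (- w)) * (\<Sum>n. of_real (exp (- w) ^ Suc n) * S n)) \<longlongrightarrow> 0) (at_right 0)"
  proof (rule tendstoI)
    fix e :: real assume e: "e > 0"
    then obtain N where N: "\<And>n. n \<ge> N \<Longrightarrow> norm (S n) < e / 2"
      using LIMSEQ_D[OF S0, of "e / 2"] by auto
    define C where "C = (\<Sum>n<N. norm (S n))"
    have C0: "C \<ge> 0" unfolding C_def by (intro sum_nonneg) auto
    have "((\<lambda>w. (1 - exp (- w)) * C) \<longlongrightarrow> (1 - exp (- 0)) * C) (at_right (0::real))"
      by (intro tendsto_intros)
    then have ev: "\<forall>\<^sub>F w in at_right 0. (1 - exp (- w)) * C < e / 2"
      using e by (intro order_tendstoD(2)) auto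
    have pos: "\<forall>\<^sub>F w in at_right (0::real). w > 0" by (simp add: eventually_at_right_less)
    show "\<forall>\<^sub>F w in at_right 0. dist (of_real (1 - exp (- w)) * (\<Sum>n. of_real (exp (- w) ^ Suc n) * S n)) 0 < e"
      using ev pos
    proof eventually_elim
      case (elim w)
      define r where "r = exp (- w)"
      have r: "0 < r" "r < 1" using elim by (auto simp: r_def)
      have nr: "norm (of_real (r ^ Suc n) :: complex) = r ^ Suc n" for n
        using r by (simp only: norm_of_real) simp
      define M where "M n = r ^ Suc n * (e / 2) + (if n < N then norm (S n) else 0)" for n
      have bnd: "norm (of_real (r ^ Suc n) * S n) \<le> M n" for n
      proof (cases "n < N")
        case True
        have "r ^ Suc n \<le> 1" using r by (intro power_le_one) auto
        then have "r ^ Suc n * norm (S n) \<le> 1 * norm (S n)" by (intro mult_right_mono) auto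
        moreover have "0 \<le> r ^ Suc n * (e / 2)" using r e by simp
        ultimately show ?thesis unfolding M_def norm_mult nr using True by simp
      next
        case False
        then have "r ^ Suc n * norm (S n) \<le> r ^ Suc n * (e / 2)" using r N[of n] by (intro mult_left_mono) auto
          then show ?thesis unfolding M_def norm_mult nr using False by simp
      qed
      have Ms: "M sums (r / (1 - r) * (e / 2) + C)"
      proof -
        have "(\<lambda>n. r * r ^ n) sums (r * (1 / (1 - r)))" by (intro sums_mult geometric_sums) (use r in auto)
        then have "(\<lambda>n. r ^ Suc n * (e / 2)) sums (r / (1 - r) * (e / 2))" by (intro sums_mult2) simp
        moreover have "(\<lambda>n. if n < N then norm (S n) else 0) sums C"
          unfolding C_def using sums_If_finite_set[of "{..<N}" "\<lambda>n. norm (S n)"] by simp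
        ultimately show ?thesis unfolding M_def by (rule sums_add)
      qed
      have "norm (\<Sum>n. of_real (r ^ Suc n) * S n) \<le> (\<Sum>n. M n)"
        by (rule norm_suminf_le[OF bnd sums_summable[OF Ms]])
      also have "\<dots> = r / (1 - r) * (e / 2) + C" using Ms by (simp add: sums_iff)
      finally have "(1 - r) * norm (\<Sum>n. of_real (r ^ Suc n) * S n) \<le> (1 - r) * (r / (1 - r) * (e / 2) + C)"
        using r by (intro mult_left_mono) auto
      also have "\<dots> = r * (e / 2) + (1 - r) * C" using r by (simp add: field_simps)
      also have "\<dots> < e / 2 + e / 2"
        using elim r e by (intro add_le_less_mono) (auto simp: r_def)
      finally have *: "(1 - r) * norm (\<Sum>n. of_real (r ^ Suc n) * S n) < e" by simp
      have "norm (of_real (1 - r) :: complex) = 1 - r" using r by (simp only: norm_of_real)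
      then show ?case using * unfolding r_def [symmetric] by (simp only: dist_0_norm dist_commute norm_mult)
    qed
  qed
  have "((\<lambda>w. of_real (exp (- w)) * s + of_real (1 - exp (- w)) * (\<Sum>n. of_real (exp (- w) ^ Suc n) * S n))
         \<longlongrightarrow> of_real (exp (- 0)) * s + 0) (at_right 0)"
    by (intro tendsto_add[OF _ lim0] tendsto_intros)
  moreover have "\<forall>\<^sub>F w in at_right 0. of_real (exp (- w)) * s + of_real (1 - exp (- w)) *
      (\<Sum>n. of_real (exp (- w) ^ Suc n) * S n) = (\<Sum>n. of_real (exp (- w * real (Suc n))) * a n)"
    using eventually_at_right_less[of "0::real"]
  proof eventually_elim
    case (elim w)
    show ?case using id[OF elim] by (simp only: diff_eq_eq) (simp only: add.commute)
  qed
  ultimately have "((\<lambda>w. \<Sum>n. of_real (exp (- w * real (Suc n))) * a n) \<longlongrightarrow> of_real (exp (- 0)) * s + 0) (at_right 0)"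
    by (rule Lim_transform_eventually)
  then show ?thesis by simp
qed

section \<open>The logarithmic duality formula for even characters\<close>

lemma sum_even_reflect:
  fixes f :: "int \<Rightarrow> complex"
  assumes "q > 0" "\<And>x y. [x = y] (mod int q) \<Longrightarrow> f x = f y"
  shows "(\<Sum>x\<in>{0..<int q}. f (- x)) = (\<Sum>x\<in>{0..<int q}. f x)"
  using sum_periodic_reindex_mult[OF assms(1) _ assms(2), of "-1"] by simp

text \<open>Division with remainder by \<open>q\<close>. Residues start at 0, so the integers
  covered by the \<open>2 * N + 1\<close> blocks are not symmetric about 0: there are
  \<open>q - 1\<close> more positive ones than negative ones.\<close>

lemma sum_over_periods:
  fixes c :: "int \<Rightarrow> complex" and l :: "int \<Rightarrow> complex"
  assumes q: "q > 0" and c: "\<And>x y. [x = y] (mod int q) \<Longrightarrow> c x = c y"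
  shows "(\<Sum>a\<in>{0..<int q}. c a * (\<Sum>j\<in>{-int N..int N}. l (a + int q * j))) =
         (\<Sum>m\<in>{-int q * int N..<int q * (int N + 1)}. c m * l m)"
proof -
  have "(\<Sum>a\<in>{0..<int q}. c a * (\<Sum>j\<in>{-int N..int N}. l (a + int q * j))) =
        (\<Sum>(a, j)\<in>{0..<int q} \<times> {-int N..int N}. c (a + int q * j) * l (a + int q * j))"
    unfolding sum_distrib_left sum.cartesian_product
    by (intro sum.cong refl) (auto intro!: c simp: cong_def)
  also have "\<dots> = (\<Sum>m\<in>{-int q * int N..<int q * (int N + 1)}. c m * l m)"
  proof (rule sum.reindex_bij_witness[of _ "\<lambda>m. (m mod int q, m div int q)" "\<lambda>(a, j). a + int q * j"])
    fix p assume "p \<in> {0..<int q} \<times> {-int N..int N}"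
    then obtain a j where p: "p = (a, j)" "0 \<le> a" "a < int q" "- int N \<le> j" "j \<le> int N" by auto
    have "int q * (- int N) \<le> int q * j" "int q * j \<le> int q * int N"
      using p q by (auto intro: mult_left_mono simp del: mult_minus_right)
    then have "- int q * int N \<le> a + int q * j" "a + int q * j < int q * (int N + 1)"
      using p by (simp_all only: distrib_left mult_minus_left mult_minus_right)
    then show "(case p of (a, j) \<Rightarrow> a + int q * j) \<in> {-int q * int N..<int q * (int N + 1)}"
      using p by simp
    show "((case p of (a, j) \<Rightarrow> a + int q * j) mod int q, (case p of (a, j) \<Rightarrow> a + int q * j) div int q) = p"
      using p q by (auto simp: mod_pos_pos_trivial div_pos_pos_trivial)
  next
    fix m assume m: "m \<in> {-int q * int N..<int q * (int N + 1)}"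
    show "(case (m mod int q, m div int q) of (a, j) \<Rightarrow> a + int q * j) = m" by simp
    have "int q * (m div int q) \<le> m" "m < int q * (m div int q) + int q"
      using q by (simp_all add: minus_mod_eq_mult_div [symmetric])
    then have "int q * (m div int q) < int q * (int N + 1)" "int q * (- int N - 1) < int q * (m div int q)"
      using m by (auto simp: algebra_simps)
    then have "m div int q < int N + 1" "- int N - 1 < m div int q" using q by auto
    then show "(m mod int q, m div int q) \<in> {0..<int q} \<times> {-int N..int N}" using q by auto
  qed (auto simp: mult_ac)
  finally show ?thesis .
qed

lemma ln_one_plus_le: "0 \<le> x \<Longrightarrow> ln (1 + x) \<le> (x :: real)"
  by (rule ln_add_one_self_le_self)

lemma summable_inverse_squares_Suc: "summable (\<lambda>m. c / (real (Suc m))\<^sup>2)"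
  using summable_mult[OF iffD2[OF summable_Suc_iff inverse_power_summable[of 2, where 'a = real]], of c]
  by (simp add: field_simps)

text \<open>Expanding \<open>t * chi n\<close> as a Gauss sum and summing over \<open>n\<close> gives
  \<open>ln (cosh w - cos (2 \<pi> a / q))\<close>, which the product formula of the sine turns into a sum of logarithms
  over the integers congruent to \<open>a\<close>. The term at \<open>w = 0\<close> yields \<open>L(1, chi)\<close> by Abel summation.\<close>

lemma even_primitive_log_duality:
  assumes prim: "primitive_dirichlet_character q chi" and q1: "q > 1" and even: "chi (-1) = 1"
    and w: "w > 0"
  defines "t \<equiv> (\<Sum>a\<in>{0..<int q}. cnj (chi a) * cis (2 * pi * of_int a / q))"
  shows "t * (Dirichlet_L chi 1 - (\<Sum>n. chi (int (Suc n)) * of_real (exp (- w * real (Suc n)) / real (Suc n)))) =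
         (\<Sum>m. cnj (chi (int (Suc m))) * of_real (ln (1 + (w * q / (2 * pi * real (Suc m)))\<^sup>2)))"
proof -
  have dc: "dirichlet_character q chi" using prim by (simp add: primitive_dirichlet_character_def)
  have q: "q > 0" and mult: "\<And>a b. chi (a * b) = chi a * chi b"
    using dc by (auto simp: dirichlet_character_def)
  obtain b where b: "coprime b (int q)" "chi b \<noteq> 1"
    using primitive_dirichlet_character_nonprincipal[OF prim q1] by blast
  have sum0: "(\<Sum>a\<in>{0..<int q}. cnj (chi a)) = 0"
    using dirichlet_character_period_sum[OF dc b] by (metis cnj_sum complex_cnj_zero)
  have even': "chi (- a) = chi a" for a using mult[of "-1" a] even by simp
  have "chi 0 \<noteq> 0 \<longleftrightarrow> coprime 0 (int q)" using dc unfolding dirichlet_character_def by blast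
  then have chi0: "chi 0 = 0" using q1 by simp
  let ?R = "{0..<int q}"
  define th where "th a = 2 * pi * real_of_int a / q" for a
  have cperiod: "cnj (chi x) = cnj (chi y)" if "[x = y] (mod int q)" for x y
    using dirichlet_character_cong[OF dc that] by simp
  have gauss: "chi n * t = (\<Sum>a\<in>?R. cnj (chi a) * of_real (cos (of_int n * th a)))" for n :: int
  proof -
    define f where "f a = cnj (chi a) * cis (2 * pi * of_int (n * a) / q)" for a
    have per: "f x = f y" if "[x = y] (mod int q)" for x y
      unfolding f_def using cperiod[OF that] cis_multiple_eq[OF cong_scalar_left[OF that, of n] q] by simp
    have "chi n * t = (\<Sum>a\<in>?R. f a)"
      unfolding f_def t_def using gauss_sum_separable[OF prim, of n] by simp
    moreover have "(\<Sum>a\<in>?R. f a) = (\<Sum>a\<in>?R. f (- a))" using sum_even_reflect[OF q, of f, OF per] by simp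
    \<comment> \<open>Averaging over \<open>a\<close> and \<open>- a\<close> turns the exponentials
      into cosines, because \<open>cnj (chi a)\<close> is even in \<open>a\<close>.\<close>
    ultimately have "2 * (chi n * t) = (\<Sum>a\<in>?R. f a + f (- a))" by (simp add: sum.distrib)
    also have "\<dots> = (\<Sum>a\<in>?R. 2 * (cnj (chi a) * of_real (cos (of_int n * th a))))"
    proof (intro sum.cong refl)
      fix a
      have "f a + f (- a) = cnj (chi a) * (cis (2 * pi * of_int (n * a) / q) + cis (- (2 * pi * of_int (n * a) / q)))"
        by (simp add: f_def even' distrib_left)
      also have "cis x + cis (- x) = 2 * of_real (cos x)" for x by (simp add: complex_eq_iff)
      finally show "f a + f (- a) = 2 * (cnj (chi a) * of_real (cos (of_int n * th a)))"
        by (simp add: th_def mult_ac)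
    qed
    finally show ?thesis by (simp add: sum_distrib_left [symmetric])
  qed
  define G where "G w = (\<Sum>n. chi (int (Suc n)) * of_real (exp (- w * real (Suc n)) / real (Suc n)))" for w
  have tG: "t * G w = (\<Sum>a\<in>?R. cnj (chi a) * of_real (- ln (cosh w - cos (th a)) / 2))" if "w > 0" for w
  proof -
    have "(\<lambda>n. \<Sum>a\<in>?R. cnj (chi a) * of_real (cos (real (Suc n) * th a) * exp (- w * real (Suc n)) / real (Suc n)))
        sums (\<Sum>a\<in>?R. cnj (chi a) * of_real (- (ln (2 * exp (- w)) + ln (cosh w - cos (th a))) / 2))"
      by (intro sums_sum sums_mult sums_of_real sums_cos_geometric_log that)
    also have "(\<lambda>n. \<Sum>a\<in>?R. cnj (chi a) * of_real (cos (real (Suc n) * th a) * exp (- w * real (Suc n)) / real (Suc n))) =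
         (\<lambda>n. t * (chi (int (Suc n)) * of_real (exp (- w * real (Suc n)) / real (Suc n))))"
    proof
      fix n
      have "t * (chi (int (Suc n)) * of_real (exp (- w * real (Suc n)) / real (Suc n))) =
         (\<Sum>a\<in>?R. cnj (chi a) * of_real (cos (of_int (int (Suc n)) * th a))) * of_real (exp (- w * real (Suc n)) / real (Suc n))"
        unfolding gauss [symmetric] by (simp add: mult_ac)
      then show "(\<Sum>a\<in>?R. cnj (chi a) * of_real (cos (real (Suc n) * th a) * exp (- w * real (Suc n)) / real (Suc n))) =
         t * (chi (int (Suc n)) * of_real (exp (- w * real (Suc n)) / real (Suc n)))"
        unfolding sum_distrib_right by (simp add: mult.assoc)
    qed
    also have "(\<Sum>a\<in>?R. cnj (chi a) * of_real (- (ln (2 * exp (- w)) + ln (cosh w - cos (th a))) / 2)) =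
        (\<Sum>a\<in>?R. cnj (chi a) * of_real (- ln (2 * exp (- w)) / 2) + cnj (chi a) * of_real (- ln (cosh w - cos (th a)) / 2))"
      by (intro sum.cong refl) (simp only: distrib_left [symmetric] of_real_add [symmetric], simp add: add_divide_distrib)
    also have "\<dots> = (\<Sum>a\<in>?R. cnj (chi a) * of_real (- ln (cosh w - cos (th a)) / 2))"
      unfolding sum.distrib sum_distrib_right [symmetric] sum0 by simp
    finally have *: "(\<lambda>n. t * (chi (int (Suc n)) * of_real (exp (- w * real (Suc n)) / real (Suc n)))) sums
        (\<Sum>a\<in>?R. cnj (chi a) * of_real (- ln (cosh w - cos (th a)) / 2))" .
    have "t \<noteq> 0" using norm_gauss_sum[OF prim] q unfolding t_def by auto
    then have "summable (\<lambda>n. chi (int (Suc n)) * of_real (exp (- w * real (Suc n)) / real (Suc n)))"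
      using sums_summable[OF *] by (simp only: summable_cmult_iff) simp
    then show ?thesis using * unfolding G_def by (simp only: suminf_mult sums_iff)
  qed
  have c1: "cos (th a) < 1" if "a \<in> ?R" "a \<noteq> 0" for a
  proof -
    have "cos (th a) \<noteq> 1"
    proof
      assume "cos (th a) = 1"
      then obtain k where "th a = of_int k * (2 * pi)" by (auto simp: cos_one_2pi_int)
      then have "real_of_int a = of_int (k * int q)" using q by (simp add: th_def field_simps)
      then have "a = k * int q" by linarith
      moreover have "0 < a" "a < int q" using that by auto
      ultimately show False using zdvd_not_zless[of a "int q"] by simp
    qed
    then show ?thesis using cos_le_one[of "th a"] by linarith
  qed
  have lim1: "(G \<longlongrightarrow> Dirichlet_L chi 1) (at_right 0)"
  proof -
    have "(\<lambda>n. chi (int (Suc n)) / of_nat (Suc n)) sums Dirichlet_L chi 1"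
      using Dirichlet_L_sums[OF dc b, of 1] by simp
    moreover have "norm (chi (int (Suc n)) / of_nat (Suc n)) \<le> 1" for n
    proof -
      have "norm (chi (int (Suc n))) \<le> real (Suc n)"
        using dirichlet_character_norm_le[OF dc, of "int (Suc n)"] by simp
      then show ?thesis by (simp add: norm_divide del: of_nat_Suc)
    qed
    ultimately have "((\<lambda>w. \<Sum>n. of_real (exp (- w * real (Suc n))) * (chi (int (Suc n)) / of_nat (Suc n))) \<longlongrightarrow> Dirichlet_L chi 1) (at_right 0)"
      by (rule abel_limit_at_right)
    then show ?thesis by (simp add: G_def [abs_def] mult_ac del: of_nat_Suc)
  qed
  have lim2: "((\<lambda>w. \<Sum>a\<in>?R. cnj (chi a) * of_real (- ln (cosh w - cos (th a)) / 2)) \<longlongrightarrow>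
      (\<Sum>a\<in>?R. cnj (chi a) * of_real (- ln (1 - cos (th a)) / 2))) (at_right 0)"
  proof (intro tendsto_sum)
    fix a assume a: "a \<in> ?R"
    show "((\<lambda>w. cnj (chi a) * of_real (- ln (cosh w - cos (th a)) / 2)) \<longlongrightarrow>
        cnj (chi a) * of_real (- ln (1 - cos (th a)) / 2)) (at_right 0)"
    proof (cases "a = 0")
      case True
      then show ?thesis by (simp add: chi0)
    next
      case False
      have "(cosh \<longlongrightarrow> 1) (at_right (0::real))"
        using tendsto_cosh[OF tendsto_ident_at[of "0::real" "{0<..}"]] by simp
      then show ?thesis using c1[OF a False] by (intro tendsto_intros) auto
    qed
  qed
  have tL: "t * Dirichlet_L chi 1 = (\<Sum>a\<in>?R. cnj (chi a) * of_real (- ln (1 - cos (th a)) / 2))"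
  proof (rule tendsto_unique[OF trivial_limit_at_right_real])
    show "((\<lambda>w. \<Sum>a\<in>?R. cnj (chi a) * of_real (- ln (cosh w - cos (th a)) / 2)) \<longlongrightarrow> t * Dirichlet_L chi 1) (at_right 0)"
      using tendsto_mult[OF tendsto_const[of t] lim1]
      by (rule Lim_transform_eventually) (rule eventually_mono[OF eventually_at_right_less[of 0]], rule tG)
  qed (rule lim2)
  define l where "l m = ln (1 + (w * q / (2 * pi * real_of_int m))\<^sup>2)" for m
  have l_even: "l (- m) = l m" for m by (simp add: l_def)
  have l_nonneg: "l m \<ge> 0" for m by (simp add: l_def)
  have lnSum: "(\<lambda>N. \<Sum>j\<in>{-int N..int N}. l (a + int q * j)) \<longlonglongrightarrow> ln ((cosh w - cos (th a)) / (1 - cos (th a)))"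
    if a: "a \<in> ?R" "a \<noteq> 0" for a
  proof -
    define x where "x = real_of_int a / q"
    define b where "b = w / (2 * pi)"
    have x: "0 < x" "x < 1" using a q by (auto simp: x_def)
    have bp: "b > 0" using w by (simp add: b_def)
    have lj: "l (a + int q * j) = ln (1 + b\<^sup>2 / (x + of_int j)\<^sup>2)" for j
    proof -
      have "w * q / (2 * pi * real_of_int (a + int q * j)) = b / (x + of_int j)"
        using q by (simp add: b_def x_def field_simps)
      then show ?thesis by (simp add: l_def power_divide)
    qed
    have "(\<Sum>j\<in>{-int N..int N}. l (a + int q * j)) = ln (1 + b\<^sup>2 / x\<^sup>2) +
        (\<Sum>k=1..N. ln (1 + b\<^sup>2 / (x + real k)\<^sup>2) + ln (1 + b\<^sup>2 / (x - real k)\<^sup>2))" for N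
    proof (induction N)
      case 0
      then show ?case using lj[of 0] by simp
    next
      case (Suc N)
      have "{-int (Suc N)..int (Suc N)} = insert (int (Suc N)) (insert (- int (Suc N)) {-int N..int N})" by auto
      then have split: "(\<Sum>j\<in>{-int (Suc N)..int (Suc N)}. l (a + int q * j)) =
          l (a + int q * int (Suc N)) + (l (a + int q * (- int (Suc N))) + (\<Sum>j\<in>{-int N..int N}. l (a + int q * j)))"
        by simp
      have p1: "l (a + int q * int (Suc N)) = ln (1 + b\<^sup>2 / (x + real (Suc N))\<^sup>2)"
        unfolding lj by simp
      have p2: "l (a + int q * (- int (Suc N))) = ln (1 + b\<^sup>2 / (x - real (Suc N))\<^sup>2)"
        unfolding lj by (simp add: algebra_simps)
      show ?case unfolding split p1 p2 Suc by simp
    qed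
    moreover have "2 * pi * b = w" "2 * pi * x = th a" by (simp_all add: b_def x_def th_def)
    ultimately show ?thesis using ln_product_ratio_tendsto[OF x bp] by simp
  qed
  have sl: "summable (\<lambda>m. cnj (chi (int (Suc m))) * of_real (l (int (Suc m))))"
  proof (rule summable_comparison_test')
    show "summable (\<lambda>m. (w * q / (2 * pi))\<^sup>2 / (real (Suc m))\<^sup>2)" by (rule summable_inverse_squares_Suc)
    fix m
    have "norm (cnj (chi (int (Suc m))) * of_real (l (int (Suc m)))) \<le> 1 * l (int (Suc m))"
      unfolding norm_mult using l_nonneg dirichlet_character_norm_le[OF dc]
      by (intro mult_mono) auto
    also have "l (int (Suc m)) \<le> (w * q / (2 * pi * real (Suc m)))\<^sup>2"
      unfolding l_def using ln_one_plus_le[of "(w * q / (2 * pi * real (Suc m)))\<^sup>2"] by simp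
    finally show "norm (cnj (chi (int (Suc m))) * of_real (l (int (Suc m)))) \<le> (w * q / (2 * pi))\<^sup>2 / (real (Suc m))\<^sup>2"
      by (simp add: power_mult_distrib power_divide)
  qed
  define T where "T = (\<Sum>m. cnj (chi (int (Suc m))) * of_real (l (int (Suc m))))"
  define F where "F M = (\<Sum>m<M. cnj (chi (int (Suc m))) * of_real (l (int (Suc m))))" for M
  have FT: "F \<longlonglongrightarrow> T" unfolding F_def T_def by (rule summable_LIMSEQ[OF sl])
  have Fsum: "F M = (\<Sum>m\<in>{1..int M}. cnj (chi m) * of_real (l m))" for M
    unfolding F_def by (rule sum.reindex_bij_witness[of _ "\<lambda>m. nat (m - 1)" "\<lambda>n. int (Suc n)"]) auto
  \<comment> \<open>Evenness folds the negative integers onto the positive ones, and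
    \<open>chi 0 = 0\<close> removes the term at 0. The two partial sums of \<open>F\<close> differ
    in length but share the limit \<open>T\<close>, so the blocks tend to
    \<open>T + T\<close>.\<close>
  have blocks: "(\<Sum>a\<in>?R. cnj (chi a) * (\<Sum>j\<in>{-int N..int N}. of_real (l (a + int q * j)))) =
        F (q * N + (q - 1)) + F (q * N)" for N
  proof -
    have "(\<Sum>a\<in>?R. cnj (chi a) * (\<Sum>j\<in>{-int N..int N}. of_real (l (a + int q * j)))) =
        (\<Sum>m\<in>{-int q * int N..<int q * (int N + 1)}. cnj (chi m) * of_real (l m))"
      by (rule sum_over_periods[OF q cperiod, where l = "\<lambda>m. of_real (l m)"])
    also have "{-int q * int N..<int q * (int N + 1)} = insert 0 ({1..int (q * N + (q - 1))} \<union> uminus ` {1..int (q * N)})"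
    proof -
      define M where "M = int q * int N"
      have M: "-int q * int N = - M" "int q * (int N + 1) = M + int q" "int (q * N) = M"
        "int (q * N + (q - 1)) = M + int q - 1" "0 \<le> M" "0 < int q"
        using q by (simp_all add: M_def algebra_simps of_nat_diff)
      have "uminus ` {1..M} = {- M..- 1}" by simp
      then show ?thesis unfolding M using M(5,6) by auto
    qed
    also have "(\<Sum>m\<in>\<dots>. cnj (chi m) * of_real (l m)) =
        F (q * N + (q - 1)) + (\<Sum>m\<in>uminus ` {1..int (q * N)}. cnj (chi m) * of_real (l m))"
      by (subst sum.insert, simp, force, subst sum.union_disjoint) (auto simp: chi0 Fsum)
    also have "(\<Sum>m\<in>uminus ` {1..int (q * N)}. cnj (chi m) * of_real (l m)) = F (q * N)"
      unfolding Fsum by (subst sum.reindex) (auto simp: even' l_even)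
    finally show ?thesis .
  qed
  have "(\<lambda>N. F (q * N + (q - 1)) + F (q * N)) \<longlonglongrightarrow> T + T"
  proof (intro tendsto_add)
    have "filterlim (\<lambda>N. q * N) at_top sequentially"
      by (intro filterlim_subseq strict_monoI mult_strict_left_mono) (use q in auto)
    moreover have "filterlim (\<lambda>N. q * N + (q - 1)) at_top sequentially"
      by (intro filterlim_subseq strict_monoI add_strict_right_mono mult_strict_left_mono) (use q in auto)
    ultimately show "(\<lambda>N. F (q * N)) \<longlonglongrightarrow> T" "(\<lambda>N. F (q * N + (q - 1))) \<longlonglongrightarrow> T"
      using filterlim_compose[OF FT] by blast+
  qed
  moreover have "(\<lambda>N. \<Sum>a\<in>?R. cnj (chi a) * (\<Sum>j\<in>{-int N..int N}. of_real (l (a + int q * j)))) \<longlonglongrightarrow>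
      (\<Sum>a\<in>?R. cnj (chi a) * of_real (ln ((cosh w - cos (th a)) / (1 - cos (th a)))))"
  proof (intro tendsto_sum)
    fix a assume a: "a \<in> ?R"
    show "(\<lambda>N. cnj (chi a) * (\<Sum>j\<in>{-int N..int N}. of_real (l (a + int q * j)))) \<longlonglongrightarrow>
      cnj (chi a) * of_real (ln ((cosh w - cos (th a)) / (1 - cos (th a))))"
    proof (cases "a = 0")
      case True
      then show ?thesis by (simp add: chi0)
    next
      case False
      show ?thesis unfolding of_real_sum [symmetric] using lnSum[OF a False] by (intro tendsto_intros)
    qed
  qed
  ultimately have TT: "T + T = (\<Sum>a\<in>?R. cnj (chi a) * of_real (ln ((cosh w - cos (th a)) / (1 - cos (th a)))))"
    unfolding blocks by (rule LIMSEQ_unique)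
  have "2 * (t * (Dirichlet_L chi 1 - G w)) =
     (\<Sum>a\<in>?R. 2 * (cnj (chi a) * of_real (- ln (1 - cos (th a)) / 2)) - 2 * (cnj (chi a) * of_real (- ln (cosh w - cos (th a)) / 2)))"
    unfolding right_diff_distrib tL tG[OF w] sum_subtractf sum_distrib_left by simp
  also have "\<dots> = T + T" unfolding TT
  proof (intro sum.cong refl)
    fix a assume a: "a \<in> ?R"
    show "2 * (cnj (chi a) * of_real (- ln (1 - cos (th a)) / 2)) - 2 * (cnj (chi a) * of_real (- ln (cosh w - cos (th a)) / 2)) =
       cnj (chi a) * of_real (ln ((cosh w - cos (th a)) / (1 - cos (th a))))"
    proof (cases "a = 0")
      case True
      then show ?thesis by (simp add: chi0)
    next
      case False
      have "cosh w - cos (th a) > 0" using cosh_real_ge_1[of w] c1[OF a False] by linarith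
      then have eq: "ln ((cosh w - cos (th a)) / (1 - cos (th a))) = ln (cosh w - cos (th a)) - ln (1 - cos (th a))"
        using c1[OF a False] by (simp add: ln_div)
      show ?thesis unfolding eq by (simp add: algebra_simps)
    qed
  qed
  finally have "t * (Dirichlet_L chi 1 - G w) = T" by simp
  then show ?thesis by (simp add: G_def T_def l_def)
qed

section \<open>Dual pairs of weights\<close>

lemma has_real_derivative_dominated_series:
  fixes f f' :: "nat \<Rightarrow> real \<Rightarrow> real"
  assumes der: "\<And>n w. w > 0 \<Longrightarrow> (f n has_real_derivative f' n w) (at w)"
    and sm: "\<And>w. w > 0 \<Longrightarrow> summable (\<lambda>n. f n w)"
    and dom: "\<And>n w. a < w \<Longrightarrow> w < b \<Longrightarrow> \<bar>f' n w\<bar> \<le> M n" "summable M"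
    and w: "0 \<le> a" "a < w" "w < b"
  shows "((\<lambda>w. \<Sum>n. f n w) has_real_derivative (\<Sum>n. f' n w)) (at w)"
proof (rule has_field_derivative_series'(2)[of "{a<..<b}"])
  show "uniformly_convergent_on {a<..<b} (\<lambda>n w. \<Sum>i<n. f' i w)"
    by (rule Weierstrass_m_test'[OF _ dom(2)]) (use dom(1) in auto)
  show "(f n has_field_derivative f' n x) (at x within {a<..<b})" if "x \<in> {a<..<b}" for n x
    by (rule has_field_derivative_at_within[OF der]) (use that w in auto)
  show "summable (\<lambda>n. f n w)" using sm w by simp
qed (use w in auto)

text \<open>The sequences are shifted: \<open>c n\<close> and \<open>d n\<close> are the coefficients at \<open>Suc n\<close>.\<close>

definition dual_pair :: "(nat \<Rightarrow> real) \<Rightarrow> (nat \<Rightarrow> real) \<Rightarrow> real \<Rightarrow> real \<Rightarrow> (real \<Rightarrow> real) \<Rightarrow> (real \<Rightarrow> real) \<Rightarrow> (real \<Rightarrow> real) \<Rightarrow> bool" where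
  "dual_pair c d K \<kappa> u v E \<longleftrightarrow> (\<forall>w>0.
     summable (\<lambda>n. c n * u (w * real (Suc n)) / real (Suc n)) \<and>
     summable (\<lambda>m. d m * v (w / (\<kappa> * real (Suc m)))) \<and>
     (\<Sum>n. c n * u (w * real (Suc n)) / real (Suc n)) + K * (\<Sum>m. d m * v (w / (\<kappa> * real (Suc m)))) = E w)"

lemma dual_pair_linear:
  assumes "dual_pair c d K \<kappa> u1 v1 E1" "dual_pair c d K \<kappa> u2 v2 E2"
  shows "dual_pair c d K \<kappa> (\<lambda>t. x * u1 t + y * u2 t) (\<lambda>t. x * v1 t + y * v2 t) (\<lambda>w. x * E1 w + y * E2 w)"
  unfolding dual_pair_def
proof (intro allI impI)
  fix w :: real assume w: "w > 0"
  define A1 A2 B1 B2 where "A1 = (\<lambda>n. c n * u1 (w * real (Suc n)) / real (Suc n))"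
    and "A2 = (\<lambda>n. c n * u2 (w * real (Suc n)) / real (Suc n))"
    and "B1 = (\<lambda>m. d m * v1 (w / (\<kappa> * real (Suc m))))" and "B2 = (\<lambda>m. d m * v2 (w / (\<kappa> * real (Suc m))))"
  have s: "summable A1" "summable A2" "summable B1" "summable B2"
    and e: "suminf A1 + K * suminf B1 = E1 w" "suminf A2 + K * suminf B2 = E2 w"
    using assms w by (auto simp: dual_pair_def A1_def A2_def B1_def B2_def)
  have eqA: "(\<lambda>n. c n * (x * u1 (w * real (Suc n)) + y * u2 (w * real (Suc n))) / real (Suc n)) = (\<lambda>n. x * A1 n + y * A2 n)"
    by (simp add: A1_def A2_def add_divide_distrib distrib_left mult_ac)
  have eqB: "(\<lambda>m. d m * (x * v1 (w / (\<kappa> * real (Suc m))) + y * v2 (w / (\<kappa> * real (Suc m))))) = (\<lambda>n. x * B1 n + y * B2 n)"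
    by (simp add: B1_def B2_def distrib_left mult_ac)
  have "suminf (\<lambda>n. x * A1 n + y * A2 n) = x * suminf A1 + y * suminf A2"
    using s by (simp add: suminf_add [symmetric] suminf_mult summable_mult)
  moreover have "suminf (\<lambda>n. x * B1 n + y * B2 n) = x * suminf B1 + y * suminf B2"
    using s by (simp add: suminf_add [symmetric] suminf_mult summable_mult)
  ultimately show "summable (\<lambda>n. c n * (x * u1 (w * real (Suc n)) + y * u2 (w * real (Suc n))) / real (Suc n)) \<and>
     summable (\<lambda>m. d m * (x * v1 (w / (\<kappa> * real (Suc m))) + y * v2 (w / (\<kappa> * real (Suc m))))) \<and>
     (\<Sum>n. c n * (x * u1 (w * real (Suc n)) + y * u2 (w * real (Suc n))) / real (Suc n)) +
     K * (\<Sum>m. d m * (x * v1 (w / (\<kappa> * real (Suc m))) + y * v2 (w / (\<kappa> * real (Suc m))))) = x * E1 w + y * E2 w"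
    unfolding eqA eqB using s by (auto intro!: summable_add summable_mult simp: e [symmetric] algebra_simps)
qed

text \<open>The operator \<open>w d/dw\<close> commutes with dilations, so applied to the identity
  it acts on \<open>u\<close> and on \<open>v\<close> separately, each in its own variable. The
  bounds on \<open>u'\<close> and \<open>v'\<close> make the differentiated terms
  \<open>O(1 / n^2)\<close> uniformly for \<open>w0 / 2 < w < 2 * w0\<close>, which justifies
  differentiating termwise.\<close>

lemma dual_pair_euler_step:
  fixes c d :: "nat \<Rightarrow> real"
  assumes pair: "dual_pair c d K \<kappa> u v E"
    and c: "\<And>n. \<bar>c n\<bar> \<le> 1" and d: "\<And>m. \<bar>d m\<bar> \<le> 1" and \<kappa>: "\<kappa> > 0"
    and u: "\<And>t. t > 0 \<Longrightarrow> (u has_real_derivative u' t) (at t)"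
    and v: "\<And>x. x > 0 \<Longrightarrow> (v has_real_derivative v' x) (at x)"
    and E: "\<And>w. w > 0 \<Longrightarrow> (E has_real_derivative E' w) (at w)"
    and u'_bound: "\<And>t. t > 0 \<Longrightarrow> \<bar>t\<^sup>2 * u' t\<bar> \<le> Cu" and v'_bound: "\<And>x. x > 0 \<Longrightarrow> \<bar>v' x\<bar> \<le> Cv * x"
  shows "dual_pair c d K \<kappa> (\<lambda>t. t * u' t) (\<lambda>x. x * v' x) (\<lambda>w. w * E' w)"
  unfolding dual_pair_def
proof (intro allI impI)
  fix w0 :: real assume w0: "w0 > 0"
  define f where "f n w = c n * u (w * real (Suc n)) / real (Suc n)" for n w
  define f' where "f' n w = c n * u' (w * real (Suc n))" for n w
  define g where "g m w = d m * v (w / (\<kappa> * real (Suc m)))" for m w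
  define g' where "g' m w = d m * v' (w / (\<kappa> * real (Suc m))) / (\<kappa> * real (Suc m))" for m w
  have sq: "summable (\<lambda>m. C / (real (Suc m))\<^sup>2)" for C
    using summable_mult[OF iffD2[OF summable_Suc_iff inverse_power_summable[of 2, where 'a = real]], of C]
    by (simp add: field_simps)
  have Cu0: "Cu \<ge> 0" using u'_bound[of 1] by simp
  have Cv0: "Cv \<ge> 0" using v'_bound[of 1] by simp
  have pos: "w * real (Suc n) > 0" "w / (\<kappa> * real (Suc n)) > 0" if "w > 0" for w n using that \<kappa> by simp_all
  have df: "(f n has_real_derivative f' n w) (at w)" if "w > 0" for n w
  proof -
    have "((\<lambda>w. u (w * real (Suc n))) has_real_derivative u' (w * real (Suc n)) * real (Suc n)) (at w)"
      by (rule DERIV_chain2[where g = "\<lambda>w. w * real (Suc n)", OF u[OF pos(1)[OF that]]])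
        (auto intro!: derivative_eq_intros)
    from DERIV_cmult[OF this, of "c n / real (Suc n)"] show ?thesis
      unfolding f_def [abs_def] f'_def by (simp del: of_nat_Suc)
  qed
  have dg: "(g n has_real_derivative g' n w) (at w)" if "w > 0" for n w
  proof -
    have "((\<lambda>w. v (w / (\<kappa> * real (Suc n)))) has_real_derivative v' (w / (\<kappa> * real (Suc n))) * (1 / (\<kappa> * real (Suc n)))) (at w)"
      by (rule DERIV_chain2[where g = "\<lambda>w. w / (\<kappa> * real (Suc n))", OF v[OF pos(2)[OF that]]])
        (rule DERIV_cdivide, rule DERIV_ident)
    from DERIV_cmult[OF this, of "d n"] show ?thesis
      unfolding g_def [abs_def] g'_def by (simp del: of_nat_Suc)
  qed
  have sf: "summable (\<lambda>n. f n w)" and sg: "summable (\<lambda>n. g n w)"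
    and fg: "(\<Sum>n. f n w) + K * (\<Sum>n. g n w) = E w" if "w > 0" for w
    using pair that by (auto simp: dual_pair_def f_def g_def)
  define Mf where "Mf n = 4 * Cu / w0\<^sup>2 / (real (Suc n))\<^sup>2" for n
  define Mg where "Mg n = 2 * w0 * Cv / \<kappa>\<^sup>2 / (real (Suc n))\<^sup>2" for n
  have bf: "\<bar>f' n w\<bar> \<le> Mf n" if "w0 / 2 < w" "w < 2 * w0" for n w
  proof -
    have wp: "w > 0" using that w0 by linarith
    define t where "t = w * real (Suc n)"
    have t: "t > 0" using pos(1)[OF wp] by (simp add: t_def)
    have "\<bar>f' n w\<bar> \<le> 1 * \<bar>u' t\<bar>" unfolding f'_def t_def abs_mult by (intro mult_right_mono c) auto
    also have "\<dots> \<le> Cu / t\<^sup>2" using u'_bound[OF t] t by (simp add: abs_mult field_simps)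
    also have "\<dots> \<le> Cu / (w0 / 2 * real (Suc n))\<^sup>2"
      using that w0 Cu0 unfolding t_def by (intro divide_left_mono power_mono mult_right_mono mult_pos_pos zero_less_power) auto
    also have "\<dots> = Mf n" by (simp add: Mf_def power_mult_distrib power_divide)
    finally show ?thesis .
  qed
  have bg: "\<bar>g' n w\<bar> \<le> Mg n" if "w0 / 2 < w" "w < 2 * w0" for n w
  proof -
    have wp: "w > 0" using that w0 by linarith
    define x where "x = w / (\<kappa> * real (Suc n))"
    have x: "x > 0" using pos(2)[OF wp] by (simp add: x_def)
    have k: "\<kappa> * real (Suc n) > 0" using \<kappa> by simp
    have "\<bar>g' n w\<bar> = \<bar>d n\<bar> * \<bar>v' x\<bar> / (\<kappa> * real (Suc n))"
      using k \<kappa> unfolding g'_def x_def by (simp add: abs_mult del: of_nat_Suc)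
    also have "\<dots> \<le> 1 * (Cv * x) / (\<kappa> * real (Suc n))"
      using k by (intro divide_right_mono mult_mono d v'_bound[OF x]) auto
    also have "\<dots> = w * Cv / \<kappa>\<^sup>2 / (real (Suc n))\<^sup>2"
      using k by (simp add: x_def power2_eq_square mult_ac del: of_nat_Suc)
    also have "\<dots> \<le> Mg n" unfolding Mg_def using that Cv0
      by (intro divide_right_mono mult_right_mono) auto
    finally show ?thesis .
  qed
  have sMf: "summable Mf" and sMg: "summable Mg" unfolding Mf_def Mg_def by (rule sq)+
  have Df: "((\<lambda>w. \<Sum>n. f n w) has_real_derivative (\<Sum>n. f' n w0)) (at w0)"
    by (rule has_real_derivative_dominated_series[where a = "w0 / 2" and b = "2 * w0", OF df sf bf sMf]) (use w0 in auto)
  have Dg: "((\<lambda>w. \<Sum>n. g n w) has_real_derivative (\<Sum>n. g' n w0)) (at w0)"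
    by (rule has_real_derivative_dominated_series[where a = "w0 / 2" and b = "2 * w0", OF dg sg bg sMg]) (use w0 in auto)
  have "((\<lambda>w. (\<Sum>n. f n w) + K * (\<Sum>n. g n w)) has_real_derivative (\<Sum>n. f' n w0) + K * (\<Sum>n. g' n w0)) (at w0)"
    by (rule DERIV_add[OF Df DERIV_cmult[OF Dg]])
  moreover have "\<forall>\<^sub>F w in nhds w0. (\<Sum>n. f n w) + K * (\<Sum>n. g n w) = E w"
    using eventually_nhds_in_open[of "{0<..}" w0] w0 by (auto elim!: eventually_mono simp: fg)
  ultimately have "(E has_real_derivative (\<Sum>n. f' n w0) + K * (\<Sum>n. g' n w0)) (at w0)"
    by (subst (asm) DERIV_cong_ev[OF refl _ refl]) auto
  then have eq: "(\<Sum>n. f' n w0) + K * (\<Sum>n. g' n w0) = E' w0"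
    using DERIV_unique[OF E[OF w0]] by simp
  have s1: "summable (\<lambda>n. f' n w0)"
    by (rule summable_comparison_test'[OF sMf]) (use bf w0 in auto)
  have s2: "summable (\<lambda>n. g' n w0)"
    by (rule summable_comparison_test'[OF sMg]) (use bg w0 in auto)
  have e1: "(\<lambda>n. c n * (w0 * real (Suc n) * u' (w0 * real (Suc n))) / real (Suc n)) = (\<lambda>n. w0 * f' n w0)"
    by (simp add: f'_def mult_ac del: of_nat_Suc)
  have e2: "(\<lambda>m. d m * (w0 / (\<kappa> * real (Suc m)) * v' (w0 / (\<kappa> * real (Suc m))))) = (\<lambda>n. w0 * g' n w0)"
    by (simp add: g'_def mult_ac del: of_nat_Suc)
  show "summable (\<lambda>n. c n * (w0 * real (Suc n) * u' (w0 * real (Suc n))) / real (Suc n)) \<and>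
     summable (\<lambda>m. d m * (w0 / (\<kappa> * real (Suc m)) * v' (w0 / (\<kappa> * real (Suc m))))) \<and>
     (\<Sum>n. c n * (w0 * real (Suc n) * u' (w0 * real (Suc n))) / real (Suc n)) +
     K * (\<Sum>m. d m * (w0 / (\<kappa> * real (Suc m)) * v' (w0 / (\<kappa> * real (Suc m))))) = w0 * E' w0"
    unfolding e1 e2 using s1 s2 by (simp add: suminf_mult eq [symmetric] algebra_simps summable_mult)
qed

section \<open>Dyadic and midpoint sums\<close>

text \<open>Every positive integer is a power of 2 times an odd number in exactly one way; the
  subtraction of 1 adapts this to series indexed from 0.\<close>

lemma bij_betw_odd_part:
  "bij_betw (\<lambda>(i, k). 2 ^ k * (2 * i + 1) - 1) (UNIV \<times> UNIV) (UNIV :: nat set)"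
proof -
  have inj: "i = j \<and> k = l" if "2 ^ k * (2 * i + 1) = 2 ^ l * (2 * j + (1::nat))" for i j k l
    using that
  proof (induction k arbitrary: l)
    case 0
    show ?case
    proof (cases l)
      case (Suc m)
      have "odd (2 ^ l * (2 * j + 1))" unfolding 0[symmetric] by simp
      then show ?thesis using Suc by simp
    qed (use 0 in simp)
  next
    case (Suc k)
    show ?case
    proof (cases l)
      case 0
      have "even (2 ^ l * (2 * j + 1))" unfolding Suc.prems[symmetric] by simp
      then show ?thesis using 0 by simp
    next
      case l: (Suc m)
      then have "2 ^ k * (2 * i + 1) = 2 ^ m * (2 * j + 1)" using Suc.prems by simp
      then show ?thesis using Suc.IH l by blast
    qed
  qed
  have surj: "\<exists>i k. n = 2 ^ k * (2 * i + (1::nat))" if "n > 0" for n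
    using that
  proof (induction n rule: less_induct)
    case (less n)
    show ?case
    proof (cases "even n")
      case True
      then obtain m where m: "n = 2 * m" by (elim evenE)
      then obtain i k where "m = 2 ^ k * (2 * i + 1)" using less by (metis less_add_same_cancel1 mult_2 nat_0_less_mult_iff)
      then have "n = 2 ^ Suc k * (2 * i + 1)" using m by simp
      then show ?thesis by blast
    next
      case False
      then obtain i where "n = 2 * i + 1" by (elim oddE)
      then have "n = 2 ^ 0 * (2 * i + 1)" by simp
      then show ?thesis by blast
    qed
  qed
  show ?thesis
  proof (rule bij_betwI')
    fix x y :: "nat \<times> nat"
    obtain i k j l where xy: "x = (i, k)" "y = (j, l)" by (metis surj_pair)
    have "2 ^ k * (2 * i + 1) > (0::nat)" "2 ^ l * (2 * j + 1) > (0::nat)" by simp_all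
    then show "((case x of (i, k) \<Rightarrow> 2 ^ k * (2 * i + 1) - 1) = (case y of (i, k) \<Rightarrow> 2 ^ k * (2 * i + 1) - 1)) = (x = y)"
      unfolding xy prod.case using inj[of k i l j]
      by (metis Suc_diff_1 prod.inject)
  next
    fix n :: nat
    obtain i k where "Suc n = 2 ^ k * (2 * i + 1)" using surj[of "Suc n"] by auto
    then have "n = 2 ^ k * (2 * i + 1) - 1" by simp
    then show "\<exists>x\<in>UNIV \<times> UNIV. n = (case x of (i, k) \<Rightarrow> 2 ^ k * (2 * i + 1) - 1)" by auto
  qed auto
qed

text \<open>A weight invariant under \<open>m \<mapsto> 2 m\<close> only sees the dyadic sums \<open>F i\<close> over the odd
  numbers \<open>2 i + 1\<close>, so negative values of \<open>f\<close> may be compensated inside these.\<close>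

lemma abs_dyadic_weighted_sum_le:
  fixes c f :: "nat \<Rightarrow> real"
  assumes sum: "summable (\<lambda>m. \<bar>f (Suc m)\<bar>)"
    and c: "\<And>m. \<bar>c m\<bar> \<le> 1" "\<And>m. c (2 * m) = c m"
    and low: "\<And>i. - B i \<le> (\<Sum>k. f (2 ^ k * (2 * i + 1)))" and B: "\<And>i. B i \<ge> 0" "summable B"
  shows "\<bar>\<Sum>m. c (Suc m) * f (Suc m)\<bar> \<le> (\<Sum>m. f (Suc m)) + 2 * (\<Sum>i. B i)"
proof -
  define h :: "nat \<times> nat \<Rightarrow> nat" where "h = (\<lambda>(i, k). 2 ^ k * (2 * i + 1) - 1)"
  have bij: "bij_betw h (UNIV \<times> UNIV) UNIV" unfolding h_def by (rule bij_betw_odd_part)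
  have Sh: "Suc (h (i, k)) = 2 ^ k * (2 * i + 1)" for i k by (simp add: h_def)
  have ck: "c (2 ^ k * n) = c n" for k n
    by (induction k) (simp_all add: c mult.assoc)
  define F where "F i = (\<Sum>k. f (2 ^ k * (2 * i + 1)))" for i
  have dec: "summable (\<lambda>k. g (2 ^ k * (2 * i + 1)))" "(\<lambda>i. \<Sum>k. g (2 ^ k * (2 * i + 1))) sums (\<Sum>m. g (Suc m))"
      "summable (\<lambda>i. \<bar>\<Sum>k. g (2 ^ k * (2 * i + 1))\<bar>)"
    if g: "summable (\<lambda>m. \<bar>g (Suc m)\<bar>)" for g :: "nat \<Rightarrow> real" and i
  proof -
    have "((\<lambda>m. g (Suc m)) has_sum (\<Sum>m. g (Suc m))) UNIV"
      using norm_summable_imp_has_sum[OF _ summable_sums[OF summable_rabs_cancel[OF g]]] g by simp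
    then have "((\<lambda>x. g (Suc (h x))) has_sum (\<Sum>m. g (Suc m))) (UNIV \<times> UNIV)"
      using has_sum_reindex_bij_betw[OF bij, of "\<lambda>m. g (Suc m)"] by simp
    then have hs: "((\<lambda>(i, k). g (2 ^ k * (2 * i + 1))) has_sum (\<Sum>m. g (Suc m))) (UNIV \<times> UNIV)"
      by (rule has_sum_cong[THEN iffD1, rotated]) (auto simp: Sh)
    have inner: "(\<lambda>k. g (2 ^ k * (2 * i + 1))) summable_on UNIV" for i
      using summable_on_SigmaD1[OF has_sum_imp_summable[OF hs], of i] by simp
    have inner': "((\<lambda>k. g (2 ^ k * (2 * i + 1))) has_sum (\<Sum>k. g (2 ^ k * (2 * i + 1)))) UNIV" for i
      using has_sum_infsum[OF inner[of i]] sums_unique[OF has_sum_imp_sums[OF has_sum_infsum[OF inner[of i]]]]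
      by simp
    show "summable (\<lambda>k. g (2 ^ k * (2 * i + 1)))"
      by (rule sums_summable[OF has_sum_imp_sums[OF inner'[of i]]])
    have outer: "((\<lambda>i. \<Sum>k. g (2 ^ k * (2 * i + 1))) has_sum (\<Sum>m. g (Suc m))) UNIV"
      using has_sum_SigmaD[OF hs, of "\<lambda>i. \<Sum>k. g (2 ^ k * (2 * i + 1))"] inner' by simp
    then show "(\<lambda>i. \<Sum>k. g (2 ^ k * (2 * i + 1))) sums (\<Sum>m. g (Suc m))" by (rule has_sum_imp_sums)
    have "(\<lambda>i. \<Sum>k. g (2 ^ k * (2 * i + 1))) summable_on UNIV" using outer by (rule has_sum_imp_summable)
    then have "(\<lambda>i. norm (\<Sum>k. g (2 ^ k * (2 * i + 1)))) summable_on UNIV"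
      by (rule summable_on_iff_abs_summable_on_real[THEN iffD1])
    then show "summable (\<lambda>i. \<bar>\<Sum>k. g (2 ^ k * (2 * i + 1))\<bar>)"
      by (subst (asm) summable_on_UNIV_nonneg_real_iff) simp_all
  qed
  have cf: "summable (\<lambda>m. \<bar>c (Suc m) * f (Suc m)\<bar>)"
  proof (rule summable_comparison_test'[OF sum])
    show "norm \<bar>c (Suc m) * f (Suc m)\<bar> \<le> \<bar>f (Suc m)\<bar>" for m
      using c(1)[of "Suc m"] by (simp add: abs_mult mult_left_le_one_le)
  qed
  have 1: "F sums (\<Sum>m. f (Suc m))" and 2: "summable (\<lambda>i. \<bar>F i\<bar>)"
    using dec(2,3)[OF sum] by (auto simp: F_def [abs_def])
  have "(\<lambda>i. \<Sum>k. c (2 ^ k * (2 * i + 1)) * f (2 ^ k * (2 * i + 1))) sums (\<Sum>m. c (Suc m) * f (Suc m))"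
    using dec(2)[OF cf] .
  moreover have "(\<Sum>k. c (2 ^ k * (2 * i + 1)) * f (2 ^ k * (2 * i + 1))) = c (2 * i + 1) * F i" for i
  proof -
    have "summable (\<lambda>k. f (2 ^ k * (2 * i + 1)))" by (rule dec(1)[OF sum])
    then show ?thesis unfolding ck F_def by (rule suminf_mult)
  qed
  ultimately have 3: "(\<lambda>i. c (2 * i + 1) * F i) sums (\<Sum>m. c (Suc m) * f (Suc m))" by simp
  have 4: "summable (\<lambda>i. \<bar>c (2 * i + 1) * F i\<bar>)"
    by (rule summable_comparison_test'[OF 2]) (use c(1) in \<open>simp add: abs_mult mult_left_le_one_le\<close>)
  have "\<bar>\<Sum>m. c (Suc m) * f (Suc m)\<bar> = \<bar>\<Sum>i. c (2 * i + 1) * F i\<bar>" using 3 by (simp add: sums_iff)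
  also have "\<dots> \<le> (\<Sum>i. \<bar>c (2 * i + 1) * F i\<bar>)" by (rule summable_rabs[OF 4])
  also have "\<dots> \<le> (\<Sum>i. F i + 2 * B i)"
  proof (rule suminf_le[OF _ 4])
    show "\<bar>c (2 * i + 1) * F i\<bar> \<le> F i + 2 * B i" for i
    proof -
      have "\<bar>c (2 * i + 1) * F i\<bar> \<le> \<bar>F i\<bar>" using c(1)[of "2 * i + 1"] by (simp add: abs_mult mult_left_le_one_le)
      \<comment> \<open>As \<open>F i \<ge> - B i\<close>, passing to the absolute value adds at
        most \<open>2 * B i\<close>.\<close>
      also have "\<bar>F i\<bar> \<le> F i + 2 * B i" using low[of i] B(1)[of i] unfolding F_def[symmetric] by linarith
      finally show ?thesis .
    qed
    show "summable (\<lambda>i. F i + 2 * B i)" using 1 B(2) by (intro summable_add summable_mult) (auto simp: sums_iff)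
  qed
  also have "\<dots> = (\<Sum>m. f (Suc m)) + 2 * (\<Sum>i. B i)"
    using 1 B(2) by (simp add: suminf_add [symmetric] suminf_mult summable_mult sums_iff)
  finally show ?thesis .
qed

text \<open>The sample points are the midpoints of consecutive cells of length
  \<open>2 * \<delta>\<close>. On a cell, \<open>B\<close> lies above the tent
  \<open>B (x i) - M * abs (y - x i)\<close>, whose integral is
  \<open>2 * \<delta> * B (x i) - M * \<delta>^2\<close>. The loss \<open>M * \<delta>^2\<close> is
  charged only to cells whose midpoint lies in \<open>{l..r}\<close>, and there are at most
  \<open>(r - l) / (2 * \<delta>) + 1\<close> of these.\<close>

lemma odd_midpoint_sum_le:
  fixes B :: "real \<Rightarrow> real"
  assumes nonneg: "\<And>x. B x \<ge> 0" and lip: "\<And>x y. \<bar>B x - B y\<bar> \<le> M * \<bar>x - y\<bar>"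
    and supp: "\<And>x. x < l \<or> r < x \<Longrightarrow> B x = 0" and lr: "0 \<le> l" "l \<le> r" and \<delta>: "\<delta> > 0"
  shows "summable (\<lambda>i. B (real (2 * i + 1) * \<delta>))"
    and "2 * \<delta> * (\<Sum>i. B (real (2 * i + 1) * \<delta>)) \<le> integral {l..r} B + M * \<delta> * (r - l) / 2 + M * \<delta>\<^sup>2"
proof -
  have M0: "M \<ge> 0" using lip[of 0 1] abs_ge_zero[of "B 0 - B 1"] by simp
  have "M-lipschitz_on UNIV B" using lip M0 by (intro lipschitz_onI) (auto simp: dist_real_def)
  then have cont: "continuous_on X B" for X
    using lipschitz_on_continuous_on continuous_on_subset by blast
  have int: "B integrable_on {a..b}" for a b by (intro integrable_continuous_interval cont)
  define n where "n = nat \<lceil>r / (2 * \<delta>)\<rceil>"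
  have n: "r \<le> 2 * real n * \<delta>"
  proof -
    have "r / (2 * \<delta>) \<le> real n" unfolding n_def by (rule real_nat_ceiling_ge)
    then show ?thesis using \<delta> by (simp add: field_simps)
  qed
  define x where "x i = real (2 * i + 1) * \<delta>" for i
  have zero: "B (x i) = 0" if "i \<notin> {..<n}" for i
  proof -
    have "2 * real n * \<delta> \<le> 2 * real i * \<delta>" using that \<delta> by simp
    moreover have "x i = 2 * real i * \<delta> + \<delta>" by (simp add: x_def algebra_simps)
    ultimately have "r < x i" using n \<delta> by linarith
    then show ?thesis using supp by simp
  qed
  show "summable (\<lambda>i. B (real (2 * i + 1) * \<delta>))"
    using summable_finite[of "{..<n}" "\<lambda>i. B (x i)"] zero by (simp add: x_def)
  have tot: "(\<Sum>i. B (real (2 * i + 1) * \<delta>)) = (\<Sum>i<n. B (x i))"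
    using suminf_finite[of "{..<n}" "\<lambda>i. B (x i)"] zero by (simp add: x_def)
  define I where "I = {i \<in> {..<n}. l \<le> x i \<and> x i \<le> r}"
  have cell: "2 * \<delta> * B (x i) \<le> integral {2 * real i * \<delta>..2 * real (Suc i) * \<delta>} B + (if i \<in> I then M * \<delta>\<^sup>2 else 0)"
    if "i < n" for i
  proof (cases "i \<in> I")
    case False
    then have "B (x i) = 0" using that supp by (auto simp: I_def not_le)
    then show ?thesis using False nonneg by (simp add: integral_nonneg int)
  next
    case True
    define a where "a = 2 * real i * \<delta>"
    have xa: "x i = a + \<delta>" and b: "2 * real (Suc i) * \<delta> = a + 2 * \<delta>"
      by (simp_all add: x_def a_def algebra_simps)
    have hi: "((\<lambda>y. B (x i) - M * \<bar>y - x i\<bar>) has_integral (2 * \<delta> * B (x i) - M * \<delta>\<^sup>2)) {a..a + 2 * \<delta>}"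
    proof -
      have 1: "((\<lambda>y. B (x i) - M * \<bar>y - x i\<bar>) has_integral (\<delta> * B (x i) - M * \<delta>\<^sup>2 / 2)) {a..a + \<delta>}"
      proof -
        have "((\<lambda>y. B (x i) - M * (x i - y)) has_integral
           (B (x i) * (a + \<delta>) + M * (x i - (a + \<delta>))\<^sup>2 / 2) - (B (x i) * a + M * (x i - a)\<^sup>2 / 2)) {a..a + \<delta>}"
          using \<delta> by (intro fundamental_theorem_of_calculus)
            (auto intro!: derivative_eq_intros simp: has_real_derivative_iff_has_vector_derivative [symmetric] field_simps)
        then have "((\<lambda>y. B (x i) - M * (x i - y)) has_integral (\<delta> * B (x i) - M * \<delta>\<^sup>2 / 2)) {a..a + \<delta>}"
          by (simp add: xa algebra_simps)
        then show ?thesis by (rule has_integral_eq[rotated]) (auto simp: xa)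
      qed
      have 2: "((\<lambda>y. B (x i) - M * \<bar>y - x i\<bar>) has_integral (\<delta> * B (x i) - M * \<delta>\<^sup>2 / 2)) {a + \<delta>..a + 2 * \<delta>}"
      proof -
        have "((\<lambda>y. B (x i) - M * (y - x i)) has_integral
           (B (x i) * (a + 2 * \<delta>) - M * ((a + 2 * \<delta>) - x i)\<^sup>2 / 2) - (B (x i) * (a + \<delta>) - M * ((a + \<delta>) - x i)\<^sup>2 / 2)) {a + \<delta>..a + 2 * \<delta>}"
          using \<delta> by (intro fundamental_theorem_of_calculus)
            (auto intro!: derivative_eq_intros simp: has_real_derivative_iff_has_vector_derivative [symmetric] field_simps)
        then have "((\<lambda>y. B (x i) - M * (y - x i)) has_integral (\<delta> * B (x i) - M * \<delta>\<^sup>2 / 2)) {a + \<delta>..a + 2 * \<delta>}"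
          by (simp add: xa algebra_simps)
        then show ?thesis by (rule has_integral_eq[rotated]) (auto simp: xa)
      qed
      show ?thesis using has_integral_combine[OF _ _ 1 2] \<delta> by (simp add: algebra_simps)
    qed
    have "2 * \<delta> * B (x i) - M * \<delta>\<^sup>2 \<le> integral {a..a + 2 * \<delta>} B"
    proof (rule has_integral_le[OF hi integrable_integral[OF int]])
      show "B (x i) - M * \<bar>y - x i\<bar> \<le> B y" for y using lip[of "x i" y] by (simp add: abs_minus_commute abs_le_iff)
    qed
    then show ?thesis using True unfolding b a_def [symmetric] by simp
  qed
  have comb: "(\<Sum>i<k. integral {2 * real i * \<delta>..2 * real (Suc i) * \<delta>} B) = integral {0..2 * real k * \<delta>} B" for k
  proof (induction k)
    case (Suc k)
    have "integral {0..2 * real k * \<delta>} B + integral {2 * real k * \<delta>..2 * real (Suc k) * \<delta>} B = integral {0..2 * real (Suc k) * \<delta>} B"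
      by (rule Henstock_Kurzweil_Integration.integral_combine) (use \<delta> int in auto)
    then show ?case using Suc by simp
  qed simp
  have whole: "integral {0..2 * real n * \<delta>} B = integral {l..r} B"
  proof -
    have "integral {0..l} B = integral {0..l} (\<lambda>_. 0)"
      by (rule integral_spike[of "{l}"]) (use supp in auto)
    then have z1: "integral {0..l} B = 0" by simp
    have "integral {r..2 * real n * \<delta>} B = integral {r..2 * real n * \<delta>} (\<lambda>_. 0)"
      by (rule integral_spike[of "{r}"]) (use supp in auto)
    then have z2: "integral {r..2 * real n * \<delta>} B = 0" by simp
    have "integral {0..l} B + integral {l..2 * real n * \<delta>} B = integral {0..2 * real n * \<delta>} B"
      by (rule Henstock_Kurzweil_Integration.integral_combine) (use lr n int in auto)
    moreover have "integral {l..r} B + integral {r..2 * real n * \<delta>} B = integral {l..2 * real n * \<delta>} B"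
      by (rule Henstock_Kurzweil_Integration.integral_combine) (use lr n int in auto)
    ultimately show ?thesis using z1 z2 by simp
  qed
  have card: "real (card I) \<le> (r - l) / (2 * \<delta>) + 1"
  proof (cases "I = {}")
    case True
    then show ?thesis using lr \<delta> by simp
  next
    case False
    have fin: "finite I" by (simp add: I_def)
    define a b where "a = Min I" and "b = Max I"
    have ab: "a \<in> I" "b \<in> I" "I \<subseteq> {a..b}" using False fin by (auto simp: a_def b_def)
    have "x b - x a \<le> r - l" using ab by (auto simp: I_def)
    then have "2 * \<delta> * (real b - real a) \<le> r - l" by (simp add: x_def algebra_simps)
    then have "real b - real a \<le> (r - l) / (2 * \<delta>)" using \<delta> by (simp add: field_simps)
    moreover have "card I \<le> card {a..b}" by (intro card_mono ab) simp
    moreover have "a \<le> b" using ab by auto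
    ultimately show ?thesis by (simp add: of_nat_diff)
  qed
  have "2 * \<delta> * (\<Sum>i<n. B (x i)) = (\<Sum>i<n. 2 * \<delta> * B (x i))" by (simp add: sum_distrib_left)
  also have "\<dots> \<le> (\<Sum>i<n. integral {2 * real i * \<delta>..2 * real (Suc i) * \<delta>} B + (if i \<in> I then M * \<delta>\<^sup>2 else 0))"
    by (intro sum_mono cell) auto
  also have "\<dots> = integral {l..r} B + (\<Sum>i<n. if i \<in> I then M * \<delta>\<^sup>2 else 0)"
    unfolding sum.distrib comb whole ..
  also have "(\<Sum>i<n. if i \<in> I then M * \<delta>\<^sup>2 else 0) = real (card I) * (M * \<delta>\<^sup>2)"
  proof -
    have "{..<n} \<inter> I = I" by (auto simp: I_def)
    then show ?thesis by (simp add: sum.If_cases)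
  qed
  also have "\<dots> \<le> ((r - l) / (2 * \<delta>) + 1) * (M * \<delta>\<^sup>2)" using card M0 by (intro mult_right_mono) auto
  also have "\<dots> = M * \<delta> * (r - l) / 2 + M * \<delta>\<^sup>2" using \<delta> by (simp add: field_simps power2_eq_square)
  finally show "2 * \<delta> * (\<Sum>i. B (real (2 * i + 1) * \<delta>)) \<le> integral {l..r} B + M * \<delta> * (r - l) / 2 + M * \<delta>\<^sup>2"
    unfolding tot by simp
qed

section \<open>Certificates for polynomial inequalities on intervals\<close>

fun horner_list :: "real list \<Rightarrow> real \<Rightarrow> real" where
  "horner_list [] x = 0"
| "horner_list (c # cs) x = c + x * horner_list cs x"

text \<open>If \<open>ds\<close> lists the coefficients of \<open>D\<close>, the result lists those
  of \<open>p + (l + u) * D u\<close> as a polynomial in \<open>u\<close>: one Horner step recentred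
  at \<open>l\<close>.\<close>

fun taylor_add :: "real \<Rightarrow> real \<Rightarrow> real list \<Rightarrow> real list" where
  "taylor_add l p [] = [p]"
| "taylor_add l p (d # ds) = (p + l * d) # taylor_add l d ds"

fun taylor_shift :: "real \<Rightarrow> real list \<Rightarrow> real list" where
  "taylor_shift l [] = []"
| "taylor_shift l (c # cs) = taylor_add l c (taylor_shift l cs)"

fun horner_lower :: "real \<Rightarrow> real list \<Rightarrow> real" where
  "horner_lower w [] = 0"
| "horner_lower w (c # cs) = c + min 0 (w * horner_lower w cs)"

fun nonneg_on_grid :: "real list \<Rightarrow> real list \<Rightarrow> bool" where
  "nonneg_on_grid (a # b # xs) cs \<longleftrightarrow> 0 \<le> horner_lower (b - a) (taylor_shift a cs) \<and> nonneg_on_grid (b # xs) cs"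
| "nonneg_on_grid _ cs \<longleftrightarrow> True"

lemma horner_taylor_add: "horner_list (taylor_add l p ds) u = p + (l + u) * horner_list ds u"
  by (induction ds arbitrary: p) (simp_all add: algebra_simps)

lemma horner_taylor_shift: "horner_list (taylor_shift l cs) u = horner_list cs (l + u)"
  by (induction cs) (simp_all add: horner_taylor_add)

text \<open>Nonnegativity of a polynomial on an interval is certified by expanding it around the left end
  point of each cell of a grid and dropping the helpful signs.\<close>

lemma horner_lower_le: "0 \<le> u \<Longrightarrow> u \<le> w \<Longrightarrow> horner_lower w cs \<le> horner_list cs u"
proof (induction cs)
  case (Cons c cs)
  have "min 0 (w * horner_lower w cs) \<le> u * horner_list cs u"
  proof (cases "horner_lower w cs \<ge> 0")
    case True
    then show ?thesis using Cons by (intro min.coboundedI1) simp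
  next
    case False
    have "w * horner_lower w cs \<le> u * horner_lower w cs" using False Cons by (intro mult_right_mono_neg) auto
    also have "\<dots> \<le> u * horner_list cs u" using Cons by (intro mult_left_mono) auto
    finally show ?thesis by (rule min.coboundedI2)
  qed
  then show ?case by simp
qed simp

lemma nonneg_on_grid_imp:
  assumes "nonneg_on_grid xs cs" "xs \<noteq> []" "hd xs \<le> x" "x \<le> last xs" "length xs \<ge> 2"
  shows "0 \<le> horner_list cs x"
  using assms
proof (induction xs cs rule: nonneg_on_grid.induct)
  case (1 a b xs cs)
  show ?case
  proof (cases "x \<le> b")
    case True
    then have "horner_lower (b - a) (taylor_shift a cs) \<le> horner_list (taylor_shift a cs) (x - a)"
      using 1 by (intro horner_lower_le) auto
    then show ?thesis using 1 by (simp add: horner_taylor_shift)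
  next
    case False
    then have "xs \<noteq> []" using 1 by auto
    then show ?thesis using 1 False by (intro "1.IH") (auto simp: Suc_le_eq)
  qed
qed auto

section \<open>The dual weight\<close>

text \<open>The variable stands for \<open>X = x^2 / (1 + x^2)\<close>, in which
  \<open>ln (1 + x^2) = - ln (1 - X)\<close>; with \<open>s = 1 / x\<close> it is
  \<open>1 / (1 + s^2)\<close>. The polynomial is what the dual logarithm loses when
  \<open>exp (- t)\<close> is replaced by \<open>smooth_fun\<close>.\<close>

definition tail_poly :: "real \<Rightarrow> real" where
  "tail_poly X = 0.9994 * X + 0.4692 * X ^ 2 + 0.9912 * X ^ 3 - 4.8192 * X ^ 4 + 17.30304 * X ^ 5
     - 25.8048 * X ^ 6 + 14.7456 * X ^ 7"

text \<open>This is \<open>1 - (1 - X) * P X\<close> with \<open>P\<close> the derivative of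
  \<open>tail_poly\<close>, so \<open>tail_fun\<close> has derivative
  \<open>tail_slope X / (1 - X)\<close>. Sign and size of that derivative thereby become questions
  about a polynomial with rational coefficients.\<close>

definition tail_slope :: "real \<Rightarrow> real" where
  "tail_slope X = horner_list [3 / 5000, 61 / 1000, - (1272 / 625), 27813 / 1250, - (13224 / 125), 30168 / 125, - (32256 / 125), 64512 / 625] X"

definition tail_fun :: "real \<Rightarrow> real" where
  "tail_fun X = - ln (1 - X) - tail_poly X"

text \<open>This lemma and the next ten follow one scheme: the bound is absorbed into the constant
  coefficient, with all signs reversed for an upper bound, and the grid cuts the interval into cells
  on which the sign test succeeds.\<close>

lemma tail_slope_1:
  assumes "47 / 50 \<le> X" "X \<le> 1"
  shows "3 / 20 \<le> tail_slope X"
proof -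
  have "nonneg_on_grid [47 / 50, 1] [- (747 / 5000), 61 / 1000, - (1272 / 625), 27813 / 1250, - (13224 / 125), 30168 / 125, - (32256 / 125), 64512 / 625]"
    by simp
  then have "0 \<le> horner_list [- (747 / 5000), 61 / 1000, - (1272 / 625), 27813 / 1250, - (13224 / 125), 30168 / 125, - (32256 / 125), 64512 / 625] X"
    by (rule nonneg_on_grid_imp) (use assms in simp_all)
  then show ?thesis by (simp add: tail_slope_def algebra_simps)
qed

lemma tail_slope_2:
  assumes "47 / 50 \<le> X" "X \<le> 481 / 500"
  shows "tail_slope X \<le> 2 / 5"
proof -
  have "nonneg_on_grid [47 / 50, 481 / 500] [1997 / 5000, - (61 / 1000), 1272 / 625, - (27813 / 1250), 13224 / 125, - (30168 / 125), 32256 / 125, - (64512 / 625)]"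
    by simp
  then have "0 \<le> horner_list [1997 / 5000, - (61 / 1000), 1272 / 625, - (27813 / 1250), 13224 / 125, - (30168 / 125), 32256 / 125, - (64512 / 625)] X"
    by (rule nonneg_on_grid_imp) (use assms in simp_all)
  then show ?thesis by (simp add: tail_slope_def algebra_simps)
qed

lemma tail_slope_3:
  assumes "2 / 5 \<le> X" "X \<le> 1883 / 2000"
  shows "- (13 / 100) \<le> tail_slope X"
proof -
  have "nonneg_on_grid [2 / 5, 33 / 50, 159 / 200, 163 / 200, 33 / 40, 167 / 200, 171 / 200, 1883 / 2000] [653 / 5000, 61 / 1000, - (1272 / 625), 27813 / 1250, - (13224 / 125), 30168 / 125, - (32256 / 125), 64512 / 625]"
    by simp
  then have "0 \<le> horner_list [653 / 5000, 61 / 1000, - (1272 / 625), 27813 / 1250, - (13224 / 125), 30168 / 125, - (32256 / 125), 64512 / 625] X"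
    by (rule nonneg_on_grid_imp) (use assms in simp_all)
  then show ?thesis by (simp add: tail_slope_def algebra_simps)
qed

lemma tail_slope_4:
  assumes "2 / 5 \<le> X" "X \<le> 471 / 500"
  shows "tail_slope X \<le> 11 / 50"
proof -
  have "nonneg_on_grid [2 / 5, 31 / 40, 471 / 500] [1097 / 5000, - (61 / 1000), 1272 / 625, - (27813 / 1250), 13224 / 125, - (30168 / 125), 32256 / 125, - (64512 / 625)]"
    by simp
  then have "0 \<le> horner_list [1097 / 5000, - (61 / 1000), 1272 / 625, - (27813 / 1250), 13224 / 125, - (30168 / 125), 32256 / 125, - (64512 / 625)] X"
    by (rule nonneg_on_grid_imp) (use assms in simp_all)
  then show ?thesis by (simp add: tail_slope_def algebra_simps)
qed

lemma tail_slope_5: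
  assumes "147 / 200 \<le> X" "X \<le> 451 / 500"
  shows "tail_slope X \<le> - (1 / 40)"
proof -
  have "nonneg_on_grid [147 / 200, 451 / 500] [- (16 / 625), - (61 / 1000), 1272 / 625, - (27813 / 1250), 13224 / 125, - (30168 / 125), 32256 / 125, - (64512 / 625)]"
    by simp
  then have "0 \<le> horner_list [- (16 / 625), - (61 / 1000), 1272 / 625, - (27813 / 1250), 13224 / 125, - (30168 / 125), 32256 / 125, - (64512 / 625)] X"
    by (rule nonneg_on_grid_imp) (use assms in simp_all)
  then show ?thesis by (simp add: tail_slope_def algebra_simps)
qed

lemma tail_slope_6:
  assumes "2 / 5 \<le> X" "X \<le> 147 / 200"
  shows "tail_slope X \<le> 1 / 50"
proof -
  have "nonneg_on_grid [2 / 5, 51 / 100, 29 / 50, 13 / 20, 147 / 200] [97 / 5000, - (61 / 1000), 1272 / 625, - (27813 / 1250), 13224 / 125, - (30168 / 125), 32256 / 125, - (64512 / 625)]"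
    by simp
  then have "0 \<le> horner_list [97 / 5000, - (61 / 1000), 1272 / 625, - (27813 / 1250), 13224 / 125, - (30168 / 125), 32256 / 125, - (64512 / 625)] X"
    by (rule nonneg_on_grid_imp) (use assms in simp_all)
  then show ?thesis by (simp add: tail_slope_def algebra_simps)
qed

lemma tail_slope_7:
  assumes "9 / 10 \<le> X" "X \<le> 459 / 500"
  shows "tail_slope X \<le> 1 / 25"
proof -
  have "nonneg_on_grid [9 / 10, 459 / 500] [197 / 5000, - (61 / 1000), 1272 / 625, - (27813 / 1250), 13224 / 125, - (30168 / 125), 32256 / 125, - (64512 / 625)]"
    by simp
  then have "0 \<le> horner_list [197 / 5000, - (61 / 1000), 1272 / 625, - (27813 / 1250), 13224 / 125, - (30168 / 125), 32256 / 125, - (64512 / 625)] X"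
    by (rule nonneg_on_grid_imp) (use assms in simp_all)
  then show ?thesis by (simp add: tail_slope_def algebra_simps)
qed

lemma tail_slope_8:
  assumes "9 / 10 \<le> X" "X \<le> 459 / 500"
  shows "- (1 / 25) \<le> tail_slope X"
proof -
  have "nonneg_on_grid [9 / 10, 459 / 500] [203 / 5000, 61 / 1000, - (1272 / 625), 27813 / 1250, - (13224 / 125), 30168 / 125, - (32256 / 125), 64512 / 625]"
    by simp
  then have "0 \<le> horner_list [203 / 5000, 61 / 1000, - (1272 / 625), 27813 / 1250, - (13224 / 125), 30168 / 125, - (32256 / 125), 64512 / 625] X"
    by (rule nonneg_on_grid_imp) (use assms in simp_all)
  then show ?thesis by (simp add: tail_slope_def algebra_simps)
qed

lemma tail_slope_9:
  assumes "917 / 1000 \<le> X" "X \<le> 471 / 500"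
  shows "0 \<le> tail_slope X"
proof -
  have "nonneg_on_grid [917 / 1000, 471 / 500] [3 / 5000, 61 / 1000, - (1272 / 625), 27813 / 1250, - (13224 / 125), 30168 / 125, - (32256 / 125), 64512 / 625]"
    by simp
  then have "0 \<le> horner_list [3 / 5000, 61 / 1000, - (1272 / 625), 27813 / 1250, - (13224 / 125), 30168 / 125, - (32256 / 125), 64512 / 625] X"
    by (rule nonneg_on_grid_imp) (use assms in simp_all)
  then show ?thesis by (simp add: tail_slope_def algebra_simps)
qed

lemma tail_slope_10:
  assumes "69 / 100 \<le> X" "X \<le> 37 / 50"
  shows "tail_slope X \<le> 0"
proof -
  have "nonneg_on_grid [69 / 100, 37 / 50] [- (3 / 5000), - (61 / 1000), 1272 / 625, - (27813 / 1250), 13224 / 125, - (30168 / 125), 32256 / 125, - (64512 / 625)]"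
    by simp
  then have "0 \<le> horner_list [- (3 / 5000), - (61 / 1000), 1272 / 625, - (27813 / 1250), 13224 / 125, - (30168 / 125), 32256 / 125, - (64512 / 625)] X"
    by (rule nonneg_on_grid_imp) (use assms in simp_all)
  then show ?thesis by (simp add: tail_slope_def algebra_simps)
qed

lemma tail_slope_11:
  assumes "33 / 50 \<le> X" "X \<le> 7 / 10"
  shows "- (3 / 100) \<le> tail_slope X"
proof -
  have "nonneg_on_grid [33 / 50, 7 / 10] [153 / 5000, 61 / 1000, - (1272 / 625), 27813 / 1250, - (13224 / 125), 30168 / 125, - (32256 / 125), 64512 / 625]"
    by simp
  then have "0 \<le> horner_list [153 / 5000, 61 / 1000, - (1272 / 625), 27813 / 1250, - (13224 / 125), 30168 / 125, - (32256 / 125), 64512 / 625] X"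
    by (rule nonneg_on_grid_imp) (use assms in simp_all)
  then show ?thesis by (simp add: tail_slope_def algebra_simps)
qed

text \<open>The list holds the coefficients of
  \<open>(X + X^2 / 2 + ... + X^12 / 12 - tail_poly X) / X\<close>. Since the truncated series lies
  below \<open>- ln (1 - X)\<close>, this gives the sign of \<open>tail_fun\<close> for
  \<open>X\<close> up to \<open>33 / 50\<close>.\<close>

lemma tail_poly_nonneg:
  assumes "0 \<le> X" "X \<le> 33 / 50"
  shows "0 \<le> horner_list [3 / 5000, 77 / 2500, - (2467 / 3750), 12673 / 2500, - (53447 / 3125), 97393 / 3750, - (63887 / 4375), 1 / 8, 1 / 9, 1 / 10, 1 / 11, 1 / 12] X"
proof -
  have "nonneg_on_grid [0, 53 / 1000, 123 / 1000, 251 / 1000, 349 / 1000, 211 / 500, 147 / 250, 33 / 50] [3 / 5000, 77 / 2500, - (2467 / 3750), 12673 / 2500, - (53447 / 3125), 97393 / 3750, - (63887 / 4375), 1 / 8, 1 / 9, 1 / 10, 1 / 11, 1 / 12]"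
    by simp
  then show ?thesis by (rule nonneg_on_grid_imp) (use assms in simp_all)
qed

lemma tail_fun_deriv:
  assumes "X < 1"
  shows "(tail_fun has_real_derivative tail_slope X / (1 - X)) (at X)"
proof -
  have "(tail_poly has_real_derivative (0.9994 + 2 * 0.4692 * X + 3 * 0.9912 * X ^ 2 - 4 * 4.8192 * X ^ 3
      + 5 * 17.30304 * X ^ 4 - 6 * 25.8048 * X ^ 5 + 7 * 14.7456 * X ^ 6)) (at X)"
    unfolding tail_poly_def [abs_def] by (auto intro!: derivative_eq_intros)
  moreover have "((\<lambda>X. - ln (1 - X)) has_real_derivative 1 / (1 - X)) (at X)"
    using assms by (auto intro!: derivative_eq_intros simp: divide_simps)
  ultimately have "(tail_fun has_real_derivative (1 / (1 - X) - (0.9994 + 2 * 0.4692 * X + 3 * 0.9912 * X ^ 2 - 4 * 4.8192 * X ^ 3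
      + 5 * 17.30304 * X ^ 4 - 6 * 25.8048 * X ^ 5 + 7 * 14.7456 * X ^ 6))) (at X)"
    unfolding tail_fun_def [abs_def] by (intro DERIV_diff)
  also have "1 / (1 - X) - (0.9994 + 2 * 0.4692 * X + 3 * 0.9912 * X ^ 2 - 4 * 4.8192 * X ^ 3
      + 5 * 17.30304 * X ^ 4 - 6 * 25.8048 * X ^ 5 + 7 * 14.7456 * X ^ 6) =
      (1 - (1 - X) * (0.9994 + 2 * 0.4692 * X + 3 * 0.9912 * X ^ 2 - 4 * 4.8192 * X ^ 3
      + 5 * 17.30304 * X ^ 4 - 6 * 25.8048 * X ^ 5 + 7 * 14.7456 * X ^ 6)) / (1 - X)"
  proof -
    have gen: "1 / d - P = (1 - d * P) / d" if "d \<noteq> 0" for d P :: real using that by (simp add: field_simps)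
    show ?thesis by (rule gen) (use assms in simp)
  qed
  also have "1 - (1 - X) * (0.9994 + 2 * 0.4692 * X + 3 * 0.9912 * X ^ 2 - 4 * 4.8192 * X ^ 3
      + 5 * 17.30304 * X ^ 4 - 6 * 25.8048 * X ^ 5 + 7 * 14.7456 * X ^ 6) = tail_slope X"
    unfolding tail_slope_def by (simp add: field_simps eval_nat_numeral)
  finally show ?thesis .
qed

text \<open>The weight \<open>v\<close> of the final pair read at \<open>x = 1 / s\<close>. In this
  variable the terms of the dual series sit at the equally spaced points
  \<open>s = m * \<delta>\<close>, and doubling \<open>m\<close> doubles \<open>s\<close>.\<close>

definition dual_fun :: "real \<Rightarrow> real" where
  "dual_fun s = tail_fun (1 / (1 + s\<^sup>2))"

lemma dual_fun_deriv:
  assumes "s > 0"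
  shows "(dual_fun has_real_derivative - (2 / s) * (1 / (1 + s\<^sup>2) * tail_slope (1 / (1 + s\<^sup>2)))) (at s)"
proof -
  define X where "X = 1 / (1 + s\<^sup>2)"
  have p: "1 + s\<^sup>2 > 1" using assms by simp
  have frac: "1 / u < 1 \<and> 1 - 1 / u = (u - 1) / u" if "u > 1" for u :: real using that by (simp add: field_simps)
  have X: "X < 1" "1 - X = s\<^sup>2 / (1 + s\<^sup>2)" using frac[OF p] unfolding X_def by simp_all
  have "((\<lambda>s. 1 / (1 + s\<^sup>2)) has_real_derivative - (2 * s) / (1 + s\<^sup>2)\<^sup>2) (at s)"
    using p by (auto intro!: derivative_eq_intros simp: power2_eq_square)
  from DERIV_chain2[OF tail_fun_deriv[OF X(1), unfolded X_def] this]
  have "(dual_fun has_real_derivative tail_slope X / (1 - X) * (- (2 * s) / (1 + s\<^sup>2)\<^sup>2)) (at s)"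
    by (simp add: dual_fun_def [abs_def] X_def)
  also have "tail_slope X / (1 - X) * (- (2 * s) / (1 + s\<^sup>2)\<^sup>2) = - (2 / s) * (X * tail_slope X)"
  proof -
    define p where "p = 1 + s\<^sup>2"
    have "p > 0" unfolding p_def by (rule add_pos_nonneg) simp_all
    moreover have "s\<^sup>2 > 0" using assms by simp
    ultimately show ?thesis unfolding X(2) unfolding X_def p_def [symmetric] using assms
      by (simp add: field_simps power2_eq_square)
  qed
  finally show ?thesis by (simp add: X_def)
qed

lemma dual_fun_eq: "s > 0 \<Longrightarrow> dual_fun s = ln (1 + 1 / s\<^sup>2) - tail_poly (1 / (1 + s\<^sup>2))"
proof -
  assume s: "s > 0"
  have "1 - 1 / (1 + u) = inverse (1 + 1 / u)" if "u > 0" for u :: real using that by (simp add: field_simps)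
  then have "1 - 1 / (1 + s\<^sup>2) = inverse (1 + 1 / s\<^sup>2)" using s by simp
  moreover have "1 + 1 / s\<^sup>2 > 0" using s by (simp add: add_pos_pos)
  ultimately show ?thesis by (simp add: dual_fun_def tail_fun_def ln_inverse)
qed

lemma ln_one_minus_lower:
  assumes "0 \<le> X" "X < 1"
  shows "(\<Sum>k<n. X ^ Suc k / real (Suc k)) \<le> - ln (1 - X)"
proof -
  define D where "D x = - ln (1 - x) - (\<Sum>k<n. x ^ Suc k / real (Suc k))" for x
  have "D 0 \<le> D X"
  proof (rule DERIV_nonneg_imp_nondecreasing[OF assms(1)])
    fix x assume x: "0 \<le> x" "x \<le> X"
    have "(D has_real_derivative (1 / (1 - x) - (\<Sum>k<n. x ^ k))) (at x)"
      unfolding D_def [abs_def] using x assms(2)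
      by (auto intro!: derivative_eq_intros sum.cong simp: divide_simps simp del: of_nat_Suc power_Suc)
    moreover have "(\<Sum>k<n. x ^ k) = (1 - x ^ n) / (1 - x)"
      using x assms(2) by (subst sum_gp_strict) auto
    moreover have "1 / (1 - x) - (1 - x ^ n) / (1 - x) = x ^ n / (1 - x)"
      by (simp add: diff_divide_distrib)
    moreover have "0 \<le> x ^ n / (1 - x)" using x assms(2) by simp
    ultimately show "\<exists>y. (D has_real_derivative y) (at x) \<and> 0 \<le> y" by auto
  qed
  then show ?thesis by (simp add: D_def)
qed

section \<open>Decimal bounds for logarithms\<close>

lemma ln2_lower: "6931471 / 10000000 \<le> ln (2::real)" and ln2_upper: "ln (2::real) \<le> 6931472 / 10000000"
proof -
  have "ln (2::real) \<in> {(\<Sum>k<8. 2 * ((2 - 1) / (2 + 1)) ^ (2 * k + 1) / real (2 * k + 1))..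
      (\<Sum>k<8. 2 * ((2 - 1) / (2 + 1)) ^ (2 * k + 1) / real (2 * k + 1)) +
      2 * (((2 - 1) / (2 + 1)) ^ (2 * 8 + 1) / (1 - ((2 - 1) / (2 + 1)) ^ 2) / real (2 * 8 + 1))}"
    by (rule ln_approx_bounds) simp
  then show "6931471 / 10000000 \<le> ln (2::real)" "ln (2::real) \<le> 6931472 / 10000000"
    by (simp_all add: eval_nat_numeral)
qed

lemma ln_two_power_mult: "y > 0 \<Longrightarrow> ln (2 ^ k * y) = real k * ln 2 + ln y"
  and ln_two_power_divide: "y > 0 \<Longrightarrow> ln (2 ^ k / y) = real k * ln 2 - ln (y :: real)"
  by (simp_all add: ln_mult_pos ln_div ln_realpow)


text \<open>The first ten arguments of this block are \<open>1 + 1 / s^2\<close> for \<open>s = 1/5,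
  2/5, 3/5, 6/5, 3/20, 19/100, 1/4, 3/10, 33/100, 33/50\<close>, the points at which
  \<open>dual_fun\<close> or its antiderivative is evaluated. The last two serve the final estimate;
  \<open>18849 / 1000\<close> is just below \<open>6 * pi\<close>. A power of 2 brings each argument
  near 1, where one or two terms of the series suffice.\<close>

lemma ln_26: "6516163 / 2000000 \<le> ln (26 :: real)" "ln (26 :: real) \<le> 8145279 / 2500000"
  using ln_two_power_divide[of "16 / 13" 5] ln_approx_bounds[of "16 / 13" 2] ln2_lower ln2_upper
  by (simp_all add: eval_nat_numeral)

lemma ln_29_4: "2476233 / 1250000 \<le> ln (29 / 4 :: real)" "ln (29 / 4 :: real) \<le> 3962033 / 2000000"
  using ln_two_power_divide[of "32 / 29" 3] ln_approx_bounds[of "32 / 29" 2] ln2_lower ln2_upper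
  by (simp_all add: eval_nat_numeral)

lemma ln_34_9: "13291209 / 10000000 \<le> ln (34 / 9 :: real)" "ln (34 / 9 :: real) \<le> 1329151 / 1000000"
  using ln_two_power_divide[of "18 / 17" 2] ln_approx_bounds[of "18 / 17" 2] ln2_lower ln2_upper
  by (simp_all add: eval_nat_numeral)

lemma ln_61_36: "5273399 / 10000000 \<le> ln (61 / 36 :: real)" "ln (61 / 36 :: real) \<le> 52737 / 100000"
  using ln_two_power_divide[of "72 / 61" 1] ln_approx_bounds[of "72 / 61" 2] ln2_lower ln2_upper
  by (simp_all add: eval_nat_numeral)

lemma ln_409_9: "7632681 / 2000000 \<le> ln (409 / 9 :: real)" "ln (409 / 9 :: real) \<le> 19083203 / 5000000"
  using ln_two_power_mult[of "409 / 288" 5] ln_approx_bounds[of "409 / 288" 2] ln2_lower ln2_upper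
  by (simp_all add: eval_nat_numeral)

lemma ln_10361_361: "419597 / 125000 \<le> ln (10361 / 361 :: real)" "ln (10361 / 361 :: real) \<le> 33570761 / 10000000"
  using ln_two_power_divide[of "11552 / 10361" 5] ln_approx_bounds[of "11552 / 10361" 2] ln2_lower ln2_upper
  by (simp_all add: eval_nat_numeral)

lemma ln_17: "28330633 / 10000000 \<le> ln (17 :: real)" "ln (17 :: real) \<le> 14166817 / 5000000"
  using ln_two_power_mult[of "17 / 16" 4] ln_approx_bounds[of "17 / 16" 1] ln2_lower ln2_upper
  by (simp_all add: eval_nat_numeral)

lemma ln_109_9: "24939733 / 10000000 \<le> ln (109 / 9 :: real)" "ln (109 / 9 :: real) \<le> 12471367 / 5000000"
  using ln_two_power_divide[of "144 / 109" 4] ln_approx_bounds[of "144 / 109" 2] ln2_lower ln2_upper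
  by (simp_all add: eval_nat_numeral)

lemma ln_11089_1089: "23205437 / 10000000 \<le> ln (11089 / 1089 :: real)" "ln (11089 / 1089 :: real) \<le> 11604219 / 5000000"
  using ln_two_power_mult[of "11089 / 8712" 3] ln_approx_bounds[of "11089 / 8712" 2] ln2_lower ln2_upper
  by (simp_all add: eval_nat_numeral)

lemma ln_3589_1089: "11924637 / 10000000 \<le> ln (3589 / 1089 :: real)" "ln (3589 / 1089 :: real) \<le> 5963819 / 5000000"
  using ln_two_power_divide[of "4356 / 3589" 2] ln_approx_bounds[of "4356 / 3589" 2] ln2_lower ln2_upper
  by (simp_all add: eval_nat_numeral)

lemma ln_6pi: "14681549 / 5000000 \<le> ln (18849 / 1000 :: real)" "ln (18849 / 1000 :: real) \<le> 29366099 / 10000000"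
  using ln_two_power_mult[of "18849 / 16000" 4] ln_approx_bounds[of "18849 / 16000" 2] ln2_lower ln2_upper
  by (simp_all add: eval_nat_numeral)

lemma ln_11: "5994363 / 2500000 \<le> ln (11 :: real)" "ln (11 :: real) \<le> 23980453 / 10000000"
  using ln_two_power_mult[of "11 / 8" 3] ln_approx_bounds[of "11 / 8" 2] ln2_lower ln2_upper
  by (simp_all add: eval_nat_numeral)

section \<open>Shape of \<open>tail_fun\<close> on the unit interval\<close>

lemma tail_fun_mono_near_1:
  assumes "917 / 1000 \<le> X" "X \<le> Y" "Y < 1"
  shows "tail_fun X \<le> tail_fun Y"
proof (rule DERIV_nonneg_imp_nondecreasing[OF assms(2)])
  fix x assume x: "X \<le> x" "x \<le> Y"
  have "0 \<le> tail_slope x"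
  proof (cases "x \<le> 471 / 500")
    case True
    then show ?thesis using tail_slope_9[of x] x assms by simp
  next
    case False
    then show ?thesis using tail_slope_1[of x] x assms by simp
  qed
  then show "\<exists>y. (tail_fun has_real_derivative y) (at x) \<and> 0 \<le> y"
    using tail_fun_deriv[of x] x assms by (intro exI[of _ "tail_slope x / (1 - x)"] conjI) auto
qed

lemma tail_fun_antimono_middle:
  assumes "69 / 100 \<le> X" "X \<le> Y" "Y \<le> 451 / 500"
  shows "tail_fun Y \<le> tail_fun X"
proof (rule DERIV_nonpos_imp_nonincreasing[OF assms(2)])
  fix x assume x: "X \<le> x" "x \<le> Y"
  have "tail_slope x \<le> 0"
  proof (cases "x \<le> 37 / 50")
    case True
    then show ?thesis using tail_slope_10[of x] x assms by simp
  next
    case False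
    then show ?thesis using tail_slope_5[of x] x assms by simp
  qed
  then show "\<exists>y. (tail_fun has_real_derivative y) (at x) \<and> y \<le> 0"
    using tail_fun_deriv[of x] x assms by (intro exI[of _ "tail_slope x / (1 - x)"] conjI) (auto intro: divide_nonpos_nonneg)
qed

lemma tail_fun_variation:
  assumes "X \<le> Y" "Y < 1" "\<And>x. X \<le> x \<Longrightarrow> x \<le> Y \<Longrightarrow> \<bar>tail_slope x\<bar> \<le> e" "e / (1 - Y) \<le> c"
  shows "tail_fun Y \<le> tail_fun X + c * (Y - X)" "tail_fun X - c * (Y - X) \<le> tail_fun Y"
proof -
  have "norm (tail_fun Y - tail_fun X) \<le> c * norm (Y - X)"
  proof (rule field_differentiable_bound[where S = "{X..Y}" and f' = "\<lambda>x. tail_slope x / (1 - x)"])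
    fix x assume x: "x \<in> {X..Y}"
    show "(tail_fun has_field_derivative tail_slope x / (1 - x)) (at x within {X..Y})"
      by (rule has_field_derivative_at_within[OF tail_fun_deriv]) (use x assms in auto)
    have "\<bar>tail_slope x\<bar> / (1 - x) \<le> e / (1 - Y)"
      using assms(2) assms(3)[of x] x by (intro frac_le) auto
    then show "norm (tail_slope x / (1 - x)) \<le> c" using assms x by (simp add: abs_divide)
  qed (use assms in auto)
  then show "tail_fun Y \<le> tail_fun X + c * (Y - X)" "tail_fun X - c * (Y - X) \<le> tail_fun Y"
    using assms by (simp_all add: abs_le_iff)
qed

lemma tail_fun_lower:
  assumes "0 \<le> X" "X \<le> 33 / 50"
  shows "X * horner_list [3 / 5000, 77 / 2500, - (2467 / 3750), 12673 / 2500, - (53447 / 3125), 97393 / 3750,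
    - (63887 / 4375), 1 / 8, 1 / 9, 1 / 10, 1 / 11, 1 / 12] X \<le> tail_fun X"
  using ln_one_minus_lower[of X 12] assms unfolding tail_fun_def tail_poly_def
  by (simp add: eval_nat_numeral field_simps)

lemma dual_fun_values:
  "21 / 100 \<le> dual_fun (3 / 20)" "105 / 1000 \<le> dual_fun (19 / 100)"
  "0 \<le> dual_fun (1 / 5) + dual_fun (2 / 5)" "dual_fun (1 / 5) + dual_fun (2 / 5) \<le> 15 / 10000"
  "dual_fun (1 / 4) \<le> - (5 / 100)" "- (96 / 1000) \<le> dual_fun (3 / 10)" "dual_fun (3 / 10) \<le> - (9 / 100)"
  "- (96 / 1000) \<le> dual_fun (33 / 100)" "0 \<le> dual_fun (3 / 5)"
  "dual_fun (3 / 5) + dual_fun (6 / 5) \<le> 15 / 10000" "dual_fun (33 / 50) \<le> 1 / 100"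
  using ln_409_9 ln_10361_361 ln_26 ln_29_4 ln_17 ln_109_9 ln_11089_1089 ln_34_9 ln_61_36 ln_3589_1089
  by (simp_all add: dual_fun_eq tail_poly_def eval_nat_numeral)

text \<open>Small \<open>X\<close> are covered by the truncated series. From \<open>7 / 10\<close>
  on, the function decreases to its value at \<open>25 / 34\<close>, which is
  \<open>dual_fun (3 / 5)\<close>. The gap is bridged from its left end, where the value is at least
  \<open>49 / 10000\<close>: the derivative is at most \<open>1 / 10\<close> in size, so at most
  \<open>4 / 1000\<close> is lost.\<close>

lemma tail_fun_nonneg:
  assumes "0 \<le> X" "X \<le> 25 / 34"
  shows "0 \<le> tail_fun X"
proof -
  consider "X \<le> 33 / 50" | "33 / 50 \<le> X" "X \<le> 7 / 10" | "7 / 10 \<le> X" by linarith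
  then show ?thesis
  proof cases
    case 1
    then show ?thesis using tail_fun_lower[of X] tail_poly_nonneg[of X] assms
      by (meson mult_nonneg_nonneg order_trans)
  next
    case 2
    define a where "a = tail_fun (33 / 50)"
    have "49 / 10000 \<le> a" using tail_fun_lower[of "33 / 50"] by (simp add: a_def)
    moreover have "a - 1 / 10 * (X - 33 / 50) \<le> tail_fun X"
      unfolding a_def
    proof (rule tail_fun_variation(2)[where e = "3 / 100"])
      show "\<bar>tail_slope x\<bar> \<le> 3 / 100" if "33 / 50 \<le> x" "x \<le> X" for x
        using tail_slope_11[of x] tail_slope_6[of x] that 2 by simp
    qed (use 2 in \<open>auto simp: field_simps\<close>)
    ultimately show ?thesis using 2 unfolding right_diff_distrib by linarith
  next
    case 3
    have "dual_fun (3 / 5) = tail_fun (25 / 34)" by (simp add: dual_fun_def power2_eq_square)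
    then show ?thesis using tail_fun_antimono_middle[of X "25 / 34"] dual_fun_values(9) 3 assms by simp
  qed
qed

text \<open>\<open>tail_fun\<close> decreases from \<open>69 / 100\<close> to
  \<open>451 / 500\<close> and increases from \<open>917 / 1000\<close> on, so its minimum in this
  range lies in between, where only the size of the derivative is controlled. The constant
  \<open>1 / 2\<close> covers \<open>0.04 / (1 - 100 / 109) < 0.485\<close>.\<close>

lemma tail_fun_middle:
  assumes "9 / 10 \<le> X" "X \<le> 100 / 109" 
  shows "tail_fun X \<le> tail_fun (100 / 109) + 1 / 2 * (100 / 109 - X)"
    "tail_fun (100 / 109) - 1 / 2 * (100 / 109 - X) \<le> tail_fun X"
proof -
  have sl: "\<bar>tail_slope x\<bar> \<le> 4 / 100" if "X \<le> x" "x \<le> 100 / 109" for x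
    using tail_slope_7[of x] tail_slope_8[of x] that assms by simp
  show "tail_fun X \<le> tail_fun (100 / 109) + 1 / 2 * (100 / 109 - X)"
    "tail_fun (100 / 109) - 1 / 2 * (100 / 109 - X) \<le> tail_fun X"
    using tail_fun_variation[OF assms(2) _ sl, of "1 / 2"] by simp_all
qed

lemma dual_fun_3_10: "dual_fun (3 / 10) = tail_fun (100 / 109)"
  and dual_fun_33_100: "dual_fun (33 / 100) = tail_fun (10000 / 11089)"
  and dual_fun_1_4: "dual_fun (1 / 4) = tail_fun (16 / 17)"
  by (simp_all add: dual_fun_def power2_eq_square)

text \<open>The sample value \<open>- 96 / 1000\<close> at \<open>100 / 109\<close>, lowered by half
  the length (below 0.016) of the middle interval and rounded. The result matches
  \<open>dual_fun (19 / 100) \<ge> 105 / 1000\<close> and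
  \<open>dual_fun (3 / 20) \<ge> 210 / 1000\<close>: these let one or two negative terms of a dyadic
  sum be absorbed.\<close>

lemma tail_fun_ge:
  assumes "0 \<le> X" "X < 1"
  shows "- (105 / 1000) \<le> tail_fun X"
proof -
  consider "X \<le> 25 / 34" | "25 / 34 \<le> X" "X \<le> 10000 / 11089" | "10000 / 11089 \<le> X" "X \<le> 100 / 109" | "100 / 109 \<le> X"
    by linarith
  then show ?thesis
  proof cases
    case 1
    then show ?thesis using tail_fun_nonneg[of X] assms by simp
  next
    case 2
    then show ?thesis using tail_fun_antimono_middle[of X "10000 / 11089"] dual_fun_values(8) dual_fun_33_100 by simp
  next
    case 3
    define a where "a = tail_fun (100 / 109)"
    have "- (96 / 1000) \<le> a" using dual_fun_values(6) dual_fun_3_10 by (simp add: a_def)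
    moreover have "a - 1 / 2 * (100 / 109 - X) \<le> tail_fun X"
      unfolding a_def by (rule tail_fun_middle(2)) (use 3 in auto)
    ultimately show ?thesis using 3 unfolding right_diff_distrib by linarith
  next
    case 4
    then show ?thesis using tail_fun_mono_near_1[of "100 / 109" X] dual_fun_values(6) dual_fun_3_10 assms by simp
  qed
qed

lemma inverse_one_plus_sq_bounds:
  fixes s :: real
  assumes "a \<le> s" "s \<le> b" "0 \<le> a"
  shows "1 / (1 + b\<^sup>2) \<le> 1 / (1 + s\<^sup>2)" "1 / (1 + s\<^sup>2) \<le> 1 / (1 + a\<^sup>2)"
proof -
  have "a\<^sup>2 \<le> s\<^sup>2" "s\<^sup>2 \<le> b\<^sup>2" using assms by (auto intro!: power_mono)
  moreover have "0 < 1 + a\<^sup>2" "0 < 1 + s\<^sup>2" by (auto intro!: add_pos_nonneg)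
  ultimately show "1 / (1 + b\<^sup>2) \<le> 1 / (1 + s\<^sup>2)" "1 / (1 + s\<^sup>2) \<le> 1 / (1 + a\<^sup>2)"
    by (auto intro!: divide_left_mono mult_pos_pos)
qed

lemma inverse_one_plus_sq_less: "s \<noteq> 0 \<Longrightarrow> 1 / (1 + s\<^sup>2) < (1 :: real)"
proof -
  assume "s \<noteq> 0"
  then have "1 + s\<^sup>2 > 1" by simp
  then show ?thesis by (subst divide_less_eq_1_pos) linarith+
qed

lemma dual_fun_antimono:
  assumes "0 < s" "s \<le> t" "t \<le> 3 / 10"
  shows "dual_fun t \<le> dual_fun s"
  unfolding dual_fun_def
proof (rule tail_fun_mono_near_1)
  have "1 / (1 + (3 / 10)\<^sup>2) \<le> 1 / (1 + t\<^sup>2)" by (rule inverse_one_plus_sq_bounds[of 0]) (use assms in auto)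
  then show "917 / 1000 \<le> 1 / (1 + t\<^sup>2)" by (simp add: power2_eq_square)
  show "1 / (1 + t\<^sup>2) \<le> 1 / (1 + s\<^sup>2)" by (rule inverse_one_plus_sq_bounds[of 0]) (use assms in auto)
  show "1 / (1 + s\<^sup>2) < 1" by (rule inverse_one_plus_sq_less) (use assms in simp)
qed

lemma dual_fun_nonneg:
  assumes "3 / 5 \<le> s"
  shows "0 \<le> dual_fun s"
  unfolding dual_fun_def
proof (rule tail_fun_nonneg)
  have "1 / (1 + s\<^sup>2) \<le> 1 / (1 + (3 / 5)\<^sup>2)" by (rule inverse_one_plus_sq_bounds[of _ _ s]) (use assms in auto)
  then show "1 / (1 + s\<^sup>2) \<le> 25 / 34" by (simp add: power2_eq_square)
qed simp

lemma dual_fun_ge: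
  assumes "0 < s"
  shows "- (105 / 1000) \<le> dual_fun s"
  unfolding dual_fun_def
proof (rule tail_fun_ge)
  show "1 / (1 + s\<^sup>2) < 1" by (rule inverse_one_plus_sq_less) (use assms in simp)
qed simp

section \<open>The two leading terms of a dyadic sum\<close>

definition pair_fun :: "real \<Rightarrow> real" where
  "pair_fun s = dual_fun s + dual_fun (2 * s)"

definition pair_slope :: "real \<Rightarrow> real" where
  "pair_slope s = 1 / (1 + s\<^sup>2) * tail_slope (1 / (1 + s\<^sup>2)) + 1 / (1 + (2 * s)\<^sup>2) * tail_slope (1 / (1 + (2 * s)\<^sup>2))"

lemma pair_fun_deriv:
  assumes "s > 0"
  shows "(pair_fun has_real_derivative - (2 / s) * pair_slope s) (at s)"
proof -
  have "((\<lambda>s. dual_fun (2 * s)) has_real_derivative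
     - (2 / (2 * s)) * (1 / (1 + (2 * s)\<^sup>2) * tail_slope (1 / (1 + (2 * s)\<^sup>2))) * 2) (at s)"
    by (rule DERIV_chain2[where g = "\<lambda>s. 2 * s", OF dual_fun_deriv]) (use assms in \<open>auto intro!: derivative_eq_intros\<close>)
  from DERIV_add[OF dual_fun_deriv[OF assms] this] show ?thesis
    unfolding pair_fun_def [abs_def] pair_slope_def using assms by (simp add: algebra_simps)
qed

text \<open>Up to the factor \<open>- 2 / s\<close>, \<open>pair_slope\<close> is the derivative of
  \<open>pair_fun\<close>. The sign is decided by the term at \<open>s\<close>: its slope is at
  least \<open>3 / 20\<close> against \<open>- 13 / 100\<close> at \<open>2 * s\<close> in the first
  range, and at most \<open>- 1 / 40\<close> against \<open>1 / 50\<close> in the last. The two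
  other bounds control only the size.\<close>

lemma pair_slope_cases:
  fixes s :: real
  shows "19 / 100 \<le> s \<Longrightarrow> s \<le> 1 / 4 \<Longrightarrow> 0 \<le> pair_slope s"
    and "1 / 5 \<le> s \<Longrightarrow> s \<le> 1 / 4 \<Longrightarrow> \<bar>pair_slope s\<bar> \<le> 4 / 10"
    and "1 / 4 \<le> s \<Longrightarrow> s \<le> 3 / 5 \<Longrightarrow> \<bar>pair_slope s\<bar> \<le> 1 / 2"
    and "33 / 100 \<le> s \<Longrightarrow> s \<le> 3 / 5 \<Longrightarrow> pair_slope s \<le> 0"
proof -
  define X Y where "X = 1 / (1 + s\<^sup>2)" and "Y = 1 / (1 + (2 * s)\<^sup>2)"
  have ps: "pair_slope s = X * tail_slope X + Y * tail_slope Y" by (simp add: pair_slope_def X_def Y_def)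
  have bd: "1 / (1 + b\<^sup>2) \<le> X" "X \<le> 1 / (1 + a\<^sup>2)" "1 / (1 + (2 * b)\<^sup>2) \<le> Y" "Y \<le> 1 / (1 + (2 * a)\<^sup>2)"
    if "a \<le> s" "s \<le> b" "0 \<le> a" for a b
    unfolding X_def Y_def using inverse_one_plus_sq_bounds[of a s b] inverse_one_plus_sq_bounds[of "2 * a" "2 * s" "2 * b"] that
    by auto
  have prod_ge: "X * c \<le> X * tail_slope X" if "c \<le> tail_slope X" "0 \<le> X" for c X :: real
    using that by (rule mult_left_mono)
  have prod_le: "X * tail_slope X \<le> X * c" if "tail_slope X \<le> c" "0 \<le> X" for c X :: real
    using that by (rule mult_left_mono)
  {
    assume s: "19 / 100 \<le> s" "s \<le> 1 / 4"
    have b: "16 / 17 \<le> X" "X \<le> 10000 / 10361" "4 / 5 \<le> Y" "Y \<le> 2500 / 2861"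
      using bd[OF s] by (simp_all add: power2_eq_square)
    have "X * (3 / 20) \<le> X * tail_slope X" using tail_slope_1[of X] b by (intro prod_ge) auto
    moreover have "Y * (- (13 / 100)) \<le> Y * tail_slope Y" using tail_slope_3[of Y] b by (intro prod_ge) auto
    ultimately show "0 \<le> pair_slope s" unfolding ps using b by linarith
  }
  note nonneg = this
  {
    assume s: "1 / 5 \<le> s" "s \<le> 1 / 4"
    have b: "16 / 17 \<le> X" "X \<le> 25 / 26" "4 / 5 \<le> Y" "Y \<le> 25 / 29"
      using bd[OF s] by (simp_all add: power2_eq_square)
    have "X * tail_slope X \<le> X * (2 / 5)" using tail_slope_2[of X] b by (intro prod_le) auto
    moreover have "Y * tail_slope Y \<le> Y * (- (1 / 40))" using tail_slope_5[of Y] b by (intro prod_le) auto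
    moreover have "0 \<le> pair_slope s" using nonneg s by simp
    ultimately show "\<bar>pair_slope s\<bar> \<le> 4 / 10" unfolding ps using b by linarith
  }
  {
    assume s: "1 / 4 \<le> s" "s \<le> 3 / 5"
    have b: "25 / 34 \<le> X" "X \<le> 16 / 17" "25 / 61 \<le> Y" "Y \<le> 4 / 5"
      using bd[OF s] by (simp_all add: power2_eq_square)
    have "X * tail_slope X \<le> X * (11 / 50)" using tail_slope_4[of X] b by (intro prod_le) auto
    moreover have "Y * tail_slope Y \<le> Y * (11 / 50)" using tail_slope_4[of Y] b by (intro prod_le) auto
    moreover have "X * (- (13 / 100)) \<le> X * tail_slope X" using tail_slope_3[of X] b by (intro prod_ge) auto
    moreover have "Y * (- (13 / 100)) \<le> Y * tail_slope Y" using tail_slope_3[of Y] b by (intro prod_ge) auto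
    ultimately show "\<bar>pair_slope s\<bar> \<le> 1 / 2" unfolding ps using b by linarith
  }
  {
    assume s: "33 / 100 \<le> s" "s \<le> 3 / 5"
    have b: "25 / 34 \<le> X" "X \<le> 10000 / 11089" "25 / 61 \<le> Y" "Y \<le> 2500 / 3589"
      using bd[OF s] by (simp_all add: power2_eq_square)
    have "X * tail_slope X \<le> X * (- (1 / 40))" using tail_slope_5[of X] b by (intro prod_le) auto
    moreover have "Y * tail_slope Y \<le> Y * (1 / 50)" using tail_slope_6[of Y] b by (intro prod_le) auto
    ultimately show "pair_slope s \<le> 0" unfolding ps using b by linarith
  }
qed

lemma pair_fun_antimono:
  assumes "19 / 100 \<le> s" "s \<le> t" "t \<le> 1 / 4"
  shows "pair_fun t \<le> pair_fun s"
proof (rule DERIV_nonpos_imp_nonincreasing[OF assms(2)])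
  fix x assume x: "s \<le> x" "x \<le> t"
  then have "0 \<le> (2 / x) * pair_slope x" using pair_slope_cases(1)[of x] assms by (intro mult_nonneg_nonneg) auto
  then show "\<exists>y. (pair_fun has_real_derivative y) (at x) \<and> y \<le> 0"
    using pair_fun_deriv[of x] x assms by (intro exI[of _ "- (2 / x) * pair_slope x"] conjI) auto
qed

lemma pair_fun_mono:
  assumes "33 / 100 \<le> s" "s \<le> t" "t \<le> 3 / 5"
  shows "pair_fun s \<le> pair_fun t"
proof (rule DERIV_nonneg_imp_nondecreasing[OF assms(2)])
  fix x assume x: "s \<le> x" "x \<le> t"
  then have "(2 / x) * pair_slope x \<le> 0" using pair_slope_cases(4)[of x] assms by (intro mult_nonneg_nonpos) auto
  then show "\<exists>y. (pair_fun has_real_derivative y) (at x) \<and> 0 \<le> y"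
    using pair_fun_deriv[of x] x assms by (intro exI[of _ "- (2 / x) * pair_slope x"] conjI) auto
qed

text \<open>Splitting at \<open>1 / 4\<close> balances the factor \<open>2 / x\<close> against the
  slope bounds: \<open>10 * (4 / 10) = 8 * (1 / 2) = 4\<close>.\<close>

lemma pair_fun_lipschitz:
  assumes "s \<in> {1 / 5..3 / 5}" "t \<in> {1 / 5..3 / 5}"
  shows "\<bar>pair_fun s - pair_fun t\<bar> \<le> 4 * \<bar>s - t\<bar>"
proof -
  have "norm (pair_fun s - pair_fun t) \<le> 4 * norm (s - t)"
  proof (rule field_differentiable_bound[where S = "{1 / 5..3 / 5}" and f' = "\<lambda>x. - (2 / x) * pair_slope x"])
    fix x :: real assume x: "x \<in> {1 / 5..3 / 5}"
    show "(pair_fun has_field_derivative - (2 / x) * pair_slope x) (at x within {1 / 5..3 / 5})"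
      by (rule has_field_derivative_at_within[OF pair_fun_deriv]) (use x in auto)
    have "2 / x * \<bar>pair_slope x\<bar> \<le> 4"
    proof (cases "x \<le> 1 / 4")
      case True
      have "2 / x * \<bar>pair_slope x\<bar> \<le> 10 * (4 / 10)"
        using x True pair_slope_cases(2)[of x] by (intro mult_mono) (auto simp: field_simps)
      then show ?thesis by simp
    next
      case False
      have "2 / x * \<bar>pair_slope x\<bar> \<le> 8 * (1 / 2)"
        using x False pair_slope_cases(3)[of x] by (intro mult_mono) (auto simp: field_simps)
      then show ?thesis by simp
    qed
    then show "norm (- (2 / x) * pair_slope x) \<le> 4" using x by (simp add: abs_mult)
  qed (use assms in auto)
  then show ?thesis by simp
qed

text \<open>This allows the negative part of \<open>p = pair_fun\<close> to be integrated without
  locating zeros, because \<open>max 0 (- p) \<le> 15 / 10000 - p\<close>. By monotonicity the outer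
  ranges reduce to the end points \<open>1 / 5\<close> and \<open>3 / 5\<close>, where
  \<open>p\<close> is nearly 0; in the middle range the term at \<open>s\<close> is at most
  \<open>- 5 / 100\<close> and the term at \<open>2 * s\<close> at most
  \<open>1 / 100\<close>.\<close>

lemma pair_fun_upper:
  assumes "1 / 5 \<le> s" "s \<le> 3 / 5"
  shows "pair_fun s \<le> 15 / 10000"
proof -
  consider "s \<le> 1 / 4" | "1 / 4 \<le> s" "s \<le> 33 / 100" | "33 / 100 \<le> s" by linarith
  then show ?thesis
  proof cases
    case 1
    then have "pair_fun s \<le> pair_fun (1 / 5)" using assms by (intro pair_fun_antimono) auto
    then show ?thesis using dual_fun_values(4) by (simp add: pair_fun_def)
  next
    case 3
    then have "pair_fun s \<le> pair_fun (3 / 5)" using assms by (intro pair_fun_mono) auto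
    then show ?thesis using dual_fun_values(10) by (simp add: pair_fun_def)
  next
    case 2
    define X Y where "X = 1 / (1 + s\<^sup>2)" and "Y = 1 / (1 + (2 * s)\<^sup>2)"
    have b: "10000 / 11089 \<le> X" "X \<le> 16 / 17" "2500 / 3589 \<le> Y" "Y \<le> 4 / 5"
      using inverse_one_plus_sq_bounds[OF 2] inverse_one_plus_sq_bounds[of "2 * (1 / 4)" "2 * s" "2 * (33 / 100)"] 2
      by (simp_all add: X_def Y_def power2_eq_square)
    have "tail_fun X \<le> - (5 / 100)"
    proof (cases "X \<le> 100 / 109")
      case True
      define a where "a = tail_fun (100 / 109)"
      have "a \<le> - (9 / 100)" using dual_fun_values(7) dual_fun_3_10 by (simp add: a_def)
      moreover have "tail_fun X \<le> a + 1 / 2 * (100 / 109 - X)"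
        unfolding a_def by (rule tail_fun_middle(1)) (use True b in auto)
      ultimately show ?thesis using b unfolding right_diff_distrib by linarith
    next
      case False
      then show ?thesis using tail_fun_mono_near_1[of X "16 / 17"] dual_fun_values(5) dual_fun_1_4 b by simp
    qed
    moreover have "tail_fun Y \<le> tail_fun (2500 / 3589)" using b by (intro tail_fun_antimono_middle) auto
    moreover have "tail_fun (2500 / 3589) = dual_fun (33 / 50)" by (simp add: dual_fun_def power2_eq_square)
    ultimately show ?thesis using dual_fun_values(11) unfolding pair_fun_def by (simp add: dual_fun_def X_def Y_def)
  qed
qed

section \<open>Dyadic sums of the dual weight\<close>

text \<open>A crude decay estimate that only serves convergence; its constant does not reach the
  final bound. As \<open>dual_fun\<close> is nonnegative for \<open>s \<ge> 1\<close>, an upper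
  estimate is enough.\<close>

lemma dual_fun_bigo:
  assumes "1 \<le> s"
  shows "\<bar>dual_fun s\<bar> \<le> 100 / s\<^sup>2"
proof -
  define X where "X = 1 / (1 + s\<^sup>2)"
  have s1: "1 \<le> s\<^sup>2" using assms by (simp add: one_le_power)
  have X: "0 < X" "X \<le> 1 / 2" "X \<le> 1 / s\<^sup>2"
    using s1 assms by (auto simp: X_def field_simps add_pos_pos)
  have pow: "X ^ k \<le> X" if "k \<ge> 1" for k
    using power_decreasing[OF that, of X] X by simp
  have "0 \<le> dual_fun s" using dual_fun_nonneg[of s] assms by simp
  moreover have "- ln (1 - X) \<le> 2 * X"
  proof -
    have "ln (inverse (1 - X)) \<le> inverse (1 - X) - 1" using X by (intro ln_le_minus_one) auto
    also have "\<dots> = X / (1 - X)" using X by (simp add: field_simps)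
    also have "\<dots> \<le> X / (1 / 2)" using X by (intro divide_left_mono) auto
    finally show ?thesis using X by (simp add: ln_inverse)
  qed
  moreover have "- tail_poly X \<le> 50 * X"
  proof -
    have "0 \<le> X ^ 2" "0 \<le> X ^ 3" "0 \<le> X ^ 5" "0 \<le> X ^ 7" using X by simp_all
    moreover have "X ^ 4 \<le> X" "X ^ 6 \<le> X" using pow by simp_all
    moreover have "tail_poly X = 4997 / 5000 * X + 1173 / 2500 * X ^ 2 + 1239 / 1250 * X ^ 3 - 3012 / 625 * X ^ 4
        + 54072 / 3125 * X ^ 5 - 16128 / 625 * X ^ 6 + 9216 / 625 * X ^ 7"
      by (simp add: tail_poly_def)
    ultimately show ?thesis using X(1) by linarith
  qed
  ultimately have "\<bar>dual_fun s\<bar> \<le> 52 * X" unfolding dual_fun_def tail_fun_def X_def by linarith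
  also have "\<dots> \<le> 100 * (1 / s\<^sup>2)" using X by (intro mult_mono) auto
  finally show ?thesis by simp
qed

lemma summable_dyadic_dual_fun:
  assumes "s > 0"
  shows "summable (\<lambda>k. dual_fun (2 ^ k * s))"
proof -
  obtain K where K: "1 / s < 2 ^ K" using real_arch_pow[of 2 "1 / s"] by auto
  show ?thesis
  proof (rule summable_comparison_test'[where N = K])
    show "summable (\<lambda>k. 100 / s\<^sup>2 * (1 / 4) ^ k)" by (intro summable_mult summable_geometric) simp
    fix k assume "K \<le> k"
    then have "2 ^ K \<le> (2 ^ k :: real)" by (intro power_increasing) auto
    then have "1 / s \<le> 2 ^ k" using K by linarith
    then have "1 \<le> 2 ^ k * s" using assms by (simp add: field_simps)
    then have "\<bar>dual_fun (2 ^ k * s)\<bar> \<le> 100 / (2 ^ k * s)\<^sup>2" by (rule dual_fun_bigo)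
    also have "\<dots> = 100 / s\<^sup>2 * (1 / 4) ^ k"
    proof -
      have "(2 ^ k :: real)\<^sup>2 = 4 ^ k" by (simp add: power_mult [symmetric] mult.commute[of k 2]) (simp add: power_mult)
      then show ?thesis by (simp add: power_mult_distrib power_one_over)
    qed
    finally show "norm (dual_fun (2 ^ k * s)) \<le> 100 / s\<^sup>2 * (1 / 4) ^ k" by simp
  qed
qed

definition dyadic_fun :: "real \<Rightarrow> real" where
  "dyadic_fun s = (\<Sum>k. dual_fun (2 ^ k * s))"

lemma dyadic_fun_unfold:
  assumes "s > 0"
  shows "dyadic_fun s = dual_fun s + dyadic_fun (2 * s)"
  using suminf_split_head[OF summable_dyadic_dual_fun[OF assms]]
  by (simp add: dyadic_fun_def mult_ac)

lemma dyadic_fun_nonneg_large: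
  assumes "3 / 5 \<le> s"
  shows "0 \<le> dyadic_fun s"
  unfolding dyadic_fun_def
proof (rule suminf_nonneg[OF summable_dyadic_dual_fun])
  show "s > 0" using assms by simp
  fix k :: nat
  have "1 * s \<le> 2 ^ k * s" using assms by (intro mult_right_mono) auto
  then have "3 / 5 \<le> 2 ^ k * s" using assms by linarith
  then show "0 \<le> dual_fun (2 ^ k * s)" by (rule dual_fun_nonneg)
qed

text \<open>All further terms have arguments at least \<open>4 * s \<ge> 3 / 5\<close>, where
  \<open>dual_fun\<close> is nonnegative.\<close>

lemma dyadic_fun_ge_pair:
  assumes "3 / 20 \<le> s"
  shows "pair_fun s \<le> dyadic_fun s"
  using dyadic_fun_unfold[of s] dyadic_fun_unfold[of "2 * s"] dyadic_fun_nonneg_large[of "2 * (2 * s)"] assms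
  by (simp add: pair_fun_def)

text \<open>For \<open>t\<close> between \<open>1 / 10\<close> and \<open>1 / 5\<close> a positive
  leading term has to pay for the terms whose arguments are below \<open>3 / 5\<close>: those at
  \<open>2 * t\<close> and \<open>4 * t\<close> if \<open>t \<le> 3 / 20\<close>, only the one at
  \<open>2 * t\<close> otherwise. Near \<open>1 / 5\<close> the global minimum is too weak an
  estimate, and monotonicity of \<open>pair_fun\<close> is used instead.\<close>

lemma dyadic_fun_nonneg_small:
  assumes "0 < s" "s \<le> 1 / 5"
  shows "0 \<le> dyadic_fun s"
proof -
  have step: "0 \<le> dyadic_fun t" if t: "1 / 10 \<le> t" "t \<le> 1 / 5" for t
  proof -
    consider "t \<le> 3 / 20" | "3 / 20 \<le> t" "t \<le> 19 / 100" | "19 / 100 \<le> t" by linarith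
    then show ?thesis
    proof cases
      case 1
      have "dyadic_fun t = dual_fun t + (dual_fun (2 * t) + (dual_fun (2 * (2 * t)) + dyadic_fun (2 * (2 * (2 * t)))))"
        using t by (simp add: dyadic_fun_unfold[of t] dyadic_fun_unfold[of "2 * t"] dyadic_fun_unfold[of "4 * t"])
      moreover have "dual_fun (3 / 20) \<le> dual_fun t" using 1 t by (intro dual_fun_antimono) auto
      ultimately show ?thesis
        using dual_fun_values(1) dual_fun_ge[of "2 * t"] dual_fun_ge[of "2 * (2 * t)"]
          dyadic_fun_nonneg_large[of "2 * (2 * (2 * t))"] t by linarith
    next
      case 2
      have "dual_fun (19 / 100) \<le> dual_fun t" using 2 by (intro dual_fun_antimono) auto
      moreover have "pair_fun t \<le> dyadic_fun t" using 2 by (intro dyadic_fun_ge_pair) auto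
      ultimately show ?thesis using dual_fun_values(2) dual_fun_ge[of "2 * t"] t unfolding pair_fun_def by linarith
    next
      case 3
      have "pair_fun (1 / 5) \<le> pair_fun t" using 3 t by (intro pair_fun_antimono) auto
      moreover have "pair_fun t \<le> dyadic_fun t" using 3 by (intro dyadic_fun_ge_pair) auto
      moreover have "0 \<le> pair_fun (1 / 5)" using dual_fun_values(3) by (simp add: pair_fun_def)
      ultimately show ?thesis by linarith
    qed
  qed
  \<comment> \<open>\<open>n\<close> bounds the number of doublings that carry \<open>t\<close> up
    to \<open>1 / 10\<close>. Each doubling splits off a nonnegative term, since its argument is
    still below \<open>1 / 10\<close>.\<close>
  have "\<forall>t. 0 < t \<and> t \<le> 1 / 5 \<and> 1 / 10 \<le> 2 ^ n * t \<longrightarrow> 0 \<le> dyadic_fun t" for n :: nat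
  proof (induction n)
    case 0
    then show ?case using step by simp
  next
    case (Suc n)
    show ?case
    proof (intro allI impI)
      fix t :: real assume t: "0 < t \<and> t \<le> 1 / 5 \<and> 1 / 10 \<le> 2 ^ Suc n * t"
      show "0 \<le> dyadic_fun t"
      proof (cases "1 / 10 \<le> t")
        case True
        then show ?thesis using step t by simp
      next
        case False
        then have "0 \<le> dyadic_fun (2 * t)" using Suc.IH[rule_format, of "2 * t"] t by (simp add: mult_ac)
        moreover have "0 \<le> dual_fun t"
        proof -
          have "dual_fun (3 / 20) \<le> dual_fun t" using False t by (intro dual_fun_antimono) auto
          then show ?thesis using dual_fun_values(1) by linarith
        qed
        ultimately show ?thesis using dyadic_fun_unfold[of t] t by simp
      qed
    qed
  qed
  moreover obtain n where "1 / (10 * s) < 2 ^ n" using real_arch_pow[of 2 "1 / (10 * s)"] by auto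
  then have "1 / 10 \<le> 2 ^ n * s" using assms by (simp add: field_simps)
  ultimately show ?thesis using assms by blast
qed

text \<open>The clamping makes the possible negative part of \<open>dyadic_fun\<close>, which lives on \<open>{1/5..3/5}\<close>,
  Lipschitz on the whole line.\<close>

definition bump :: "real \<Rightarrow> real" where
  "bump s = max 0 (- pair_fun (max (1 / 5) (min (3 / 5) s)))"

lemma bump_nonneg: "0 \<le> bump s"
  by (simp add: bump_def)

lemma bump_outside:
  assumes "s < 1 / 5 \<or> 3 / 5 < s"
  shows "bump s = 0"
proof -
  have "0 \<le> pair_fun (1 / 5)" using dual_fun_values(3) by (simp add: pair_fun_def)
  moreover have "0 \<le> pair_fun (3 / 5)"
    using dual_fun_nonneg[of "3 / 5"] dual_fun_nonneg[of "2 * (3 / 5)"] by (simp add: pair_fun_def)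
  moreover have "max (1 / 5) (min (3 / 5) s) = 1 / 5 \<or> max (1 / 5) (min (3 / 5) s) = 3 / 5" using assms by auto
  ultimately show ?thesis unfolding bump_def by auto
qed

lemma bump_lipschitz: "\<bar>bump s - bump t\<bar> \<le> 4 * \<bar>s - t\<bar>"
proof -
  define x y where "x = max (1 / 5) (min (3 / 5) s)" and "y = max (1 / 5) (min (3 / 5) t)"
  have "\<bar>max 0 (- a) - max 0 (- b)\<bar> \<le> \<bar>a - b\<bar>" for a b :: real by (auto simp: max_def)
  then have "\<bar>bump s - bump t\<bar> \<le> \<bar>pair_fun x - pair_fun y\<bar>" unfolding bump_def x_def y_def .
  also have "\<dots> \<le> 4 * \<bar>x - y\<bar>" by (rule pair_fun_lipschitz) (auto simp: x_def y_def)
  also have "\<bar>x - y\<bar> \<le> \<bar>s - t\<bar>" by (simp add: x_def y_def)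
  finally show ?thesis by simp
qed

lemma dyadic_fun_ge_bump:
  assumes "0 < s"
  shows "- bump s \<le> dyadic_fun s"
proof -
  consider "s \<le> 1 / 5" | "1 / 5 \<le> s" "s \<le> 3 / 5" | "3 / 5 \<le> s" by linarith
  then show ?thesis
  proof cases
    case 1
    then show ?thesis using dyadic_fun_nonneg_small[of s] bump_nonneg[of s] assms by linarith
  next
    case 2
    then have "bump s \<ge> - pair_fun s" by (simp add: bump_def)
    moreover have "pair_fun s \<le> dyadic_fun s" using 2 by (intro dyadic_fun_ge_pair) auto
    ultimately show ?thesis by linarith
  next
    case 3
    then show ?thesis using dyadic_fun_nonneg_large[of s] bump_nonneg[of s] by linarith
  qed
qed

section \<open>The integral of the negative part\<close>

definition dual_prim :: "real \<Rightarrow> real" where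
  "dual_prim s = s * ln (1 + 1 / s\<^sup>2) + 193 / 1000 * arctan s - s * (2019 / 2500 * (1 / (1 + s\<^sup>2)) + 191 / 500 * (1 / (1 + s\<^sup>2)) ^ 2
     + 671 / 6250 * (1 / (1 + s\<^sup>2)) ^ 3 + 2439 / 3125 * (1 / (1 + s\<^sup>2)) ^ 4 - 768 / 625 * (1 / (1 + s\<^sup>2)) ^ 5
     + 768 / 625 * (1 / (1 + s\<^sup>2)) ^ 6)"

text \<open>Integration by parts gives \<open>s * ln (1 + 1 / s^2) + 2 * arctan s\<close> for the
  logarithm, and the reduction formula turns powers of \<open>X = 1 / (1 + s^2)\<close> into
  \<open>s\<close> times lower powers plus multiples of \<open>arctan s\<close>. These multiples
  collect to \<open>0.193 = 2 * 0.0965\<close>. A consistency check: the integral of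
  \<open>dual_fun\<close> over the half-line is \<open>0.193 * pi / 2\<close>, which is
  \<open>2 * pi\<close> times the coefficient \<open>0.04825\<close> of the linear main
  term.\<close>

lemma dual_prim_deriv:
  assumes "s > 0"
  shows "(dual_prim has_real_derivative dual_fun s) (at s)"
proof -
  define X where "X = 1 / (1 + s\<^sup>2)"
  have p: "1 + s\<^sup>2 > 1" using assms by simp
  have sX: "s\<^sup>2 * X = 1 - X"
  proof -
    have "(u - 1) * (1 / u) = 1 - 1 / u" if "u > 1" for u :: real using that by (simp add: field_simps)
    from this[OF p] show ?thesis by (simp add: X_def)
  qed
  have dX: "((\<lambda>s. 1 / (1 + s\<^sup>2)) has_real_derivative - (2 * s) * X\<^sup>2) (at s)"
    using p by (auto intro!: derivative_eq_intros simp: X_def power2_eq_square)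
  have dpow: "((\<lambda>s. s * (1 / (1 + s\<^sup>2)) ^ k) has_real_derivative X ^ k - real (2 * k) * (X ^ k * (1 - X))) (at s)" for k
  proof (cases k)
    case 0
    then show ?thesis by simp
  next
    case (Suc j)
    have "((\<lambda>s. s * (1 / (1 + s\<^sup>2)) ^ k) has_real_derivative
        1 * X ^ k + (of_nat k * (- (2 * s) * X\<^sup>2 * X ^ (k - Suc 0))) * s) (at s)"
      using DERIV_mult[OF DERIV_ident DERIV_power[OF dX, of k]] by (simp add: X_def)
    also have "1 * X ^ k + (of_nat k * (- (2 * s) * X\<^sup>2 * X ^ (k - Suc 0))) * s = X ^ k - real (2 * k) * (X ^ k * (s\<^sup>2 * X))"
      using Suc by (simp add: power2_eq_square)
    finally show ?thesis unfolding sX .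
  qed
  have dln: "((\<lambda>s. s * ln (1 + 1 / s\<^sup>2)) has_real_derivative ln (1 + 1 / s\<^sup>2) - 2 * X) (at s)"
  proof -
    have q: "1 + 1 / s\<^sup>2 > 0" using assms by (simp add: add_pos_pos)
    have d1: "((\<lambda>s. 1 + 1 / s\<^sup>2) has_real_derivative - 2 / s ^ 3) (at s)"
      using assms by (auto intro!: derivative_eq_intros simp: power2_eq_square power3_eq_cube)
    have "((\<lambda>s. s * ln (1 + 1 / s\<^sup>2)) has_real_derivative 1 * ln (1 + 1 / s\<^sup>2) + (inverse (1 + 1 / s\<^sup>2) * (- 2 / s ^ 3)) * s) (at s)"
      by (rule DERIV_mult[OF DERIV_ident DERIV_chain2[OF DERIV_ln[OF q] d1]])
    also have "(inverse (1 + 1 / s\<^sup>2) * (- 2 / s ^ 3)) * s = - 2 * X"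
    proof -
      have "inverse (1 + 1 / u) * (- 2 / u) = - 2 * (1 / (1 + u))" if "u > 0" for u :: real
      proof -
        have "1 + 1 / u = (1 + u) / u" using that by (simp add: field_simps)
        then show ?thesis using that by simp
      qed
      from this[of "s\<^sup>2"] show ?thesis using assms by (simp add: X_def power2_eq_square power3_eq_cube)
    qed
    finally show ?thesis by simp
  qed
  have dat: "((\<lambda>s. 193 / 1000 * arctan s) has_real_derivative 193 / 1000 * X) (at s)"
    using DERIV_cmult[OF DERIV_arctan[of s], of "193 / 1000"] by (simp add: X_def inverse_eq_divide)
  have eq: "dual_prim = (\<lambda>s. s * ln (1 + 1 / s\<^sup>2) + 193 / 1000 * arctan s - (2019 / 2500 * (s * (1 / (1 + s\<^sup>2)) ^ 1)
     + 191 / 500 * (s * (1 / (1 + s\<^sup>2)) ^ 2) + 671 / 6250 * (s * (1 / (1 + s\<^sup>2)) ^ 3) + 2439 / 3125 * (s * (1 / (1 + s\<^sup>2)) ^ 4)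
     + (- 768 / 625) * (s * (1 / (1 + s\<^sup>2)) ^ 5) + 768 / 625 * (s * (1 / (1 + s\<^sup>2)) ^ 6)))"
    by (rule ext) (simp only: dual_prim_def power_one_right, simp only: algebra_simps)
  have "(dual_prim has_real_derivative (ln (1 + 1 / s\<^sup>2) - 2 * X) + 193 / 1000 * X -
     (2019 / 2500 * (X ^ 1 - real (2 * 1) * (X ^ 1 * (1 - X)))
     + 191 / 500 * (X ^ 2 - real (2 * 2) * (X ^ 2 * (1 - X))) + 671 / 6250 * (X ^ 3 - real (2 * 3) * (X ^ 3 * (1 - X)))
     + 2439 / 3125 * (X ^ 4 - real (2 * 4) * (X ^ 4 * (1 - X)))
     + (- 768 / 625) * (X ^ 5 - real (2 * 5) * (X ^ 5 * (1 - X))) + 768 / 625 * (X ^ 6 - real (2 * 6) * (X ^ 6 * (1 - X))))) (at s)"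
    unfolding eq by (intro DERIV_add DERIV_diff DERIV_cmult dln dat dpow)
  moreover have "(ln (1 + 1 / s\<^sup>2) - 2 * X) + 193 / 1000 * X -
     (2019 / 2500 * (X ^ 1 - real (2 * 1) * (X ^ 1 * (1 - X)))
     + 191 / 500 * (X ^ 2 - real (2 * 2) * (X ^ 2 * (1 - X))) + 671 / 6250 * (X ^ 3 - real (2 * 3) * (X ^ 3 * (1 - X)))
     + 2439 / 3125 * (X ^ 4 - real (2 * 4) * (X ^ 4 * (1 - X)))
     + (- 768 / 625) * (X ^ 5 - real (2 * 5) * (X ^ 5 * (1 - X))) + 768 / 625 * (X ^ 6 - real (2 * 6) * (X ^ 6 * (1 - X)))) =
     ln (1 + 1 / s\<^sup>2) - tail_poly X"
    unfolding tail_poly_def by (simp add: field_simps eval_nat_numeral)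
  ultimately show ?thesis using dual_fun_eq[OF assms] by (simp only: X_def)
qed

lemma arctan_upper: "0 \<le> x \<Longrightarrow> arctan x \<le> x - x ^ 3 / 3 + x ^ 5 / 5"
  and arctan_lower: "0 \<le> x \<Longrightarrow> x - x ^ 3 / 3 + x ^ 5 / 5 - x ^ 7 / 7 \<le> arctan x"
proof -
  have d: "1 - x\<^sup>2 + x ^ 4 - 1 / (1 + x\<^sup>2) = x ^ 6 / (1 + x\<^sup>2)"
    "1 / (1 + x\<^sup>2) - (1 - x\<^sup>2 + x ^ 4 - x ^ 6) = x ^ 8 / (1 + x\<^sup>2)" for x :: real
  proof -
    have "1 + x\<^sup>2 \<noteq> 0" using zero_le_power2[of x] by linarith
    then show "1 - x\<^sup>2 + x ^ 4 - 1 / (1 + x\<^sup>2) = x ^ 6 / (1 + x\<^sup>2)"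
      "1 / (1 + x\<^sup>2) - (1 - x\<^sup>2 + x ^ 4 - x ^ 6) = x ^ 8 / (1 + x\<^sup>2)"
      by (simp_all add: divide_simps) (simp_all add: algebra_simps eval_nat_numeral)
  qed
  assume x: "0 \<le> x"
  have "0 - 0 ^ 3 / 3 + 0 ^ 5 / 5 - arctan 0 \<le> x - x ^ 3 / 3 + x ^ 5 / 5 - arctan x"
  proof (rule DERIV_nonneg_imp_nondecreasing[OF x])
    fix t :: real
    have "((\<lambda>x. x - x ^ 3 / 3 + x ^ 5 / 5 - arctan x) has_real_derivative (1 - t\<^sup>2 + t ^ 4 - 1 / (1 + t\<^sup>2))) (at t)"
      by (auto intro!: derivative_eq_intros simp: inverse_eq_divide)
    then show "\<exists>y. ((\<lambda>x. x - x ^ 3 / 3 + x ^ 5 / 5 - arctan x) has_real_derivative y) (at t) \<and> 0 \<le> y"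
      unfolding d by (rule exI[of _ "t ^ 6 / (1 + t\<^sup>2)", OF conjI]) simp
  qed
  then show "arctan x \<le> x - x ^ 3 / 3 + x ^ 5 / 5" by simp
  have "arctan 0 - (0 - 0 ^ 3 / 3 + 0 ^ 5 / 5 - 0 ^ 7 / 7) \<le> arctan x - (x - x ^ 3 / 3 + x ^ 5 / 5 - x ^ 7 / 7)"
  proof (rule DERIV_nonneg_imp_nondecreasing[OF x])
    fix t :: real
    have "((\<lambda>x. arctan x - (x - x ^ 3 / 3 + x ^ 5 / 5 - x ^ 7 / 7)) has_real_derivative (1 / (1 + t\<^sup>2) - (1 - t\<^sup>2 + t ^ 4 - t ^ 6))) (at t)"
      by (auto intro!: derivative_eq_intros simp: inverse_eq_divide)
    then show "\<exists>y. ((\<lambda>x. arctan x - (x - x ^ 3 / 3 + x ^ 5 / 5 - x ^ 7 / 7)) has_real_derivative y) (at t) \<and> 0 \<le> y"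
      unfolding d by (rule exI[of _ "t ^ 8 / (1 + t\<^sup>2)", OF conjI]) simp
  qed
  then show "x - x ^ 3 / 3 + x ^ 5 / 5 - x ^ 7 / 7 \<le> arctan x" by simp
qed

lemma pi_lower: "31415 / 10000 \<le> pi" and pi_upper: "pi \<le> 31417 / 10000"
  using machin arctan_lower[of "1 / 5"] arctan_upper[of "1 / 5"] arctan_lower[of "1 / 239"] arctan_upper[of "1 / 239"]
  by (simp_all add: eval_nat_numeral)

lemma arctan_6_5: "876 / 1000 \<le> arctan (6 / 5)"
proof -
  \<comment> \<open>The truncated series is too inaccurate at \<open>6 / 5\<close>; the addition
    formula moves to a small argument by \<open>(1 + 1 / 11) / (1 - 1 / 11) = 6 / 5\<close>.\<close>
  have "arctan (6 / 5) = arctan 1 + arctan (1 / 11)" by (subst arctan_add) auto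
  then show ?thesis using arctan_lower[of "1 / 11"] pi_lower by (simp add: arctan_one eval_nat_numeral)
qed

lemma dual_prim_values:
  "dual_prim (1 / 5) = 1 / 5 * ln (26) + 193 / 1000 * arctan (1 / 5) - 3578545259 / 9653618000"
  "dual_prim (2 / 5) = 2 / 5 * ln (29 / 4) + 193 / 1000 * arctan (2 / 5) - 41614792978 / 74352915125"
  "dual_prim (3 / 5) = 3 / 5 * ln (34 / 9) + 193 / 1000 * arctan (3 / 5) - 29001738573 / 48275138000"
  "dual_prim (6 / 5) = 6 / 5 * ln (61 / 36) + 193 / 1000 * arctan (6 / 5) - 3216194153766 / 6440046795125"
  by (simp_all add: dual_prim_def power2_eq_square eval_nat_numeral)

text \<open>\<open>bump\<close> is replaced by the larger \<open>15 / 10000 - pair_fun\<close>,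
  which has an explicit antiderivative. The two differ by at most \<open>15 / 10000\<close>, so the
  replacement costs at most \<open>0.0006\<close> over an interval of length
  \<open>2 / 5\<close>.\<close>

lemma integral_bump_le: "integral {1 / 5..3 / 5} bump \<le> 21 / 1000"
proof -
  define A where "A s = 15 / 10000 * s - (dual_prim s + dual_prim (2 * s) / 2)" for s
  have up: "((\<lambda>s. 15 / 10000 - pair_fun s) has_integral (A (3 / 5) - A (1 / 5))) {1 / 5..3 / 5}"
  proof (rule fundamental_theorem_of_calculus)
    fix s :: real assume "s \<in> {1 / 5..3 / 5}"
    then have s: "s > 0" "2 * s > 0" by auto
    have "((\<lambda>s. dual_prim (2 * s)) has_real_derivative dual_fun (2 * s) * 2) (at s)"
      by (rule DERIV_chain2[where g = "\<lambda>s. 2 * s", OF dual_prim_deriv[OF s(2)]]) (auto intro!: derivative_eq_intros)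
    then have "((\<lambda>s. dual_prim (2 * s) / 2) has_real_derivative dual_fun (2 * s) * 2 / 2) (at s)" by (rule DERIV_cdivide)
    then have "(A has_real_derivative 15 / 10000 * 1 - (dual_fun s + dual_fun (2 * s) * 2 / 2)) (at s)"
      unfolding A_def [abs_def]
      by (rule DERIV_diff[OF DERIV_cmult[OF DERIV_ident] DERIV_add[OF dual_prim_deriv[OF s(1)]]])
    then have "(A has_real_derivative 15 / 10000 - pair_fun s) (at s)" by (simp add: pair_fun_def)
    then show "(A has_vector_derivative 15 / 10000 - pair_fun s) (at s within {1 / 5..3 / 5})"
      unfolding has_real_derivative_iff_has_vector_derivative [symmetric]
      by (rule has_field_derivative_at_within)
  qed simp
  have low: "(bump has_integral integral {1 / 5..3 / 5} bump) {1 / 5..3 / 5}"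
  proof (intro integrable_integral integrable_continuous_interval)
    have "4-lipschitz_on {1 / 5..3 / 5} bump"
      using bump_lipschitz by (intro lipschitz_onI) (auto simp: dist_real_def)
    then show "continuous_on {1 / 5..3 / 5} bump" by (rule lipschitz_on_continuous_on)
  qed
  have "bump s \<le> 15 / 10000 - pair_fun s" if "s \<in> {1 / 5..3 / 5}" for s
    using that pair_fun_upper[of s] by (simp add: bump_def)
  then have "integral {1 / 5..3 / 5} bump \<le> A (3 / 5) - A (1 / 5)"
    by (rule has_integral_le[OF low up])
  also have "A (3 / 5) - A (1 / 5) = 15 / 10000 * (2 / 5) - (dual_prim (3 / 5) + dual_prim (6 / 5) / 2) + (dual_prim (1 / 5) + dual_prim (2 / 5) / 2)"
    by (simp add: A_def)
  also have "\<dots> \<le> 21 / 1000"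
  proof -
    have "arctan (1 / 5) \<le> 1 / 5 - (1 / 5) ^ 3 / 3 + (1 / 5) ^ 5 / 5" "arctan (2 / 5) \<le> 2 / 5 - (2 / 5) ^ 3 / 3 + (2 / 5) ^ 5 / 5"
      "3 / 5 - (3 / 5) ^ 3 / 3 + (3 / 5) ^ 5 / 5 - (3 / 5) ^ 7 / 7 \<le> arctan (3 / 5 :: real)"
      by (rule arctan_upper arctan_lower, simp)+
    then have "arctan (1 / 5) \<le> 197398 / 1000000" "arctan (2 / 5) \<le> 380715 / 1000000" "539552 / 1000000 \<le> arctan (3 / 5 :: real)"
      by (simp_all add: eval_nat_numeral)
    then have "dual_prim (1 / 5) \<le> 319026 / 1000000" "dual_prim (2 / 5) \<le> 306192 / 1000000"
      "300846 / 1000000 \<le> dual_prim (3 / 5)" "302470 / 1000000 \<le> dual_prim (6 / 5)"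
      unfolding dual_prim_values using ln_26 ln_29_4 ln_34_9 ln_61_36 arctan_6_5 by linarith+
    then show ?thesis by linarith
  qed
  finally show ?thesis .
qed

section \<open>Construction of the weights\<close>

lemma dual_pair_cong:
  assumes "dual_pair c d K \<kappa> u v E" "\<kappa> > 0"
    and "\<And>t. t > 0 \<Longrightarrow> u t = u' t" "\<And>x. x > 0 \<Longrightarrow> v x = v' x" "\<And>w. w > 0 \<Longrightarrow> E w = E' w"
  shows "dual_pair c d K \<kappa> u' v' E'"
  using assms unfolding dual_pair_def by (simp del: of_nat_Suc)

lemma power_le_fact_exp:
  assumes "0 \<le> (t :: real)"
  shows "t ^ n * exp (- t) \<le> fact n"
proof -
  have "t ^ n /\<^sub>R fact n \<le> exp t"
    using sum_le_suminf[OF summable_exp_generic[of t], of "{n}"] assms by (simp add: exp_def)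
  then show ?thesis by (simp add: exp_minus field_simps)
qed

text \<open>\<open>t d/dt\<close> sends \<open>t ^ k * exp (- t)\<close> to
  \<open>k * t ^ k * exp (- t) - t ^ Suc k * exp (- t)\<close>. Subtracting this image from
  \<open>k\<close> times the given pair isolates the next power.\<close>

lemma dual_pair_gamma_step:
  assumes pair: "dual_pair c d K \<kappa> (\<lambda>t. t ^ k * exp (- t)) v E"
    and cd: "\<And>n. \<bar>c n\<bar> \<le> 1" "\<And>m. \<bar>d m\<bar> \<le> 1" and \<kappa>: "\<kappa> > 0"
    and v: "\<And>x. x > 0 \<Longrightarrow> (v has_real_derivative v' x) (at x)"
    and E: "\<And>w. w > 0 \<Longrightarrow> (E has_real_derivative E' w) (at w)"
    and v'_bound: "\<And>x. x > 0 \<Longrightarrow> \<bar>v' x\<bar> \<le> Cv * x"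
  shows "dual_pair c d K \<kappa> (\<lambda>t. t ^ Suc k * exp (- t)) (\<lambda>x. real k * v x - x * v' x) (\<lambda>w. real k * E w - w * E' w)"
proof -
  define u' where "u' t = (real k * t ^ (k - 1) - t ^ k) * exp (- t)" for t :: real
  have tu: "t * u' t = real k * (t ^ k * exp (- t)) - t ^ Suc k * exp (- t)" for t
    by (cases k) (simp_all add: u'_def algebra_simps)
  have u: "((\<lambda>t. t ^ k * exp (- t)) has_real_derivative u' t) (at t)" for t
    unfolding u'_def by (auto intro!: derivative_eq_intros simp: algebra_simps)
  have u': "\<bar>t\<^sup>2 * u' t\<bar> \<le> real k * fact (Suc k) + fact (Suc (Suc k))" if "t > 0" for t
  proof -
    have "t\<^sup>2 * u' t = real k * (t ^ Suc k * exp (- t)) - t ^ Suc (Suc k) * exp (- t)"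
      using arg_cong[OF tu[of t], of "\<lambda>y. t * y"] by (simp add: power2_eq_square right_diff_distrib mult_ac)
    moreover have "0 \<le> real k * (t ^ Suc k * exp (- t))" "0 \<le> t ^ Suc (Suc k) * exp (- t)"
      using that by simp_all
    moreover have "real k * (t ^ Suc k * exp (- t)) \<le> real k * fact (Suc k)"
      by (intro mult_left_mono power_le_fact_exp) (use that in auto)
    moreover have "t ^ Suc (Suc k) * exp (- t) \<le> fact (Suc (Suc k))"
      by (rule power_le_fact_exp) (use that in auto)
    moreover have "0 \<le> real k * fact (Suc k)" "(0::real) \<le> fact (Suc (Suc k))" by (simp_all del: fact_Suc)
    ultimately show ?thesis by linarith
  qed
  have step: "dual_pair c d K \<kappa> (\<lambda>t. t * u' t) (\<lambda>x. x * v' x) (\<lambda>w. w * E' w)"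
    by (rule dual_pair_euler_step[OF pair cd \<kappa> u v E u' v'_bound])
  show ?thesis
    by (rule dual_pair_cong[OF dual_pair_linear[OF pair step, of "real k" "- 1"] \<kappa>]) (simp_all add: tu)
qed

text \<open>\<open>- poly (dual_poly k)\<close> at \<open>\<sigma> = x^2 / (1 + x^2)\<close> is the
  dual weight of \<open>t ^ Suc k * exp (- t)\<close>. The recursion is the step above rewritten in
  \<open>\<sigma>\<close>, with \<open>x * d\<sigma>/dx = 2 * \<sigma> * (1 - \<sigma>)\<close>; the
  start comes from differentiating \<open>ln (1 + x^2)\<close>.\<close>

fun dual_poly :: "nat \<Rightarrow> real poly" where
  "dual_poly 0 = [:0, 2:]"
| "dual_poly (Suc k) = Polynomial.smult (real (Suc k)) (dual_poly k) - [:0, 2, -2:] * pderiv (dual_poly k)"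

text \<open>In the main term the first derivative removes \<open>e\<close> and turns the logarithm
  into the constant \<open>a\<close>, which later steps multiply up to \<open>fact k * a\<close>.
  The operator \<open>w d/dw\<close> fixes \<open>b * w\<close>, so the linear term cancels in the
  step from \<open>k = 0\<close> to \<open>k = 1\<close> and is absent from then on.\<close>

lemma dual_pair_gamma:
  assumes pair: "dual_pair c d K \<kappa> (\<lambda>t. exp (- t)) (\<lambda>x. ln (1 + x\<^sup>2)) (\<lambda>w. e - a * ln w + b * w)"
    and cd: "\<And>n. \<bar>c n\<bar> \<le> 1" "\<And>m. \<bar>d m\<bar> \<le> 1" and \<kappa>: "\<kappa> > 0"
  shows "dual_pair c d K \<kappa> (\<lambda>t. t ^ Suc k * exp (- t)) (\<lambda>x. - poly (dual_poly k) (x\<^sup>2 / (1 + x\<^sup>2)))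
           (\<lambda>w. fact k * a - (if k = 0 then b else 0) * w)"
proof (induction k)
  case 0
  have p: "dual_pair c d K \<kappa> (\<lambda>t. t ^ 0 * exp (- t)) (\<lambda>x. ln (1 + x\<^sup>2)) (\<lambda>w. e - a * ln w + b * w)"
    using pair by simp
  have "dual_pair c d K \<kappa> (\<lambda>t. t ^ Suc 0 * exp (- t)) (\<lambda>x. real 0 * ln (1 + x\<^sup>2) - x * (2 * x / (1 + x\<^sup>2)))
     (\<lambda>w. real 0 * (e - a * ln w + b * w) - w * (- a / w + b))"
  proof (rule dual_pair_gamma_step[OF p cd \<kappa>, where Cv = 2])
    fix x :: real assume x: "x > 0"
    have q: "1 + x\<^sup>2 > 0" "1 \<le> 1 + x\<^sup>2" using zero_le_power2[of x] by linarith+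
    have "((\<lambda>x. 1 + x\<^sup>2) has_real_derivative 2 * x) (at x)" by (auto intro!: derivative_eq_intros)
    from DERIV_chain2[OF DERIV_ln[OF q(1)] this]
    show "((\<lambda>x. ln (1 + x\<^sup>2)) has_real_derivative 2 * x / (1 + x\<^sup>2)) (at x)"
      by (simp add: inverse_eq_divide)
    have "2 * x / (1 + x\<^sup>2) \<le> 2 * x"
      by (rule mult_imp_div_pos_le[OF q(1)]) (use mult_left_mono[OF q(2), of "2 * x"] x in linarith)
    moreover have "0 \<le> 2 * x / (1 + x\<^sup>2)" using x by (intro divide_nonneg_pos q(1)) simp
    ultimately show "\<bar>2 * x / (1 + x\<^sup>2)\<bar> \<le> 2 * x" by linarith
  next
    fix w :: real assume "w > 0"
    then show "((\<lambda>w. e - a * ln w + b * w) has_real_derivative - a / w + b) (at w)"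
      by (auto intro!: derivative_eq_intros)
  qed
  then show ?case
    by (rule dual_pair_cong[OF _ \<kappa>]) (simp_all add: power2_eq_square field_simps)
next
  case (Suc k)
  define P where "P = dual_poly k"
  define \<sigma> where "\<sigma> x = x\<^sup>2 / (1 + x\<^sup>2)" for x :: real
  define \<sigma>' where "\<sigma>' x = 2 * x / (1 + x\<^sup>2)\<^sup>2" for x :: real
  \<comment> \<open>The majorant must hold for all \<open>x > 0\<close>; it does because
    \<open>\<sigma> x\<close> stays in the compact interval \<open>{0..1}\<close>.\<close>
  obtain C where C: "\<bar>poly (pderiv P) y\<bar> \<le> C" if "y \<in> {0..1}" for y
  proof -
    have "bounded (poly (pderiv P) ` {0..1})"
      by (intro compact_imp_bounded compact_continuous_image continuous_intros) auto
    then obtain C where "\<forall>z\<in>poly (pderiv P) ` {0..1}. norm z \<le> C" unfolding bounded_iff by auto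
    then show ?thesis by (intro that[of C]) auto
  qed
  have C0: "0 \<le> C" using C[of 0] by simp
  have "dual_pair c d K \<kappa> (\<lambda>t. t ^ Suc (Suc k) * exp (- t))
     (\<lambda>x. real (Suc k) * (- poly P (\<sigma> x)) - x * (- (poly (pderiv P) (\<sigma> x) * \<sigma>' x)))
     (\<lambda>w. real (Suc k) * (fact k * a - (if k = 0 then b else 0) * w) - w * (- (if k = 0 then b else 0)))"
  proof (rule dual_pair_gamma_step[OF Suc.IH[folded P_def \<sigma>_def] cd \<kappa>, where Cv = "2 * C"])
    fix x :: real assume x: "x > 0"
    have q: "1 + x\<^sup>2 > 0" "1 \<le> 1 + x\<^sup>2" using zero_le_power2[of x] by linarith+
    have d\<sigma>: "(\<sigma> has_real_derivative \<sigma>' x) (at x)"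
      unfolding \<sigma>_def [abs_def] \<sigma>'_def using q by (auto intro!: derivative_eq_intros simp: power2_eq_square algebra_simps)
    show "((\<lambda>x. - poly P (\<sigma> x)) has_real_derivative - (poly (pderiv P) (\<sigma> x) * \<sigma>' x)) (at x)"
      by (rule DERIV_minus[OF DERIV_chain2[OF poly_DERIV d\<sigma>]])
    have "1 \<le> (1 + x\<^sup>2)\<^sup>2" using q(2) by (rule one_le_power)
    then have "\<sigma>' x \<le> 2 * x" unfolding \<sigma>'_def
      by (intro mult_imp_div_pos_le) (use mult_left_mono[of 1 "(1 + x\<^sup>2)\<^sup>2" "2 * x"] x in linarith)+
    moreover have "0 \<le> \<sigma>' x" unfolding \<sigma>'_def using x by simp
    ultimately have "\<bar>\<sigma>' x\<bar> \<le> 2 * x" by linarith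
    moreover have "0 \<le> \<sigma> x" unfolding \<sigma>_def by (intro divide_nonneg_pos q(1)) simp
    moreover have "\<sigma> x \<le> 1" unfolding \<sigma>_def by (rule mult_imp_div_pos_le[OF q(1)]) simp
    ultimately have "\<bar>poly (pderiv P) (\<sigma> x)\<bar> * \<bar>\<sigma>' x\<bar> \<le> C * (2 * x)" using C0 C by (intro mult_mono) auto
    then show "\<bar>- (poly (pderiv P) (\<sigma> x) * \<sigma>' x)\<bar> \<le> 2 * C * x" by (simp add: abs_mult)
  next
    fix w :: real
    show "((\<lambda>w. fact k * a - (if k = 0 then b else 0) * w) has_real_derivative - (if k = 0 then b else 0)) (at w)"
      by (auto intro!: derivative_eq_intros)
  qed
  then show ?case
  proof (rule dual_pair_cong[OF _ \<kappa>])
    fix x :: real assume "x > 0"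
    have q: "1 + x\<^sup>2 \<noteq> 0" by (metis add_pos_nonneg less_irrefl zero_le_power2 zero_less_one)
    then have "x * \<sigma>' x = 2 * \<sigma> x - 2 * (\<sigma> x * \<sigma> x)"
      unfolding \<sigma>_def \<sigma>'_def by (simp add: divide_simps) (simp add: algebra_simps eval_nat_numeral)
    from arg_cong[OF this, of "\<lambda>y. poly (pderiv P) (\<sigma> x) * y"]
    have "x * (poly (pderiv P) (\<sigma> x) * \<sigma>' x) = poly ([:0, 2, -2:] * pderiv P) (\<sigma> x)"
      by (simp add: algebra_simps)
    then show "real (Suc k) * (- poly P (\<sigma> x)) - x * (- (poly (pderiv P) (\<sigma> x) * \<sigma>' x)) = - poly (dual_poly (Suc k)) (x\<^sup>2 / (1 + x\<^sup>2))"
      by (simp add: P_def \<sigma>_def algebra_simps)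
  qed (simp_all add: algebra_simps)
qed

text \<open>The coefficients were found by numerical optimisation; \<open>tail_poly\<close> is the corresponding
  combination of the polynomials \<open>dual_poly\<close>, and \<open>1.94222\<close> below is the sum of the coefficients at \<open>t^k\<close> times
  \<open>fact (k - 1)\<close>.\<close>

definition smooth_fun :: "real \<Rightarrow> real" where
  "smooth_fun t = (1 + 0.9035 * t + 0.4038 * t ^ 2 + 0.1194 * t ^ 3 + 0.0239 * t ^ 4 + 0.00573 * t ^ 5 + 0.00016 * t ^ 7) * exp (- t)"

lemma smooth_fun_nonneg: "0 \<le> t \<Longrightarrow> 0 \<le> smooth_fun t"
  by (simp add: smooth_fun_def)

lemma dual_poly_values:
  "poly (dual_poly 0) s = 2 * s"
  "poly (dual_poly 1) s = 2 * (- s + 2 * s ^ 2)"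
  "poly (dual_poly 2) s = 4 * (- 3 * s ^ 2 + 4 * s ^ 3)"
  "poly (dual_poly 3) s = 12 * (s ^ 2 - 8 * s ^ 3 + 8 * s ^ 4)"
  "poly (dual_poly 4) s = 48 * (5 * s ^ 3 - 20 * s ^ 4 + 16 * s ^ 5)"
  "poly (dual_poly 6) s = 1440 * (- 7 * s ^ 4 + 56 * s ^ 5 - 112 * s ^ 6 + 64 * s ^ 7)"
  by (simp_all add: eval_nat_numeral pderiv_pCons algebra_simps)

text \<open>Among the added pairs only the one for \<open>t * exp (- t)\<close> has a linear main
  term, so \<open>b * w\<close> keeps the factor \<open>1 - 0.9035 = 0.0965\<close>. Making this
  factor small is the purpose of the polynomial.\<close>

lemma dual_pair_smooth:
  assumes pair: "dual_pair c d K \<kappa> (\<lambda>t. exp (- t)) (\<lambda>x. ln (1 + x\<^sup>2)) (\<lambda>w. e - a * ln w + b * w)"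
    and cd: "\<And>n. \<bar>c n\<bar> \<le> 1" "\<And>m. \<bar>d m\<bar> \<le> 1" and \<kappa>: "\<kappa> > 0"
  shows "dual_pair c d K \<kappa> smooth_fun (\<lambda>x. dual_fun (1 / x)) (\<lambda>w. e + a * (1.94222 - ln w) + 0.0965 * b * w)"
proof -
  note p = dual_pair_gamma[OF pair cd \<kappa>]
  note l = dual_pair_linear[OF dual_pair_linear[OF dual_pair_linear[OF dual_pair_linear[OF dual_pair_linear[OF dual_pair_linear[OF pair
    p[of 0], of 1 "0.9035"] p[of 1], of 1 "0.4038"] p[of 2], of 1 "0.1194"] p[of 3], of 1 "0.0239"] p[of 4], of 1 "0.00573"] p[of 6], of 1 "0.00016"]
  show ?thesis
  proof (rule dual_pair_cong[OF l \<kappa>], unfold dual_poly_values, goal_cases)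
    case (1 t)
    show ?case by (simp add: smooth_fun_def algebra_simps power2_eq_square)
  next
    case (2 x)
    define s where "s = x\<^sup>2 / (1 + x\<^sup>2)"
    have s: "1 / (1 + (1 / x)\<^sup>2) = s"
      using 2 by (simp add: s_def field_simps add_pos_pos)
    have "1 / (1 / x)\<^sup>2 = x\<^sup>2" by (simp add: power_divide)
    then show ?case
      unfolding dual_fun_eq[OF divide_pos_pos[OF zero_less_one 2]] s tail_poly_def s_def [symmetric]
      by (simp add: field_simps)
  next
    case (3 w)
    then show ?case by (simp add: field_simps fact_numeral)
  qed
qed

text \<open>Euler's product for the sine at an imaginary point, that is, for
  \<open>sinh (w / 2) / (w / 2)\<close>. Writing \<open>sinh (w / 2)\<close> as
  \<open>exp (w / 2) * (1 - exp (- w)) / 2\<close> displays the terms \<open>w / 2\<close> and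
  \<open>- ln w\<close> that become the main term of the trivial character.\<close>

lemma sums_ln_sinh:
  fixes w :: real
  assumes "w > 0"
  shows "(\<lambda>m. ln (1 + (w / (2 * pi * real (Suc m)))\<^sup>2)) sums (ln (1 - exp (- w)) + w / 2 - ln w)"
proof -
  define z where "z = \<i> * of_real (w / (2 * pi))"
  have z2: "z\<^sup>2 = - of_real ((w / (2 * pi))\<^sup>2)" unfolding z_def power_mult_distrib by simp
  have piz: "of_real pi * z = \<i> * of_real (w / 2)" by (simp add: z_def)
  have sin: "sin (\<i> * of_real y) = \<i> * of_real (sinh y)" for y :: real
    by (simp add: sin_i_times sinh_field_def exp_of_real [symmetric] exp_minus)
  define P where "P n = (\<Prod>k<n. 1 + (w / (2 * pi * real (Suc k)))\<^sup>2)" for n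
  have f: "of_real pi * z * (\<Prod>k=1..n. 1 - z\<^sup>2 / of_nat k ^ 2) = \<i> * of_real (w / 2 * P n)" for n
  proof -
    have "(\<Prod>k=1..n. 1 - z\<^sup>2 / of_nat k ^ 2) = (\<Prod>k<n. 1 - z\<^sup>2 / of_nat (Suc k) ^ 2)"
      by (rule prod.reindex_bij_witness[of _ Suc "\<lambda>k. k - 1"]) auto
    also have "\<dots> = of_real (P n)" unfolding P_def of_real_prod z2
      by (intro prod.cong refl) (simp add: power_divide power_mult_distrib del: of_nat_Suc)
    finally show ?thesis unfolding piz by (simp only: of_real_mult mult.assoc)
  qed
  have "(\<lambda>n. \<i> * of_real (w / 2 * P n)) \<longlonglongrightarrow> \<i> * of_real (sinh (w / 2))"
    using sin_product_formula_complex[of z] unfolding f unfolding piz sin .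
  then have "(\<lambda>n. Im (\<i> * of_real (w / 2 * P n))) \<longlonglongrightarrow> Im (\<i> * of_real (sinh (w / 2)))"
    by (rule tendsto_Im)
  then have "(\<lambda>n. w / 2 * P n) \<longlonglongrightarrow> sinh (w / 2)" by simp
  then have "(\<lambda>n. ln (w / 2 * P n)) \<longlonglongrightarrow> ln (sinh (w / 2))"
    by (rule tendsto_ln) (use assms in \<open>simp add: sinh_real_zero_iff\<close>)
  then have "(\<lambda>n. ln (w / 2 * P n) - ln (w / 2)) \<longlonglongrightarrow> ln (sinh (w / 2)) - ln (w / 2)"
    by (rule tendsto_diff[OF _ tendsto_const])
  moreover have "ln (w / 2 * P n) - ln (w / 2) = (\<Sum>k<n. ln (1 + (w / (2 * pi * real (Suc k)))\<^sup>2))" for n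
  proof -
    have pos: "0 < 1 + (w / (2 * pi * real (Suc k)))\<^sup>2" for k
      using zero_le_power2[of "w / (2 * pi * real (Suc k))"] by linarith
    then have "0 < P n" unfolding P_def by (intro prod_pos) blast
    then have "ln (w / 2 * P n) - ln (w / 2) = ln (P n)" using assms ln_mult_pos[of "w / 2" "P n"] by simp
    also have "\<dots> = (\<Sum>k<n. ln (1 + (w / (2 * pi * real (Suc k)))\<^sup>2))"
      unfolding P_def by (rule ln_prod[OF finite_lessThan]) (metis pos less_irrefl)
    finally show ?thesis .
  qed
  moreover have "ln (sinh (w / 2)) - ln (w / 2) = ln (1 - exp (- w)) + w / 2 - ln w"
  proof -
    have e: "1 - exp (- w) > 0" using assms by simp
    have "sinh (w / 2) = exp (w / 2) * ((1 - exp (- w)) / 2)"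
      by (simp add: sinh_field_def right_diff_distrib exp_add [symmetric] mult_exp_exp)
    then have "ln (sinh (w / 2)) = ln (exp (w / 2)) + ln ((1 - exp (- w)) / 2)"
      using e by (simp only: ln_mult_pos exp_gt_zero half_gt_zero)
    then have "ln (sinh (w / 2)) = w / 2 + ln (1 - exp (- w)) - ln 2" using e by (simp add: ln_div)
    then show ?thesis using assms by (simp add: ln_div)
  qed
  ultimately show ?thesis unfolding sums_def by simp
qed

text \<open>The cosine series at angle 0, where \<open>2 * exp (- w) * (cosh w - 1)\<close> is the
  square of \<open>1 - exp (- w)\<close>.\<close>

lemma sums_ln_one_minus_exp:
  fixes w :: real
  assumes "w > 0"
  shows "(\<lambda>n. exp (- (w * real (Suc n))) / real (Suc n)) sums (- ln (1 - exp (- w)))"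
proof -
  have "cosh w \<noteq> 1" using assms by simp
  then have "cosh w - 1 > 0" using cosh_real_ge_1[of w] by linarith
  moreover have e: "1 - exp (- w) > 0" using assms by simp
  moreover have "2 * exp (- w) * (cosh w - 1) = (1 - exp (- w))\<^sup>2"
    by (simp add: cosh_field_def power2_eq_square algebra_simps exp_add [symmetric] mult_exp_exp)
  moreover have "ln (2 * exp (- w) * (cosh w - 1)) = ln (2 * exp (- w)) + ln (cosh w - 1)"
    using calculation(1) by (intro ln_mult_pos) auto
  moreover have "ln ((1 - exp (- w))\<^sup>2) = 2 * ln (1 - exp (- w))" using e by (simp add: ln_realpow)
  ultimately have "ln (2 * exp (- w)) + ln (cosh w - 1) = 2 * ln (1 - exp (- w))" by simp
  then show ?thesis using sums_cos_geometric_log[OF assms, of 0] by simp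
qed

text \<open>Both series are known in closed form, and their terms \<open>ln (1 - exp (- w))\<close>
  cancel.\<close>

lemma dual_pair_trivial:
  "dual_pair (\<lambda>_. 1) (\<lambda>_. 1) 1 (2 * pi) (\<lambda>t. exp (- t)) (\<lambda>x. ln (1 + x\<^sup>2)) (\<lambda>w. 0 - 1 * ln w + 1 / 2 * w)"
  unfolding dual_pair_def
proof (intro allI impI conjI)
  fix w :: real assume w: "w > 0"
  note s = sums_ln_one_minus_exp[OF w] sums_ln_sinh[OF w]
  show "summable (\<lambda>n. 1 * exp (- (w * real (Suc n))) / real (Suc n))"
    "summable (\<lambda>m. 1 * ln (1 + (w / (2 * pi * real (Suc m)))\<^sup>2))"
    using s by (simp_all only: mult_1 sums_summable)
  show "(\<Sum>n. 1 * exp (- (w * real (Suc n))) / real (Suc n)) + 1 * (\<Sum>m. 1 * ln (1 + (w / (2 * pi * real (Suc m)))\<^sup>2)) = 0 - 1 * ln w + 1 / 2 * w"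
    using s[THEN sums_unique, symmetric] by (simp only: mult_1)
qed

lemma Re_complex_of_real_mult: "Re (of_real r * z) = r * Re z"
  by simp

text \<open>\<open>dual_pair\<close> has real coefficients, so the complex duality is rotated by
  \<open>\<omega>\<close> and real parts are taken. Splitting \<open>1 / t\<close> into
  \<open>1 / sqrt q\<close> and \<open>sqrt q / t\<close>, a number of modulus 1, puts the size into
  \<open>K\<close>; for \<open>norm \<omega> = 1\<close> both coefficient sequences are then bounded
  by 1. The right-hand side has neither a logarithm nor a linear term.\<close>

lemma dual_pair_even_primitive:
  fixes \<omega> :: complex
  assumes prim: "primitive_dirichlet_character q chi" and q: "q > 1" and even: "chi (-1) = 1"
  defines "t \<equiv> (\<Sum>a\<in>{0..<int q}. cnj (chi a) * cis (2 * pi * of_int a / q))"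
  shows "dual_pair (\<lambda>n. Re (\<omega> * chi (int (Suc n)))) (\<lambda>m. Re (\<omega> * (of_real (sqrt q) / t) * cnj (chi (int (Suc m)))))
           (1 / sqrt q) (2 * pi / q) (\<lambda>t. exp (- t)) (\<lambda>x. ln (1 + x\<^sup>2)) (\<lambda>w. Re (\<omega> * Dirichlet_L chi 1) - 0 * ln w + 0 * w)"
  unfolding dual_pair_def
proof (intro allI impI conjI)
  fix w :: real assume w: "w > 0"
  have dc: "dirichlet_character q chi" using prim by (simp add: primitive_dirichlet_character_def)
  note le1 = dirichlet_character_norm_le[OF dc]
  have t0: "t \<noteq> 0" using norm_gauss_sum[OF prim] q unfolding t_def by auto
  define A where "A n = chi (int (Suc n)) * of_real (exp (- w * real (Suc n)) / real (Suc n))" for n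
  define B where "B m = cnj (chi (int (Suc m))) * of_real (ln (1 + (w * q / (2 * pi * real (Suc m)))\<^sup>2))" for m
  have dual: "t * (Dirichlet_L chi 1 - suminf A) = suminf B"
    using even_primitive_log_duality[OF prim q even w] unfolding t_def A_def B_def .
  have sA: "summable A"
  proof (rule summable_comparison_test'[OF sums_summable[OF sums_ln_one_minus_exp[OF w]]])
    fix n
    have "norm (A n) = norm (chi (int (Suc n))) * (exp (- w * real (Suc n)) / real (Suc n))"
      unfolding A_def norm_mult norm_of_real by simp
    also have "\<dots> \<le> 1 * (exp (- w * real (Suc n)) / real (Suc n))" by (intro mult_right_mono le1) auto
    finally show "norm (A n) \<le> exp (- (w * real (Suc n))) / real (Suc n)" by simp
  qed
  have sB: "summable B"
  proof (rule summable_comparison_test'[OF summable_inverse_squares_Suc[of "(w * q / (2 * pi))\<^sup>2"]])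
    fix n
    define y where "y = (w * q / (2 * pi * real (Suc n)))\<^sup>2"
    have y: "0 \<le> y" "y = (w * q / (2 * pi))\<^sup>2 / (real (Suc n))\<^sup>2" by (simp_all add: y_def power_divide power_mult_distrib del: of_nat_Suc)
    have "norm (B n) = norm (chi (int (Suc n))) * ln (1 + y)"
      unfolding B_def y_def [symmetric] norm_mult norm_of_real using y(1) by simp
    also have "\<dots> \<le> 1 * y" by (intro mult_mono le1 ln_one_plus_le y) (use y in auto)
    finally show "norm (B n) \<le> (w * q / (2 * pi))\<^sup>2 / (real (Suc n))\<^sup>2" using y(2) by simp
  qed
  define s where "s = complex_of_real (sqrt q) / t"
  have K: "1 / sqrt q * Re (\<omega> * s * y) = Re (\<omega> * (y / t))" for y
  proof -
    have "\<omega> * s * y = of_real (sqrt q) * (\<omega> * (y / t))" by (simp add: s_def)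
    then have "Re (\<omega> * s * y) = sqrt q * Re (\<omega> * (y / t))" by (simp only: Re_complex_of_real_mult)
    then show ?thesis using q by simp
  qed
  have eA: "(\<lambda>n. Re (\<omega> * chi (int (Suc n))) * exp (- (w * real (Suc n))) / real (Suc n)) = (\<lambda>n. Re (\<omega> * A n))"
  proof
    fix n
    have "\<omega> * A n = of_real (exp (- w * real (Suc n)) / real (Suc n)) * (\<omega> * chi (int (Suc n)))"
      by (simp add: A_def del: of_nat_Suc)
    then show "Re (\<omega> * chi (int (Suc n))) * exp (- (w * real (Suc n))) / real (Suc n) = Re (\<omega> * A n)"
      by (simp only: Re_complex_of_real_mult) simp
  qed
  have eB: "(\<lambda>m. Re (\<omega> * s * cnj (chi (int (Suc m)))) * ln (1 + (w / (2 * pi / q * real (Suc m)))\<^sup>2)) = (\<lambda>m. Re (\<omega> * s * B m))"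
  proof
    fix m
    have "\<omega> * s * B m = of_real (ln (1 + (w * q / (2 * pi * real (Suc m)))\<^sup>2)) * (\<omega> * s * cnj (chi (int (Suc m))))"
      by (simp add: B_def del: of_nat_Suc)
    moreover have "w / (2 * pi / q * real (Suc m)) = w * q / (2 * pi * real (Suc m))" using q by (simp add: field_simps)
    ultimately show "Re (\<omega> * s * cnj (chi (int (Suc m)))) * ln (1 + (w / (2 * pi / q * real (Suc m)))\<^sup>2) = Re (\<omega> * s * B m)"
      by (simp only: Re_complex_of_real_mult mult.commute[of "Re (\<omega> * s * cnj (chi (int (Suc m))))"])
  qed
  have sA': "summable (\<lambda>n. \<omega> * A n)" and sB': "summable (\<lambda>n. \<omega> * s * B n)" by (intro summable_mult sA sB)+
  note re = bounded_linear.summable[OF bounded_linear_Re] bounded_linear.suminf[OF bounded_linear_Re, symmetric]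
  show "summable (\<lambda>n. Re (\<omega> * chi (int (Suc n))) * exp (- (w * real (Suc n))) / real (Suc n))" unfolding eA by (rule re(1)[OF sA'])
  show "summable (\<lambda>m. Re (\<omega> * (of_real (sqrt q) / t) * cnj (chi (int (Suc m)))) * ln (1 + (w / (2 * pi / q * real (Suc m)))\<^sup>2))"
    unfolding s_def [symmetric] eB by (rule re(1)[OF sB'])
  have "(\<Sum>n. Re (\<omega> * A n)) + 1 / sqrt q * (\<Sum>m. Re (\<omega> * s * B m)) = Re (\<omega> * suminf A) + Re (\<omega> * (suminf B / t))"
    unfolding re(2)[OF sA'] re(2)[OF sB'] suminf_mult[OF sA] suminf_mult[OF sB] K ..
  also have "\<dots> = Re (\<omega> * Dirichlet_L chi 1)"
  proof -
    have "suminf B / t = Dirichlet_L chi 1 - suminf A" using dual t0 by (metis nonzero_mult_div_cancel_left)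
    then show ?thesis by (simp only: plus_complex.sel(1) [symmetric] distrib_left [symmetric]) simp
  qed
  finally show "(\<Sum>n. Re (\<omega> * chi (int (Suc n))) * exp (- (w * real (Suc n))) / real (Suc n)) +
     1 / sqrt q * (\<Sum>m. Re (\<omega> * (of_real (sqrt q) / t) * cnj (chi (int (Suc m)))) * ln (1 + (w / (2 * pi / q * real (Suc m)))\<^sup>2)) =
     Re (\<omega> * Dirichlet_L chi 1) - 0 * ln w + 0 * w"
    unfolding s_def [symmetric] eA eB by simp
qed

section \<open>The bound\<close>

lemma modulus_ge_11:
  assumes prim: "primitive_dirichlet_character q chi" and q1: "q > 1" and even: "chi (-1) = 1" and chi2: "chi 2 = 1"
  shows "11 \<le> q"
proof (rule ccontr)
  assume "\<not> 11 \<le> q"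
  then have small: "q \<le> 10" by simp
  have dc: "dirichlet_character q chi" using prim by (simp add: primitive_dirichlet_character_def)
  have mult: "\<And>a b. chi (a * b) = chi a * chi b"
    using dc by (simp add: dirichlet_character_def)
  have "coprime 2 (int q)"
    using dc chi2 unfolding dirichlet_character_def by (metis zero_neq_one)
  then have "odd q" by simp
  then have "q \<in> {3, 5, 7, 9}" using small q1 by (simp, presburger)
  obtain b where b: "coprime b (int q)" "chi b \<noteq> 1"
    using primitive_dirichlet_character_nonprincipal[OF prim q1] .
  have nd: "\<not> p dvd b" if "p dvd int q" "p > 1" for p
    using coprime_common_divisor[OF b(1) _ that(1)] that(2) by auto
  have "\<exists>e\<in>{1, -1, 2, -2, 4, -4}. [b = e] (mod int q)"
    using \<open>q \<in> {3, 5, 7, 9}\<close>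
  proof (elim insertE emptyE)
    assume q: "q = 3"
    have "\<not> 3 dvd b" using nd[of 3] q by simp
    then have "b mod 3 = 1 \<or> b mod 3 = 2" by presburger
    then show ?thesis unfolding cong_def q by auto
  next
    assume q: "q = 5"
    have "\<not> 5 dvd b" using nd[of 5] q by simp
    then have "b mod 5 = 1 \<or> b mod 5 = 2 \<or> b mod 5 = 3 \<or> b mod 5 = 4" by presburger
    then show ?thesis unfolding cong_def q by auto
  next
    assume q: "q = 7"
    have "\<not> 7 dvd b" using nd[of 7] q by simp
    then have "b mod 7 = 1 \<or> b mod 7 = 2 \<or> b mod 7 = 3 \<or> b mod 7 = 4 \<or> b mod 7 = 5 \<or> b mod 7 = 6" by presburger
    then show ?thesis unfolding cong_def q by auto
  next
    assume q: "q = 9"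
    have "\<not> 3 dvd b" using nd[of 3] q by simp
    then have "b mod 9 = 1 \<or> b mod 9 = 2 \<or> b mod 9 = 4 \<or> b mod 9 = 5 \<or> b mod 9 = 7 \<or> b mod 9 = 8" by presburger
    then show ?thesis unfolding cong_def q by auto
  qed
  moreover have "chi e = 1" if "e \<in> {1, -1, 2, -2, 4, -4}" for e
    using that mult[of "-1" 2] mult[of 2 2] mult[of "-1" 4] even chi2 dirichlet_character_1[OF dc] by auto
  ultimately show False using b(2) dirichlet_character_cong[OF dc] by metis
qed

lemma sums_smooth_trivial:
  assumes "w > 0"
  shows "summable (\<lambda>n. smooth_fun (w * real (Suc n)) / real (Suc n))"
    and "summable (\<lambda>m. dual_fun (2 * pi * real (Suc m) / w))"
    and "(\<Sum>n. smooth_fun (w * real (Suc n)) / real (Suc n)) + (\<Sum>m. dual_fun (2 * pi * real (Suc m) / w)) =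
      1.94222 - ln w + 0.04825 * w"
proof -
  have "dual_pair (\<lambda>_. 1) (\<lambda>_. 1) 1 (2 * pi) smooth_fun (\<lambda>x. dual_fun (1 / x)) (\<lambda>w. 0 + 1 * (1.94222 - ln w) + 0.0965 * (1 / 2) * w)"
    by (rule dual_pair_smooth[OF dual_pair_trivial]) simp_all
  then show "summable (\<lambda>n. smooth_fun (w * real (Suc n)) / real (Suc n))"
    "summable (\<lambda>m. dual_fun (2 * pi * real (Suc m) / w))"
    "(\<Sum>n. smooth_fun (w * real (Suc n)) / real (Suc n)) + (\<Sum>m. dual_fun (2 * pi * real (Suc m) / w)) =
      1.94222 - ln w + 0.04825 * w"
    using assms by (simp_all add: dual_pair_def del: of_nat_Suc)
qed

text \<open>The losses of the dyadic sums are bounded by a midpoint sum of \<open>bump\<close> over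
  the odd multiples of \<open>\<delta>\<close>. The integral is at most \<open>0.021\<close>; the
  corrections come from the Lipschitz constant 4 and the length \<open>2 / 5\<close> of
  \<open>{1/5..3/5}\<close>, whence \<open>0.8 = 4 * (2 / 5) / 2\<close>. The factor
  \<open>2 * \<delta>\<close> makes the sum comparable to that integral.\<close>

lemma dual_fun_dyadic_weighted_sum_le:
  fixes c :: "nat \<Rightarrow> real"
  assumes c: "\<And>m. \<bar>c m\<bar> \<le> 1" "\<And>m. c (2 * m) = c m" and \<delta>: "\<delta> > 0"
  shows "2 * \<delta> * \<bar>\<Sum>m. c (Suc m) * dual_fun (real (Suc m) * \<delta>)\<bar> \<le>
    2 * \<delta> * (\<Sum>m. dual_fun (real (Suc m) * \<delta>)) + 2 * (0.021 + 0.8 * \<delta> + 4 * \<delta>\<^sup>2)"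
proof -
  define B where "B i = bump (real (2 * i + 1) * \<delta>)" for i :: nat
  have sB: "summable B" unfolding B_def
    by (rule odd_midpoint_sum_le(1)[where M = 4 and l = "1 / 5" and r = "3 / 5"])
      (use bump_nonneg bump_lipschitz bump_outside \<delta> in auto)
  have B: "2 * \<delta> * suminf B \<le> integral {1 / 5..3 / 5} bump + 4 * \<delta> * (3 / 5 - 1 / 5) / 2 + 4 * \<delta>\<^sup>2"
    unfolding B_def
    by (rule odd_midpoint_sum_le(2)) (use bump_nonneg bump_lipschitz bump_outside \<delta> in auto)
  have "summable (\<lambda>m. \<bar>dual_fun (real (Suc m) * \<delta>)\<bar>)"
  proof (rule summable_comparison_test'[where N = "nat \<lceil>1 / \<delta>\<rceil>"])
    show "summable (\<lambda>m. 100 / \<delta>\<^sup>2 / (real (Suc m))\<^sup>2)" by (rule summable_inverse_squares_Suc)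
    fix m assume "nat \<lceil>1 / \<delta>\<rceil> \<le> m"
    then have "1 / \<delta> \<le> real (Suc m)" by linarith
    then have "1 \<le> real (Suc m) * \<delta>" using \<delta> by (simp add: pos_divide_le_eq)
    from dual_fun_bigo[OF this] show "norm \<bar>dual_fun (real (Suc m) * \<delta>)\<bar> \<le> 100 / \<delta>\<^sup>2 / (real (Suc m))\<^sup>2"
      by (simp add: power_mult_distrib mult_ac del: of_nat_Suc)
  qed
  then have "\<bar>\<Sum>m. c (Suc m) * dual_fun (real (Suc m) * \<delta>)\<bar> \<le> (\<Sum>m. dual_fun (real (Suc m) * \<delta>)) + 2 * suminf B"
  proof (rule abs_dyadic_weighted_sum_le[of "\<lambda>m. dual_fun (real m * \<delta>)" c, OF _ c])
    fix i
    have "- B i \<le> dyadic_fun (real (2 * i + 1) * \<delta>)" unfolding B_def by (rule dyadic_fun_ge_bump) (use \<delta> in simp)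
    also have "\<dots> = (\<Sum>k. dual_fun (real (2 ^ k * (2 * i + 1)) * \<delta>))"
      unfolding dyadic_fun_def by (simp only: of_nat_mult of_nat_power of_nat_numeral mult.assoc)
    finally show "- B i \<le> (\<Sum>k. dual_fun (real (2 ^ k * (2 * i + 1)) * \<delta>))" .
  qed (use sB in \<open>simp_all add: B_def [abs_def] bump_nonneg\<close>)
  then have "2 * \<delta> * \<bar>\<Sum>m. c (Suc m) * dual_fun (real (Suc m) * \<delta>)\<bar> \<le> 2 * \<delta> * ((\<Sum>m. dual_fun (real (Suc m) * \<delta>)) + 2 * suminf B)"
    using \<delta> by (intro mult_left_mono) auto
  also have "\<dots> = 2 * \<delta> * (\<Sum>m. dual_fun (real (Suc m) * \<delta>)) + 2 * (2 * \<delta> * suminf B)" by (simp add: algebra_simps)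
  also have "2 * \<delta> * suminf B \<le> 0.021 + 0.8 * \<delta> + 4 * \<delta>\<^sup>2"
  proof -
    have "0.021 + 0.8 * \<delta> + 4 * \<delta>\<^sup>2 = 21 / 1000 + 4 * \<delta> * (3 / 5 - 1 / 5) / 2 + 4 * \<delta>\<^sup>2" by simp
    then show ?thesis using B integral_bump_le by linarith
  qed
  finally show ?thesis by simp
qed

text \<open>The identity for the trivial character at \<open>w = 2 * pi / \<delta>\<close>, with the
  nonnegative first sum dropped. For small \<open>\<delta>\<close> little is lost, as that sum is
  exponentially small in \<open>w\<close>.\<close>

lemma dual_fun_sum_le:
  assumes "\<delta> > 0"
  shows "(\<Sum>m. dual_fun (real (Suc m) * \<delta>)) \<le> 1.94222 - ln (2 * pi / \<delta>) + 0.04825 * (2 * pi / \<delta>)"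
proof -
  define w where "w = 2 * pi / \<delta>"
  have w: "w > 0" using assms by (simp add: w_def)
  have "2 * pi * real (Suc m) / w = real (Suc m) * \<delta>" for m using assms by (simp add: w_def del: of_nat_Suc)
  moreover have "0 \<le> (\<Sum>n. smooth_fun (w * real (Suc n)) / real (Suc n))"
    by (intro suminf_nonneg sums_smooth_trivial w divide_nonneg_nonneg smooth_fun_nonneg) (use w in auto)
  ultimately show ?thesis using sums_smooth_trivial(3)[OF w] unfolding w_def [symmetric] by simp
qed

text \<open>The same identity with the dual sum dropped. The bound on \<open>w\<close> puts all
  arguments \<open>2 * pi * m / w\<close> at or beyond \<open>3 / 5\<close>, where
  \<open>dual_fun\<close> is nonnegative.\<close>

lemma smooth_sum_le:
  assumes w: "0 < w" "w \<le> 10 / 3 * pi"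
  shows "(\<Sum>n. smooth_fun (w * real (Suc n)) / real (Suc n)) \<le> 1.94222 - ln w + 0.04825 * w"
proof -
  have "0 \<le> dual_fun (2 * pi * real (Suc m) / w)" for m
  proof (rule dual_fun_nonneg)
    have "2 * pi * 1 \<le> 2 * pi * real (Suc m)" by (intro mult_left_mono) auto
    then have "3 / 5 * w \<le> 2 * pi * real (Suc m)" using w(2) by linarith
    then show "3 / 5 \<le> 2 * pi * real (Suc m) / w" using w(1) by (simp add: pos_le_divide_eq del: of_nat_Suc)
  qed
  then have "0 \<le> (\<Sum>m. dual_fun (2 * pi * real (Suc m) / w))"
    by (intro suminf_nonneg sums_smooth_trivial w)
  then show ?thesis using sums_smooth_trivial(3)[OF w(1)] by linarith
qed

text \<open>In the dual sum the linear term \<open>0.04825 * (6 * pi / h)\<close> is multiplied by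
  \<open>h\<close>, which leaves \<open>0.2895 * pi\<close>. With \<open>l = ln q / 2\<close> and
  \<open>L = ln (6 * pi)\<close>, the left side becomes \<open>l\<close> plus a constant of about
  -0.0218 plus \<open>h\<close> times a bracket. The bracket decreases in \<open>q\<close> and is
  nonpositive from \<open>q = 11\<close> on, where \<open>l \<ge> 1.198\<close> and
  \<open>h \<le> 10 / 33\<close>.\<close>

lemma final_numerical_bound:
  assumes q: "(11 :: real) \<le> q"
  defines "h \<equiv> 1 / sqrt q"
  shows "(1.94222 - ln (6 * pi * h) + 0.04825 * (6 * pi * h)) + h * (1.94222 - ln (6 * pi / h) + 0.04825 * (6 * pi / h)) +
    3 * (0.021 + 0.8 * (h / 3) + 4 * (h / 3)\<^sup>2) \<le> 1 / 2 * ln q - 0.02012"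
proof -
  define L where "L = ln (6 * pi)"
  define l where "l = ln q / 2"
  have h: "h > 0" using q by (simp add: h_def)
  have "sqrt q \<ge> sqrt 11" using q by simp
  moreover have "sqrt 11 \<ge> (33 / 10 :: real)" by (rule real_le_rsqrt) (simp add: power2_eq_square)
  ultimately have "sqrt q \<ge> 33 / 10" by linarith
  then have "h \<le> 1 / (33 / 10)" unfolding h_def by (intro divide_left_mono) (use q in auto)
  then have h3: "h \<le> 10 / 33" by simp
  have "ln 11 \<le> ln q" using q by simp
  then have l: "1198 / 1000 \<le> l" using ln_11(1) unfolding l_def by linarith
  have "ln (18849 / 1000) \<le> L" unfolding L_def using pi_lower by simp
  then have L: "29363 / 10000 \<le> L" using ln_6pi(1) by linarith
  have lh: "ln h = - l" using q by (simp add: h_def l_def ln_div ln_sqrt)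
  have e: "ln (6 * pi * h) = L - l" "ln (6 * pi / h) = L + l"
    using h lh by (simp_all add: ln_mult_pos ln_div L_def)
  have "h * (1.94222 - (L + l) + 0.04825 * (6 * pi / h)) = h * (1.94222 - L - l) + 0.2895 * pi"
    using h by (simp add: algebra_simps)
  then have "(1.94222 - ln (6 * pi * h) + 0.04825 * (6 * pi * h)) + h * (1.94222 - ln (6 * pi / h) + 0.04825 * (6 * pi / h)) +
    3 * (0.021 + 0.8 * (h / 3) + 4 * (h / 3)\<^sup>2) =
    l + (1.94222 - L + 0.2895 * pi + 0.063) + h * (1.94222 - L + 0.2895 * pi - l + 0.8 + 4 / 3 * h)"
    unfolding e by (simp add: algebra_simps power2_eq_square)
  moreover have "h * (1.94222 - L + 0.2895 * pi - l + 0.8 + 4 / 3 * h) \<le> 0"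
  proof (rule mult_nonneg_nonpos)
    show "1.94222 - L + 0.2895 * pi - l + 0.8 + 4 / 3 * h \<le> 0" using pi_upper L l h3 by simp
  qed (use h in simp)
  moreover have "1.94222 - L + 0.2895 * pi + 0.063 \<le> - 0.02012" using pi_upper L by simp
  ultimately show ?thesis unfolding l_def by simp
qed

theorem theorem1:
  fixes q :: nat and chi :: "int \<Rightarrow> complex"
  assumes "q > 1"
    and "primitive_dirichlet_character q chi"
    and "chi (-1) = 1"
    and "chi 2 = 1"
  shows "norm (Dirichlet_L chi 1) \<le> 1 / 2 * ln (real q) - 0.02012"
proof -
  have q11: "11 \<le> q" using modulus_ge_11 assms by blast
  have dc: "dirichlet_character q chi" using assms(2) by (simp add: primitive_dirichlet_character_def)
  define t where "t = (\<Sum>a\<in>{0..<int q}. cnj (chi a) * cis (2 * pi * of_int a / q))"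
  have nt: "norm t = sqrt q" unfolding t_def by (rule norm_gauss_sum[OF assms(2)])
  obtain \<omega> :: complex where \<omega>: "norm \<omega> = 1" "Re (\<omega> * Dirichlet_L chi 1) = norm (Dirichlet_L chi 1)"
  proof -
    have "cis (- Arg z) * z = of_real (norm z)" for z
      using arg_cong[OF rcis_cmod_Arg[of z], of "\<lambda>y. cis (- Arg z) * y"] by (simp add: rcis_def mult.left_commute cis_mult)
    then show ?thesis by (intro that[of "cis (- Arg (Dirichlet_L chi 1))"]) simp_all
  qed
  define h where "h = 1 / sqrt q"
  have h: "h > 0" using q11 by (simp add: h_def)
  define c where "c n = Re (\<omega> * chi (int n))" for n
  define d where "d m = Re (\<omega> * (of_real (sqrt q) / t) * cnj (chi (int m)))" for m
  have c1: "\<bar>c n\<bar> \<le> 1" for n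
    using abs_Re_le_cmod[of "\<omega> * chi (int n)"] dirichlet_character_norm_le[OF dc, of "int n"] \<omega>(1)
    unfolding c_def by (simp add: norm_mult)
  have d1: "\<bar>d m\<bar> \<le> 1" for m
  proof -
    have "norm (\<omega> * (of_real (sqrt q) / t) * cnj (chi (int m))) = norm (chi (int m))"
      using \<omega>(1) nt q11 by (simp add: norm_mult norm_divide)
    then show ?thesis unfolding d_def
      using abs_Re_le_cmod[of "\<omega> * (of_real (sqrt q) / t) * cnj (chi (int m))"] dirichlet_character_norm_le[OF dc, of "int m"] by linarith
  qed
  have d2: "d (2 * m) = d m" for m
    using dc assms(4) by (simp add: d_def dirichlet_character_def)
  have \<kappa>: "2 * pi / q > 0" using q11 by simp
  have pair: "dual_pair (\<lambda>n. c (Suc n)) (\<lambda>m. d (Suc m)) h (2 * pi / q) smooth_fun (\<lambda>x. dual_fun (1 / x))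
      (\<lambda>w. norm (Dirichlet_L chi 1) + 0 * (1.94222 - ln w) + 0.0965 * 0 * w)"
    by (rule dual_pair_smooth[OF _ c1 d1 \<kappa>])
      (use dual_pair_even_primitive[OF assms(2,1,3), of \<omega>] in \<open>simp only: c_def d_def h_def t_def \<omega>(2)\<close>)
  \<comment> \<open>For \<open>w = a * h\<close> the part of the bound beyond
    \<open>ln q / 2\<close> that has no factor \<open>h\<close> is
    \<open>1.94222 - ln a + 0.04825 * a + 0.021 * a / (2 * pi)\<close>. It is minimal near
    \<open>a = 19.4\<close>; the nearby value \<open>6 * pi\<close> makes the spacing of the dual
    points exactly \<open>h / 3\<close>.\<close>
  define w where "w = 6 * pi * h"
  have w: "w > 0" using h by (simp add: w_def)
  have arg: "1 / (w / (2 * pi / q * real (Suc m))) = real (Suc m) * (h / 3)" for m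
  proof -
    have "h * q = 1 / h" using q11 by (simp add: h_def real_div_sqrt)
    moreover have "w / (2 * pi / q * real (Suc m)) = 3 * (h * q) / real (Suc m)"
      by (simp add: w_def del: of_nat_Suc)
    ultimately show ?thesis by (simp del: of_nat_Suc)
  qed
  have sc: "summable (\<lambda>n. c (Suc n) * smooth_fun (w * real (Suc n)) / real (Suc n))"
    and eq: "norm (Dirichlet_L chi 1) = (\<Sum>n. c (Suc n) * smooth_fun (w * real (Suc n)) / real (Suc n)) +
      h * (\<Sum>m. d (Suc m) * dual_fun (real (Suc m) * (h / 3)))"
    using pair[unfolded dual_pair_def, rule_format, OF w] unfolding arg by simp_all
  have "(\<Sum>n. c (Suc n) * smooth_fun (w * real (Suc n)) / real (Suc n)) \<le> (\<Sum>n. smooth_fun (w * real (Suc n)) / real (Suc n))"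
  proof (rule suminf_le[OF _ sc sums_smooth_trivial(1)[OF w]])
    fix n
    have "c (Suc n) * smooth_fun (w * real (Suc n)) \<le> 1 * smooth_fun (w * real (Suc n))"
      by (intro mult_right_mono smooth_fun_nonneg) (use c1[of "Suc n"] w in auto)
    then show "c (Suc n) * smooth_fun (w * real (Suc n)) / real (Suc n) \<le> smooth_fun (w * real (Suc n)) / real (Suc n)"
      by (intro divide_right_mono) auto
  qed
  also have "\<dots> \<le> 1.94222 - ln w + 0.04825 * w"
  proof (rule smooth_sum_le[OF w])
    have "sqrt 9 \<le> sqrt q" using q11 by (intro real_sqrt_le_mono) simp
    then have "h \<le> 1 / 3" unfolding h_def by (intro divide_left_mono) (use q11 in auto)
    then have "6 * pi * h \<le> 6 * pi * (1 / 3)" by (intro mult_left_mono) auto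
    then show "w \<le> 10 / 3 * pi" unfolding w_def using pi_gt_zero by linarith
  qed
  finally have first: "(\<Sum>n. c (Suc n) * smooth_fun (w * real (Suc n)) / real (Suc n)) \<le> 1.94222 - ln w + 0.04825 * w" .
  define S where "S = (\<Sum>m. d (Suc m) * dual_fun (real (Suc m) * (h / 3)))"
  define T where "T = (\<Sum>m. dual_fun (real (Suc m) * (h / 3)))"
  have "2 * (h / 3) * \<bar>S\<bar> \<le> 2 * (h / 3) * T + 2 * (0.021 + 0.8 * (h / 3) + 4 * (h / 3)\<^sup>2)"
    unfolding S_def T_def by (rule dual_fun_dyadic_weighted_sum_le[of d, OF d1 d2]) (use h in simp)
  moreover have "h * S \<le> h * \<bar>S\<bar>" using h by (intro mult_left_mono) auto
  \<comment> \<open>The factor 3 arises from the doubled loss times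
    \<open>h / (2 * (h / 3)) = 3 / 2\<close>.\<close>
  ultimately have "h * S \<le> h * T + 3 * (0.021 + 0.8 * (h / 3) + 4 * (h / 3)\<^sup>2)" by (simp add: field_simps)
  moreover have "h * T \<le> h * (1.94222 - ln (6 * pi / h) + 0.04825 * (6 * pi / h))"
    using dual_fun_sum_le[of "h / 3"] h unfolding T_def by (intro mult_left_mono) auto
  ultimately have "norm (Dirichlet_L chi 1) \<le> (1.94222 - ln (6 * pi * h) + 0.04825 * (6 * pi * h)) +
      h * (1.94222 - ln (6 * pi / h) + 0.04825 * (6 * pi / h)) + 3 * (0.021 + 0.8 * (h / 3) + 4 * (h / 3)\<^sup>2)"
    using first unfolding eq S_def [symmetric] w_def by linarith
  also have "\<dots> \<le> 1 / 2 * ln (real q) - 0.02012"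
    unfolding h_def by (rule final_numerical_bound) (use q11 in simp)
  finally show ?thesis .
qed

end
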